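(* Let $1<p<\infty$ and let $q$ be its conjugate exponent. For every $(\psi, \phi) \in M^{*q} \times M^p$, $$\tilde{B}(\psi, S(t)\phi) = \tilde{B}(S^*(t)\psi, \phi)$$ holds for all $t \ge 0$.
   Context: Let $r>0$ and let $n$ be a positive integer. $\mathbb{C}^n$ denotes column vectors, $(\mathbb{C}^n)'$ denotes $n$-dimensional complex row vectors, $M_n(\mathbb{C})$ the $n\times n$ complex matrices. Let $\eta=(\eta_{ij})\colon [-r,0]\to M_n(\mathbb{C})$ be a function of bounded variation. Integrals against $d\eta$ are Riemann–Stieltjes integrals taken componentwise: for continuous $\phi$ (column valued) and $\psi$ (row valued), $\left(\int d\eta(\theta)\,\phi(\theta)\right)_i=\sum_j\int \phi_j(\theta)\,d\eta_{ij}(\theta)$ and $\left(\int \psi(\theta)\,d\eta(\theta)\right)_j=\sum_i\int \psi_i(\theta)\,d\eta_{ij}(\theta)$. Write $C=C([-r,0],\mathbb{C}^n)$ and $C^*=C([0,r],(\mathbb{C}^n)')$ (supremum norms). Define $L\colon C\to\mathbb{C}^n$, $L\phi=\int_{-r}^0 d\eta(\theta)\,\phi(\theta)$, and $L^*\colon C^*\to(\mathbb{C}^n)'$, $L^*\psi=\int_{-r}^0\psi(-\theta)\,d\eta(\theta)$. The bilinear form $B\colon C^*\times C\to\mathbb{C}$ is $$B(\psi,\phi)=\psi(0)\phi(0)+\int_{-r}^0\left(\int_{-r}^{\xi}\psi(\xi-\theta)\,d\eta(\theta)\right)\phi(\xi)\,d\xi ,$$ where the inner integral, as a function of $\xi\in[-r,0]$,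 is Riemann integrable. Let $m$ be the sum of the Lebesgue measure on $[-r,0]$ and the Dirac measure at $0$, and let $m^*$ be the sum of the Lebesgue measure on $[0,r]$ and the Dirac measure at $0$. For $1\le p,q\le\infty$ set $M^p=L^p(([-r,0],m),\mathbb{C}^n)$ and $M^{*q}=L^q(([0,r],m^* ),(\mathbb{C}^n)')$; elements have well-defined values at $0$. $C$ and $C^*$ are regarded as (dense, for finite exponents) subspaces of $M^p$ and $M^{*q}$. For conjugate exponents $1<p,q<\infty$, $\tilde B\colon M^{*q}\times M^p\to\mathbb{C}$ denotes the unique bounded bilinear form extending $B$ (which exists). Mild solutions. For $\phi\in M^1$, $x=x(\cdot;\phi)$ denotes the unique (known to exist) $\mathbb{C}^n$-valued locally integrable function on $[-r,\infty)$, defined at every point of $[0,\infty)$, such that $x(\theta)=\phi(\theta)$ for $m$-a.e. $\theta\in[-r,0]$ and $x(t)=\phi(0)+L\int_0^t x_s\,ds$ for all $t\ge0$, where $\int_0^t x_s\,ds\in C$ is defined by $\left(\int_0^t x_s\,ds\right)(\theta)=\int_0^t x(s+\theta)\,ds$ for $\theta\in[-r,0]$. For $\psi\in M^{*1}$, $y=y(\cdot;\psi)$ denotes the unique (known to exist) $(\mathbb{C}^n)'$-valued locally integrable function on $(-\infty,r]$, defined at every point of $(-\infty,0]$, such that $y(\tau)=\psi(\tau)$ for $m^*$-a.e. $\tau\in[0,r]$ and $y(t)=\psi(0)-L^*\int_0^t y^s\,ds$ for all $t\le0$, where $\int_0^t y^s\,ds\in C^*$ is defined by $\left(\int_0^t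 y^s\,ds\right)(\tau)=\int_0^t y(s+\tau)\,ds$ for $\tau\in[0,r]$. For $t\ge0$: $S(t)\colon M^p\to M^p$ is $S(t)\phi=x(\cdot;\phi)_t$, where $x(\cdot;\phi)_t(\theta)=x(t+\theta;\phi)$ for $m$-a.e. $\theta\in[-r,0]$; and $S^*(t)\colon M^{*q}\to M^{*q}$ is $S^*(t)\psi=y(\cdot;\psi)^{-t}$, where $y(\cdot;\psi)^{-t}(\tau)=y(-t+\tau;\psi)$ for $m^*$-a.e. $\tau\in[0,r]$. *)

theory Defs
  imports "HOL-Analysis.Analysis"
begin

text \<open>
  Column vectors and row vectors of length n are both represented by \<^typ>\<open>complex^'n\<close>, as in the
  library operations for matrix-vector and vector-matrix products.  Functions on an interval are
  total functions on the reals whose values outside that interval are irrelevant.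
\<close>

definition row_col_mult :: "complex^'n \<Rightarrow> complex^'n \<Rightarrow> complex" where
  "row_col_mult u v = (\<Sum>i\<in>UNIV. u $ i * v $ i)"

subsection \<open>Bounded variation and the Riemann--Stieltjes integral\<close>

definition bounded_variation_on :: "real \<Rightarrow> real \<Rightarrow> (real \<Rightarrow> 'a::real_normed_vector) \<Rightarrow> bool" where
  "bounded_variation_on a b g \<longleftrightarrow>
     (\<exists>K. \<forall>D. D division_of {a..b} \<longrightarrow> (\<Sum>k\<in>D. norm (g (Sup k) - g (Inf k))) \<le> K)"

text \<open>The gauge is a ball of constant radius, so this is the limit as the mesh tends to 0.\<close>

definition has_RS_integral ::
    "(real \<Rightarrow> complex) \<Rightarrow> (real \<Rightarrow> complex) \<Rightarrow> real \<Rightarrow> real \<Rightarrow> complex \<Rightarrow> bool" where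
  "has_RS_integral f g a b I \<longleftrightarrow>
     (\<forall>e>0. \<exists>d>0. \<forall>D. D tagged_division_of {a..b} \<and> (\<lambda>x. ball x d) fine D \<longrightarrow>
        norm ((\<Sum>(x, k)\<in>D. f x * (g (Sup k) - g (Inf k))) - I) < e)"

definition RS_integral ::
    "real \<Rightarrow> real \<Rightarrow> (real \<Rightarrow> complex) \<Rightarrow> (real \<Rightarrow> complex) \<Rightarrow> complex" where
  "RS_integral a b f g = (THE I. has_RS_integral f g a b I)"

definition RS_integral_col ::
    "real \<Rightarrow> real \<Rightarrow> (real \<Rightarrow> complex^'n^'n) \<Rightarrow> (real \<Rightarrow> complex^'n) \<Rightarrow> complex^'n" where
  "RS_integral_col a b \<eta> \<phi> =
     (\<chi> i. \<Sum>j\<in>UNIV. RS_integral a b (\<lambda>\<theta>. \<phi> \<theta> $ j) (\<lambda>\<theta>. \<eta> \<theta> $ i $ j))"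

definition RS_integral_row ::
    "real \<Rightarrow> real \<Rightarrow> (real \<Rightarrow> complex^'n) \<Rightarrow> (real \<Rightarrow> complex^'n^'n) \<Rightarrow> complex^'n" where
  "RS_integral_row a b \<psi> \<eta> =
     (\<chi> j. \<Sum>i\<in>UNIV. RS_integral a b (\<lambda>\<theta>. \<psi> \<theta> $ i) (\<lambda>\<theta>. \<eta> \<theta> $ i $ j))"

subsection \<open>The functionals and the bilinear form on continuous functions\<close>

definition L_op :: "real \<Rightarrow> (real \<Rightarrow> complex^'n^'n) \<Rightarrow> (real \<Rightarrow> complex^'n) \<Rightarrow> complex^'n" where
  "L_op r \<eta> \<phi> = RS_integral_col (-r) 0 \<eta> \<phi>"

definition L_star :: "real \<Rightarrow> (real \<Rightarrow> complex^'n^'n) \<Rightarrow> (real \<Rightarrow> complex^'n) \<Rightarrow> complex^'n" where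
  "L_star r \<eta> \<psi> = RS_integral_row (-r) 0 (\<lambda>\<theta>. \<psi> (-\<theta>)) \<eta>"

definition B_form ::
    "real \<Rightarrow> (real \<Rightarrow> complex^'n^'n) \<Rightarrow> (real \<Rightarrow> complex^'n) \<Rightarrow> (real \<Rightarrow> complex^'n) \<Rightarrow> complex" where
  "B_form r \<eta> \<psi> \<phi> =
     row_col_mult (\<psi> 0) (\<phi> 0) +
     integral {-r..0}
       (\<lambda>\<xi>. row_col_mult (RS_integral_row (-r) \<xi> (\<lambda>\<theta>. \<psi> (\<xi> - \<theta>)) \<eta>) (\<phi> \<xi>))"

subsection \<open>The spaces $M^p$ and $M^{*q}$\<close>

text \<open>Lebesgue measure on \<open>S\<close> plus the Dirac measure at 0.\<close>

definition lebesgue_plus_dirac :: "real set \<Rightarrow> real measure" where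
  "lebesgue_plus_dirac S =
     measure_of S (sets (lebesgue_on S)) (\<lambda>A. emeasure (lebesgue_on S) A + indicator A 0)"

text \<open>The measure is the intended one (and not the zero default of \<^const>\<open>measure_of\<close>).\<close>

lemma space_lebesgue_plus_dirac [simp]: "space (lebesgue_plus_dirac S) = S"
  and sets_lebesgue_plus_dirac [simp]: "sets (lebesgue_plus_dirac S) = sets (lebesgue_on S)"
proof -
  have *: "sets (lebesgue_on S) \<subseteq> Pow S"
    using sets.space_closed[of "lebesgue_on S"] by simp
  show "space (lebesgue_plus_dirac S) = S"
    unfolding lebesgue_plus_dirac_def by (rule space_measure_of[OF *])
  show "sets (lebesgue_plus_dirac S) = sets (lebesgue_on S)"
    unfolding lebesgue_plus_dirac_def
    using sets.sigma_sets_eq[of "lebesgue_on S"] by (simp add: sets_measure_of[OF *])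
qed

lemma emeasure_lebesgue_plus_dirac:
  assumes "A \<in> sets (lebesgue_on S)"
  shows "emeasure (lebesgue_plus_dirac S) A = emeasure (lebesgue_on S) A + indicator A 0"
proof (rule emeasure_measure_of[OF lebesgue_plus_dirac_def])
  show "sets (lebesgue_on S) \<subseteq> Pow S"
    using sets.space_closed[of "lebesgue_on S"] by simp
  show "A \<in> sets (lebesgue_plus_dirac S)"
    using assms by simp
  show "positive (sets (lebesgue_plus_dirac S)) (\<lambda>A. emeasure (lebesgue_on S) A + indicator A 0)"
    by (simp add: positive_def)
  show "countably_additive (sets (lebesgue_plus_dirac S))
      (\<lambda>A. emeasure (lebesgue_on S) A + indicator A 0)"
  proof (rule countably_additiveI)
    fix F :: "nat \<Rightarrow> real set"
    assume F: "range F \<subseteq> sets (lebesgue_plus_dirac S)" "disjoint_family F"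
    have "(\<Sum>i. emeasure (lebesgue_on S) (F i) + indicator (F i) 0) =
        (\<Sum>i. emeasure (lebesgue_on S) (F i)) + (\<Sum>i. indicator (F i) (0::real) :: ennreal)"
      by (rule suminf_add[symmetric]) auto
    also have "\<dots> = emeasure (lebesgue_on S) (\<Union>i. F i) + indicator (\<Union>i. F i) 0"
      using F by (simp add: suminf_emeasure suminf_indicator)
    finally show "(\<Sum>i. emeasure (lebesgue_on S) (F i) + indicator (F i) 0) =
        emeasure (lebesgue_on S) (\<Union>i. F i) + indicator (\<Union>i. F i) 0" .
  qed
qed

text \<open>
  Elements of the Lebesgue spaces are given by representatives; only finite exponents occur.
\<close>

definition Lp_space :: "'a measure \<Rightarrow> real \<Rightarrow> ('a \<Rightarrow> complex^'n) set" where
  "Lp_space M p = {f \<in> borel_measurable M. integrable M (\<lambda>x. norm (f x) powr p)}"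

definition Lp_norm :: "'a measure \<Rightarrow> real \<Rightarrow> ('a \<Rightarrow> complex^'n) \<Rightarrow> real" where
  "Lp_norm M p f = (LINT x|M. norm (f x) powr p) powr (1 / p)"

definition m_measure :: "real \<Rightarrow> real measure" where
  "m_measure r = lebesgue_plus_dirac {-r..0}"

definition m_star_measure :: "real \<Rightarrow> real measure" where
  "m_star_measure r = lebesgue_plus_dirac {0..r}"

definition M_space :: "real \<Rightarrow> real \<Rightarrow> (real \<Rightarrow> complex^'n) set" where
  "M_space r p = Lp_space (m_measure r) p"

definition M_star_space :: "real \<Rightarrow> real \<Rightarrow> (real \<Rightarrow> complex^'n) set" where
  "M_star_space r q = Lp_space (m_star_measure r) q"

subsection \<open>The extended bilinear form\<close>

text \<open>
  The norm bound makes the form independent of the choice of representatives.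
\<close>

definition bounded_bilinear_extension ::
    "real \<Rightarrow> (real \<Rightarrow> complex^'n^'n) \<Rightarrow> real \<Rightarrow> real \<Rightarrow>
     ((real \<Rightarrow> complex^'n) \<Rightarrow> (real \<Rightarrow> complex^'n) \<Rightarrow> complex) \<Rightarrow> bool" where
  "bounded_bilinear_extension r \<eta> p q \<beta> \<longleftrightarrow>
     (\<forall>\<psi>\<^sub>1\<in>M_star_space r q. \<forall>\<psi>\<^sub>2\<in>M_star_space r q. \<forall>\<phi>\<in>M_space r p.
        \<beta> (\<lambda>\<tau>. \<psi>\<^sub>1 \<tau> + \<psi>\<^sub>2 \<tau>) \<phi> = \<beta> \<psi>\<^sub>1 \<phi> + \<beta> \<psi>\<^sub>2 \<phi>) \<and>
     (\<forall>\<psi>\<in>M_star_space r q. \<forall>\<phi>\<^sub>1\<in>M_space r p. \<forall>\<phi>\<^sub>2\<in>M_space r p.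
        \<beta> \<psi> (\<lambda>\<theta>. \<phi>\<^sub>1 \<theta> + \<phi>\<^sub>2 \<theta>) = \<beta> \<psi> \<phi>\<^sub>1 + \<beta> \<psi> \<phi>\<^sub>2) \<and>
     (\<forall>c. \<forall>\<psi>\<in>M_star_space r q. \<forall>\<phi>\<in>M_space r p.
        \<beta> (\<lambda>\<tau>. c *s \<psi> \<tau>) \<phi> = c * \<beta> \<psi> \<phi> \<and> \<beta> \<psi> (\<lambda>\<theta>. c *s \<phi> \<theta>) = c * \<beta> \<psi> \<phi>) \<and>
     (\<exists>K. \<forall>\<psi>\<in>M_star_space r q. \<forall>\<phi>\<in>M_space r p.
        norm (\<beta> \<psi> \<phi>) \<le> K * Lp_norm (m_star_measure r) q \<psi> * Lp_norm (m_measure r) p \<phi>) \<and>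
     (\<forall>\<psi> \<phi>. continuous_on {0..r} \<psi> \<and> continuous_on {-r..0} \<phi> \<longrightarrow> \<beta> \<psi> \<phi> = B_form r \<eta> \<psi> \<phi>)"

text \<open>
  \<open>SOME\<close> instead of \<open>THE\<close>, because the extension is unique only on the product of the two spaces,
  not as a total function.
\<close>

definition B_tilde ::
    "real \<Rightarrow> (real \<Rightarrow> complex^'n^'n) \<Rightarrow> real \<Rightarrow> real \<Rightarrow>
     (real \<Rightarrow> complex^'n) \<Rightarrow> (real \<Rightarrow> complex^'n) \<Rightarrow> complex" where
  "B_tilde r \<eta> p q = (SOME \<beta>. bounded_bilinear_extension r \<eta> p q \<beta>)"

subsection \<open>Mild solutions and the solution operators\<close>

definition is_mild_solution ::
    "real \<Rightarrow> (real \<Rightarrow> complex^'n^'n) \<Rightarrow> (real \<Rightarrow> complex^'n) \<Rightarrow> (real \<Rightarrow> complex^'n) \<Rightarrow> bool" where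
  "is_mild_solution r \<eta> \<phi> x \<longleftrightarrow>
     (\<forall>T. x absolutely_integrable_on {-r..T}) \<and>
     (AE \<theta> in m_measure r. x \<theta> = \<phi> \<theta>) \<and>
     (\<forall>t\<ge>0. x t = \<phi> 0 + L_op r \<eta> (\<lambda>\<theta>. integral {0..t} (\<lambda>s. x (s + \<theta>))))"

text \<open>For \<open>t \<le> 0\<close> the oriented integral from 0 to \<open>t\<close> is minus the integral over \<open>{t..0}\<close>.\<close>

definition is_adjoint_mild_solution ::
    "real \<Rightarrow> (real \<Rightarrow> complex^'n^'n) \<Rightarrow> (real \<Rightarrow> complex^'n) \<Rightarrow> (real \<Rightarrow> complex^'n) \<Rightarrow> bool" where
  "is_adjoint_mild_solution r \<eta> \<psi> y \<longleftrightarrow>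
     (\<forall>T. y absolutely_integrable_on {T..r}) \<and>
     (AE \<tau> in m_star_measure r. y \<tau> = \<psi> \<tau>) \<and>
     (\<forall>t\<le>0. y t = \<psi> 0 - L_star r \<eta> (\<lambda>\<tau>. - integral {t..0} (\<lambda>s. y (s + \<tau>))))"

text \<open>
  A mild solution is unique only up to changes on a null set of negative times and outside its
  domain, whence \<open>SOME\<close>; similarly for the adjoint equation.
\<close>

definition mild_solution ::
    "real \<Rightarrow> (real \<Rightarrow> complex^'n^'n) \<Rightarrow> (real \<Rightarrow> complex^'n) \<Rightarrow> real \<Rightarrow> complex^'n" where
  "mild_solution r \<eta> \<phi> = (SOME x. is_mild_solution r \<eta> \<phi> x)"

definition adjoint_mild_solution ::
    "real \<Rightarrow> (real \<Rightarrow> complex^'n^'n) \<Rightarrow> (real \<Rightarrow> complex^'n) \<Rightarrow> real \<Rightarrow> complex^'n" where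
  "adjoint_mild_solution r \<eta> \<psi> = (SOME y. is_adjoint_mild_solution r \<eta> \<psi> y)"

definition S_op ::
    "real \<Rightarrow> (real \<Rightarrow> complex^'n^'n) \<Rightarrow> real \<Rightarrow> (real \<Rightarrow> complex^'n) \<Rightarrow> real \<Rightarrow> complex^'n" where
  "S_op r \<eta> t \<phi> = (\<lambda>\<theta>. mild_solution r \<eta> \<phi> (t + \<theta>))"

definition S_star_op ::
    "real \<Rightarrow> (real \<Rightarrow> complex^'n^'n) \<Rightarrow> real \<Rightarrow> (real \<Rightarrow> complex^'n) \<Rightarrow> real \<Rightarrow> complex^'n" where
  "S_star_op r \<eta> t \<psi> = (\<lambda>\<tau>. adjoint_mild_solution r \<eta> \<psi> (-t + \<tau>))"

end

theory Submission
  imports Defs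
begin

text \<open>
  The extended form has an explicit formula.  For continuous \<open>\<psi>\<close> and \<open>\<phi>\<close>, exchanging the two
  integrations in the form \<open>B\<close> gives
  \<open>B \<psi> \<phi> = \<psi>(0) \<phi>(0) + \<integral> d\<eta>(\<theta>) c(\<theta>)\<close> with the correlation
  \<open>c(\<theta>) = \<integral>\<^sub>\<theta>\<^sup>0 \<psi>(\<xi> - \<theta>) \<phi>(\<xi>) d\<xi>\<close>.  For conjugate exponents, the correlation of an \<open>L\<^sup>q\<close> and an
  \<open>L\<^sup>p\<close> function is still continuous and bounded by the product of the norms, so the right-hand
  side, called \<open>pairing\<close> below, is a bounded bilinear extension of \<open>B\<close>; as continuous functions
  are dense, it is the only one (\<open>B_form_eq_pairing\<close>, \<open>pairing_is_extension\<close>,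
  \<open>extension_unique\<close>).

  Time reversal turns the adjoint equation for \<open>\<eta>\<close> into the original equation for the transposed
  kernel (\<open>adjoint_mild_solution_iff\<close>).  Hence one existence proof, a contraction argument with an
  exponential weight, serves both equations.  With \<open>x\<close> the solution for \<open>\<phi>\<close> and \<open>z(t) = y(-t)\<close> the
  reversed solution for \<open>\<psi>\<close>, the claim is that the pairings of \<open>z(-\<cdot>)\<close> with \<open>x(t + \<cdot>)\<close> and of
  \<open>z(t - \<cdot>)\<close> with \<open>x\<close> agree.

  For smooth data one would differentiate \<open>s \<mapsto> pairing (z(t - s - \<cdot>)) (x(s + \<cdot>))\<close> and find 0.
  Mild solutions need not be differentiable, so the equations are used in integrated form.  Write
  \<open>x\<^sup>\<theta>(s) = x(s + \<theta>)\<close> and \<open>f * g\<close> for convolution on \<open>[0, t]\<close>, so that \<open>1 * g\<close> is the primitive of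
  \<open>g\<close>.  The equations read \<open>x = x(0) + \<integral> d\<eta>(\<theta>) (1 * x\<^sup>\<theta>)\<close> and \<open>z = z(0) + \<integral> (1 * z\<^sup>\<theta>) d\<eta>(\<theta>)\<close>.
  Convolving the first with \<open>z\<close>, the second with \<open>x\<close>, and subtracting gives \<open>1 * D = 0\<close> for
  \<open>D(t) = z(0) x(t) - z(t) x(0) + \<integral> d\<eta>(\<theta>) (z\<^sup>\<theta> * x - z * x\<^sup>\<theta>)(t)\<close>, because convolution is
  commutative and associative.  Since \<open>D\<close> is continuous, it vanishes
  (\<open>mild_solutions_reciprocity\<close>), and a change of variables shows that \<open>D(t)\<close> is the difference of
  the two pairings (\<open>correlation_diff_eq_shifted_convolution_diff\<close>).

  Only continuous functions are ever integrated against \<open>\<eta>\<close>.  The facts needed about these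
  Stieltjes integrals follow from a monotone function that dominates the increments of \<open>\<eta>\<close> and from
  convergence of sums over partitions with mesh tending to 0.
\<close>

section \<open>Functions of bounded variation\<close>

text \<open>The function \<open>W\<close> plays the role of the total variation of \<open>g\<close> on \<open>[a, t]\<close>.  In contrast to a
  bound on the total variation, such a \<open>W\<close> localises: it serves every subinterval, and sums of
  increments over a partition telescope.\<close>

definition increments_dominated :: "real \<Rightarrow> real \<Rightarrow> (real \<Rightarrow> 'a::real_normed_vector) \<Rightarrow> (real \<Rightarrow> real) \<Rightarrow> bool" where
  "increments_dominated a b g W \<longleftrightarrow> (\<forall>u v. a \<le> u \<and> u \<le> v \<and> v \<le> b \<longrightarrow> norm (g v - g u) \<le> W v - W u)"

lemma increments_dominatedD:
  "increments_dominated a b g W \<Longrightarrow> a \<le> u \<Longrightarrow> u \<le> v \<Longrightarrow> v \<le> b \<Longrightarrow> norm (g v - g u) \<le> W v - W u"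
  unfolding increments_dominated_def by blast

lemma increments_dominated_mono:
  assumes "increments_dominated a b g W"
  shows "mono_on {a..b} W"
proof (rule mono_onI)
  fix u v assume "u \<in> {a..b}" "v \<in> {a..b}" "u \<le> v"
  then have "norm (g v - g u) \<le> W v - W u"
    using increments_dominatedD[OF assms] by auto
  then show "W u \<le> W v"
    using norm_ge_zero[of "g v - g u"] by linarith
qed

lemma increments_dominated_subinterval:
  "increments_dominated a b g W \<Longrightarrow> a \<le> c \<Longrightarrow> d \<le> b \<Longrightarrow> increments_dominated c d g W"
  unfolding increments_dominated_def by (meson order_trans)

lemma division_extend_Icc:
  fixes a u v :: real
  assumes D: "D division_of {a..u}" and "a \<le> u" "u < v"
  shows "insert {u..v} D division_of {a..v}" "{u..v} \<notin> D"
proof -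
  show *: "{u..v} \<notin> D"
  proof
    assume "{u..v} \<in> D"
    then have "{u..v} \<subseteq> {a..u}" using division_ofD(2)[OF D] by blast
    then show False using \<open>u < v\<close> by auto
  qed
  have 2: "{{u..v}} division_of {u..v}"
    using division_of_self[of u v] \<open>u < v\<close> by auto
  have "D \<union> {{u..v}} division_of {a..u} \<union> {u..v}"
  proof (rule division_disjoint_union[OF D 2])
    show "interior {a..u} \<inter> interior {u..v} = {}" by auto
  qed
  moreover have "{a..u} \<union> {u..v} = {a..v}" using assms by auto
  ultimately show "insert {u..v} D division_of {a..v}" by simp
qed

text \<open>Take for \<open>W t\<close> the supremum of the variation sums over \<open>{a..t}\<close>: a division of \<open>{a..u}\<close> together
  with the interval \<open>{u..v}\<close> is a division of \<open>{a..v}\<close>.\<close>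

lemma bounded_variation_on_dominated:
  assumes bv: "bounded_variation_on a b g"
  obtains W where "increments_dominated a b g W"
proof -
  obtain K where K: "\<And>D. D division_of {a..b} \<Longrightarrow> (\<Sum>k\<in>D. norm (g (Sup k) - g (Inf k))) \<le> K"
    using bv unfolding bounded_variation_on_def by blast
  define sm where "sm D = (\<Sum>k\<in>D. norm (g (Sup k) - g (Inf k)))" for D
  define W where "W t = (SUP D\<in>{D. D division_of {a..t}}. sm D)" for t
  have ext: "sm (insert {u..v} D) = sm D + norm (g v - g u)"
    if D: "D division_of {a..u}" and uv: "a \<le> u" "u < v" for D u v
    using division_extend_Icc(2)[OF that] division_ofD(1)[OF D] uv
    by (simp add: sm_def add.commute)
  have bdd: "sm D \<le> K" if D: "D division_of {a..t}" and t: "a \<le> t" "t \<le> b" for D t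
  proof (cases "t = b")
    case True then show ?thesis using K D by (simp add: sm_def)
  next
    case False
    then have "t < b" using t by simp
    have "sm D \<le> sm (insert {t..b} D)" using ext[OF D \<open>a \<le> t\<close> \<open>t < b\<close>] by simp
    also have "\<dots> \<le> K" using K[OF division_extend_Icc(1)[OF D \<open>a \<le> t\<close> \<open>t < b\<close>]] by (simp add: sm_def)
    finally show ?thesis .
  qed
  have bda: "bdd_above (sm ` {D. D division_of {a..t}})" if "a \<le> t" "t \<le> b" for t
    using bdd[OF _ that] by (auto intro!: bdd_aboveI2)
  have ne: "{D. D division_of {a..t}} \<noteq> {}" if "a \<le> t" for t :: real
    using division_of_self[of a t] that by auto
  have "norm (g v - g u) \<le> W v - W u" if uv: "a \<le> u" "u \<le> v" "v \<le> b" for u v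
  proof (cases "u = v")
    case False
    then have "u < v" using uv by simp
    have "W u \<le> W v - norm (g v - g u)"
      unfolding W_def[of u]
    proof (rule cSUP_least[OF ne[OF uv(1)]], clarify)
      fix D assume D: "D division_of {a..u}"
      have "sm (insert {u..v} D) \<le> W v"
        unfolding W_def by (rule cSUP_upper)
          (use division_extend_Icc(1)[OF D uv(1) \<open>u < v\<close>] bda[of v] uv in auto)
      then show "sm D \<le> W v - norm (g v - g u)"
        using ext[OF D uv(1) \<open>u < v\<close>] by simp
    qed
    then show ?thesis by simp
  qed simp
  then show thesis
    using that[of W] by (auto simp: increments_dominated_def)
qed

text \<open>Both \<open>Re g + W\<close> and \<open>Im g + W\<close> are monotone, so \<open>g\<close> is measurable; it is also bounded.\<close>

lemma increments_dominated_absolutely_integrable: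
  fixes g :: "real \<Rightarrow> complex"
  assumes dom: "increments_dominated a b g W"
  shows "g absolutely_integrable_on {a..b}"
proof (rule measurable_bounded_by_integrable_imp_absolutely_integrable)
  have W: "W \<in> borel_measurable (lebesgue_on {a..b})"
    using integrable_mono_on[OF increments_dominated_mono[OF dom]] by auto
  have "mono_on {a..b} (\<lambda>x. Re (g x) + W x)"
  proof (rule mono_onI)
    fix u v assume "u \<in> {a..b}" "v \<in> {a..b}" "u \<le> v"
    then show "Re (g u) + W u \<le> Re (g v) + W v"
      using increments_dominatedD[OF dom, of u v] abs_Re_le_cmod[of "g v - g u"] by auto
  qed
  from integrable_mono_on[OF this] have "(\<lambda>x. Re (g x) + W x) \<in> borel_measurable (lebesgue_on {a..b})"
    by auto
  from borel_measurable_diff[OF this W] have re: "(\<lambda>x. Re (g x)) \<in> borel_measurable (lebesgue_on {a..b})"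
    by simp
  have "mono_on {a..b} (\<lambda>x. Im (g x) + W x)"
  proof (rule mono_onI)
    fix u v assume "u \<in> {a..b}" "v \<in> {a..b}" "u \<le> v"
    then show "Im (g u) + W u \<le> Im (g v) + W v"
      using increments_dominatedD[OF dom, of u v] abs_Im_le_cmod[of "g v - g u"] by auto
  qed
  from integrable_mono_on[OF this] have "(\<lambda>x. Im (g x) + W x) \<in> borel_measurable (lebesgue_on {a..b})"
    by auto
  from borel_measurable_diff[OF this W] have im: "(\<lambda>x. Im (g x)) \<in> borel_measurable (lebesgue_on {a..b})"
    by simp
  show "g \<in> borel_measurable (lebesgue_on {a..b})"
    using re im by (simp add: borel_measurable_complex_iff)
  show "(\<lambda>x. norm (g a) + (W b - W a)) integrable_on {a..b}"
    by (simp add: integrable_const_ivl)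
  show "norm (g x) \<le> norm (g a) + (W b - W a)" if "x \<in> {a..b}" for x
    using that increments_dominatedD[OF dom, of a x] increments_dominatedD[OF dom, of x b]
      norm_triangle_ineq2[of "g x" "g a"] norm_ge_zero[of "g b - g x"] 
    by (auto simp del: norm_ge_zero)
qed simp

definition RS_sum :: "(real \<Rightarrow> complex) \<Rightarrow> (real \<Rightarrow> complex) \<Rightarrow> (real \<times> real set) set \<Rightarrow> complex" where
  "RS_sum f g D = (\<Sum>(x, k)\<in>D. f x * (g (Sup k) - g (Inf k)))"

lemma tagged_division_of_IccE:
  fixes a b :: real
  assumes "D tagged_division_of {a..b}" "(x, k) \<in> D"
  obtains u v where "k = {u..v}" "u \<le> x" "x \<le> v" "a \<le> u" "v \<le> b" "Sup k = v" "Inf k = u"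
proof -
  obtain u v where k: "k = cbox u v" using tagged_division_ofD(4)[OF assms] by blast
  moreover have "x \<in> k" "k \<subseteq> {a..b}" using tagged_division_ofD(2,3)[OF assms] by auto
  ultimately show thesis using that[of u v] by auto
qed

lemma RS_sum_diff_le:
  assumes dom: "increments_dominated a b g W" and "a \<le> b" and D: "D tagged_division_of {a..b}"
    and le: "\<And>x. x \<in> {a..b} \<Longrightarrow> norm (f x - h x) \<le> e"
  shows "norm (RS_sum f g D - RS_sum h g D) \<le> e * (W b - W a)"
proof -
  have "RS_sum f g D - RS_sum h g D = (\<Sum>(x, k)\<in>D. (f x - h x) * (g (Sup k) - g (Inf k)))"
    by (simp add: RS_sum_def left_diff_distrib case_prod_unfold flip: sum_subtractf)
  also have "norm \<dots> \<le> (\<Sum>(x, k)\<in>D. e * (W (Sup k) - W (Inf k)))"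
  proof (rule sum_norm_le, clarify)
    fix x k assume xk: "(x, k) \<in> D"
    obtain u v where k: "k = {u..v}" "u \<le> x" "x \<le> v" "a \<le> u" "v \<le> b" "Sup k = v" "Inf k = u"
      using tagged_division_of_IccE[OF D xk] .
    have "e \<ge> 0" using le[of x] norm_ge_zero[of "f x - h x"] k by (auto simp del: norm_ge_zero)
    then show "norm ((f x - h x) * (g (Sup k) - g (Inf k))) \<le> e * (W (Sup k) - W (Inf k))"
      using le[of x] k increments_dominatedD[OF dom, of u v] by (auto simp: norm_mult intro!: mult_mono)
  qed
  also have "\<dots> = e * (\<Sum>(x, k)\<in>D. W (Sup k) - W (Inf k))"
    by (simp add: sum_distrib_left case_prod_unfold)
  also have "\<dots> = e * (W b - W a)"
    by (subst additive_tagged_division_1[OF \<open>a \<le> b\<close> D]) simp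
  finally show ?thesis .
qed

text \<open>For a continuously differentiable integrand, integration by parts predicts the value of the
  Stieltjes integral.  On a single interval \<open>{u..v}\<close> of the division with tag \<open>x\<close> the error equals
  \<open>(p x - p v) (g v - g u) + \<integral> p' (g - g u)\<close>, and both terms are at most \<open>M\<close> times the length
  times the increment of \<open>W\<close>; summing telescopes.\<close>

lemma RS_sum_C1_error:
  assumes dom: "increments_dominated a b g W" and ab: "a \<le> b"
    and deriv: "\<And>s. s \<in> {a..b} \<Longrightarrow> (p has_vector_derivative p' s) (at s within {a..b})"
    and cont: "continuous_on {a..b} p'" and M: "\<And>s. s \<in> {a..b} \<Longrightarrow> norm (p' s) \<le> M"
    and D: "D tagged_division_of {a..b}" and fine: "(\<lambda>x. ball x d) fine D" and d: "d > 0"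
  shows "norm (RS_sum p g D - (p b * g b - p a * g a - integral {a..b} (\<lambda>s. p' s * g s)))
           \<le> 4 * M * d * (W b - W a)"
proof -
  have M0: "M \<ge> 0" using M[of a] norm_ge_zero[of "p' a"] ab by (auto simp del: norm_ge_zero)
  have gi: "g absolutely_integrable_on {a..b}"
    by (rule increments_dominated_absolutely_integrable[OF dom])
  have pg: "(\<lambda>s. p' s * g s) integrable_on {a..b}"
  proof -
    have "bounded (p' ` {a..b})" using M unfolding bounded_iff by blast
    then have "(\<lambda>s. p' s * g s) absolutely_integrable_on {a..b}"
      by (intro absolutely_integrable_bounded_measurable_product[OF _ _ _ _ gi])
         (auto simp: bilinear_times cont continuous_imp_measurable_on_sets_lebesgue)
    then show ?thesis by (simp add: absolutely_integrable_on_def)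
  qed
  have 1: "p b * g b - p a * g a = (\<Sum>(x, k)\<in>D. p (Sup k) * g (Sup k) - p (Inf k) * g (Inf k))"
    by (rule additive_tagged_division_1[OF ab D, of "\<lambda>s. p s * g s", symmetric])
  have 2: "integral {a..b} (\<lambda>s. p' s * g s) = (\<Sum>(x, k)\<in>D. integral k (\<lambda>s. p' s * g s))"
    using integral_combine_tagged_division_topdown[of "\<lambda>s. p' s * g s" a b D] pg D by simp
  have "RS_sum p g D - (p b * g b - p a * g a - integral {a..b} (\<lambda>s. p' s * g s))
      = (\<Sum>(x, k)\<in>D. p x * (g (Sup k) - g (Inf k)) - (p (Sup k) * g (Sup k) - p (Inf k) * g (Inf k))
            + integral k (\<lambda>s. p' s * g s))"
    unfolding 1 2 RS_sum_def by (simp add: case_prod_unfold sum_subtractf sum.distrib)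
  also have "norm \<dots> \<le> (\<Sum>(x, k)\<in>D. 4 * M * d * (W (Sup k) - W (Inf k)))"
  proof (rule sum_norm_le, clarify)
    fix x k assume xk: "(x, k) \<in> D"
    obtain u v where k: "k = {u..v}" "u \<le> x" "x \<le> v" "a \<le> u" "v \<le> b" "Sup k = v" "Inf k = u"
      using tagged_division_of_IccE[OF D xk] .
    have "k \<subseteq> ball x d" using fine xk by (auto simp: fine_def)
    moreover have "u \<in> k" "v \<in> k" using k by auto
    ultimately have "u \<in> ball x d" "v \<in> ball x d" by blast+
    then have vu: "v - u \<le> 2 * d" by (auto simp: dist_real_def)
    have sub: "{u..v} \<subseteq> {a..b}" using k by auto
    define w where "w = W v - W u"
    have w: "w \<ge> 0" "norm (g v - g u) \<le> w"
      using increments_dominatedD[OF dom, of u v] k norm_ge_zero[of "g v - g u"]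
      by (auto simp: w_def simp del: norm_ge_zero)
    have w': "norm (g s - g u) \<le> w" if "s \<in> {u..v}" for s
      using that increments_dominatedD[OF dom, of u s] increments_dominatedD[OF dom, of s v] k
        norm_ge_zero[of "g v - g s"] unfolding w_def by (auto simp del: norm_ge_zero)
    have ftc: "(p' has_integral (p v - p u)) {u..v}"
      using k sub by (intro fundamental_theorem_of_calculus)
        (auto intro: has_vector_derivative_within_subset[OF deriv])
    have ftc': "(p' has_integral (p v - p x)) {x..v}"
      using k sub by (intro fundamental_theorem_of_calculus)
        (auto intro: has_vector_derivative_within_subset[OF deriv])
    have px: "norm (p v - p x) \<le> M * (v - x)"
      using has_integral_bound_real[OF M0 _ ftc', of "{}"] M k by auto
    have "M * (v - x) \<le> M * (2*d)" using vu k M0 by (intro mult_left_mono) auto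
    with px have px: "norm (p x - p v) \<le> M * (2*d)" by (simp add: norm_minus_commute)
    have i1: "((\<lambda>s. p' s * g s) has_integral integral {u..v} (\<lambda>s. p' s * g s)) {u..v}"
      using integrable_on_subinterval[OF pg sub] by (simp add: integrable_integral)
    have i2: "((\<lambda>s. p' s * g s - p' s * g u) has_integral
        (integral {u..v} (\<lambda>s. p' s * g s) - (p v - p u) * g u)) {u..v}"
      by (intro has_integral_diff i1 has_integral_mult_left ftc)
    have "norm (integral {u..v} (\<lambda>s. p' s * g s) - (p v - p u) * g u) \<le> (M * w) * measure lborel {u..v}"
    proof (rule has_integral_bound_real[of _ "{}"])
      show "norm (p' s * g s - p' s * g u) \<le> M * w" if "s \<in> {u..v} - {}" for s
      proof -
        have "norm (p' s * g s - p' s * g u) = norm (p' s) * norm (g s - g u)"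
          by (simp add: norm_mult flip: right_diff_distrib)
        also have "\<dots> \<le> M * w"
          using that M[of s] w'[of s] k M0 by (intro mult_mono) auto
        finally show ?thesis .
      qed
    qed (use M0 w i2 in auto)
    also have "\<dots> \<le> (M * w) * (2 * d)"
      using vu k M0 w by (intro mult_left_mono) auto
    finally have I: "norm (integral {u..v} (\<lambda>s. p' s * g s) - (p v - p u) * g u) \<le> (M * w) * (2 * d)" .
    have "p x * (g v - g u) - (p v * g v - p u * g u) + integral {u..v} (\<lambda>s. p' s * g s)
        = (p x - p v) * (g v - g u) + (integral {u..v} (\<lambda>s. p' s * g s) - (p v - p u) * g u)"
      by (simp add: algebra_simps)
    also have "norm \<dots> \<le> M * (2*d) * w + (M * w) * (2 * d)"
    proof (rule norm_triangle_le[OF add_mono[OF _ I]])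
      show "norm ((p x - p v) * (g v - g u)) \<le> M * (2 * d) * w"
        unfolding norm_mult using px w M0 d by (intro mult_mono) auto
    qed
    also have "\<dots> = 4 * M * d * w" by simp
    finally show "norm (p x * (g (Sup k) - g (Inf k)) - (p (Sup k) * g (Sup k) - p (Inf k) * g (Inf k))
            + integral k (\<lambda>s. p' s * g s)) \<le> 4 * M * d * (W (Sup k) - W (Inf k))"
      unfolding k(6,7) unfolding k(1) by (simp only: w_def)
  qed
  also have "\<dots> = 4 * M * d * (\<Sum>(x, k)\<in>D. W (Sup k) - W (Inf k))"
    by (simp add: sum_distrib_left case_prod_unfold)
  also have "\<dots> = 4 * M * d * (W b - W a)"
    by (subst additive_tagged_division_1[OF ab D]) simp
  finally show ?thesis .
qed

section \<open>The Riemann--Stieltjes integral of a continuous function\<close>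

lemma fine_ball_mono: "(\<lambda>x::real. ball x d) fine D \<Longrightarrow> d \<le> d' \<Longrightarrow> (\<lambda>x. ball x d') fine D"
  unfolding fine_def using subset_ball[of d d'] by (metis (no_types, lifting) subset_trans case_prodE case_prodI)

lemma has_RS_integral_unique:
  assumes I: "has_RS_integral f g a b I" and J: "has_RS_integral f g a b J"
  shows "I = J"
proof (rule ccontr)
  assume "I \<noteq> J"
  then have e: "norm (I - J) / 2 > 0" by simp
  obtain d1 where d1: "d1 > 0" "\<And>D. D tagged_division_of {a..b} \<Longrightarrow> (\<lambda>x. ball x d1) fine D \<Longrightarrow> norm (RS_sum f g D - I) < norm (I - J) / 2"
    using I e unfolding has_RS_integral_def RS_sum_def by meson
  obtain d2 where d2: "d2 > 0" "\<And>D. D tagged_division_of {a..b} \<Longrightarrow> (\<lambda>x. ball x d2) fine D \<Longrightarrow> norm (RS_sum f g D - J) < norm (I - J) / 2"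
    using J e unfolding has_RS_integral_def RS_sum_def by meson
  have "gauge (\<lambda>x::real. ball x (min d1 d2))" using d1 d2 by (auto simp: gauge_def)
  then obtain D where D: "D tagged_division_of {a..b}" "(\<lambda>x. ball x (min d1 d2)) fine D"
    using fine_division_exists_real by blast
  have "(\<lambda>x. ball x d1) fine D" "(\<lambda>x. ball x d2) fine D" using fine_ball_mono[OF D(2)] by auto
  then have "norm (RS_sum f g D - I) < norm (I - J) / 2" "norm (RS_sum f g D - J) < norm (I - J) / 2"
    using d1 d2 D by auto
  then have "norm (I - J) < norm (I - J) / 2 + norm (I - J) / 2"
    by (metis norm_diff_triangle_less norm_minus_commute)
  then show False by simp
qed

lemma RS_integral_eqI: "has_RS_integral f g a b I \<Longrightarrow> RS_integral a b f g = I"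
  unfolding RS_integral_def using has_RS_integral_unique by blast

lemma norm_diff_add_diff_le:
  fixes w x y z :: "'a::real_normed_vector"
  shows "norm (w - x + (y - z)) \<le> norm w + norm x + (norm y + norm z)"
  using norm_triangle_ineq[of "w - x" "y - z"] norm_triangle_ineq4[of w x] norm_triangle_ineq4[of y z]
  by linarith

text \<open>Approximate \<open>f\<close> uniformly by polynomials \<open>p n\<close>.  Their integrals exist by integration by parts,
  and form a Cauchy sequence because the Riemann--Stieltjes sums depend on the integrand with
  Lipschitz constant \<open>W b - W a\<close>.\<close>

lemma has_RS_integral_continuous:
  assumes dom: "increments_dominated a b g W" and ab: "a \<le> b" and f: "continuous_on {a..b} f"
  shows "has_RS_integral f g a b (RS_integral a b f g)"
proof -
  \<comment> \<open>The summand 1 permits the division by \<open>V\<close> if \<open>g\<close> is constant.\<close>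
  define V where "V = W b - W a + 1"
  have V: "V > 0" "W b - W a \<le> V"
    using increments_dominatedD[OF dom, of a b] ab norm_ge_zero[of "g b - g a"]
    by (auto simp: V_def simp del: norm_ge_zero)
  have "\<exists>p. polynomial_function p \<and> (\<forall>x\<in>{a..b}. norm (f x - p x) < e)" if "e > 0" for e
    using Stone_Weierstrass_polynomial_function[OF _ f that] by auto
  then have "\<exists>p. \<forall>n. polynomial_function (p n) \<and> (\<forall>x\<in>{a..b}. norm (f x - p n x) < inverse (real (Suc n)))"
    by (intro choice) simp
  then obtain p where p: "\<And>n. polynomial_function (p n)"
      "\<And>n x. x \<in> {a..b} \<Longrightarrow> norm (f x - p n x) < inverse (real (Suc n))" by blast
  have "\<exists>I. \<forall>e>0. \<exists>d>0. \<forall>D. D tagged_division_of {a..b} \<and> (\<lambda>x. ball x d) fine D \<longrightarrow> norm (RS_sum (p n) g D - I) < e" for n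
  proof -
    obtain p' where p': "polynomial_function p'" "\<And>x. (p n has_vector_derivative p' x) (at x)"
      using has_vector_derivative_polynomial_function[OF p(1)] by blast
    have c: "continuous_on {a..b} p'" using p'(1) by (simp add: continuous_on_polymonial_function)
    then have "bounded (p' ` {a..b})" by (simp add: compact_continuous_image compact_imp_bounded)
    then obtain M where M: "M > 0" "\<And>x. x \<in> {a..b} \<Longrightarrow> norm (p' x) \<le> M"
      by (auto simp: bounded_pos)
    show ?thesis
    proof (rule exI[of _ "p n b * g b - p n a * g a - integral {a..b} (\<lambda>s. p' s * g s)"], intro allI impI)
      fix e :: real assume "e > 0"
      define d where "d = e / (8 * M * V)"
      have "d > 0" using \<open>e > 0\<close> M V by (simp add: d_def)
      have "norm (RS_sum (p n) g D - (p n b * g b - p n a * g a - integral {a..b} (\<lambda>s. p' s * g s))) < e"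
        if "D tagged_division_of {a..b}" "(\<lambda>x. ball x d) fine D" for D
      proof -
        have "norm (RS_sum (p n) g D - (p n b * g b - p n a * g a - integral {a..b} (\<lambda>s. p' s * g s))) \<le> 4 * M * d * (W b - W a)"
          by (rule RS_sum_C1_error[OF dom ab has_vector_derivative_at_within[OF p'(2)] c M(2) that \<open>d > 0\<close>])
        also have "\<dots> \<le> 4 * M * d * V"
          using V M \<open>d > 0\<close> by (intro mult_left_mono) auto
        also have "\<dots> < e" using \<open>e > 0\<close> V M by (simp add: d_def)
        finally show ?thesis .
      qed
      then show "\<exists>d>0. \<forall>D. D tagged_division_of {a..b} \<and> (\<lambda>x. ball x d) fine D \<longrightarrow> 
         norm (RS_sum (p n) g D - (p n b * g b - p n a * g a - integral {a..b} (\<lambda>s. p' s * g s))) < e"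
        by (intro exI[of _ d] conjI \<open>d > 0\<close>) blast
    qed
  qed
  then obtain I where I: "\<And>n e. e > 0 \<Longrightarrow> \<exists>d>0. \<forall>D. D tagged_division_of {a..b} \<and> (\<lambda>x. ball x d) fine D \<longrightarrow> norm (RS_sum (p n) g D - I n) < e"
    by metis
  have close: "norm (RS_sum f g D - RS_sum (p n) g D) \<le> V * inverse (real (Suc n))" if "D tagged_division_of {a..b}" for D n
  proof -
    have "norm (RS_sum f g D - RS_sum (p n) g D) \<le> inverse (real (Suc n)) * (W b - W a)"
      by (rule RS_sum_diff_le[OF dom ab that]) (use p(2) in \<open>auto intro: less_imp_le\<close>)
    also have "\<dots> \<le> inverse (real (Suc n)) * V" using V by (intro mult_left_mono) auto
    finally show ?thesis by (simp add: mult.commute)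
  qed
  have II: "norm (I n - I m) \<le> V * inverse (real (Suc n)) + V * inverse (real (Suc m))" for n m
  proof (rule field_le_epsilon)
    fix e :: real assume "e > 0"
    then have "e/2 > 0" by simp
    obtain d1 where d1: "d1 > 0" "\<And>D. D tagged_division_of {a..b} \<Longrightarrow> (\<lambda>x. ball x d1) fine D \<Longrightarrow> norm (RS_sum (p n) g D - I n) < e/2"
      using I[OF \<open>e/2 > 0\<close>] by meson
    obtain d2 where d2: "d2 > 0" "\<And>D. D tagged_division_of {a..b} \<Longrightarrow> (\<lambda>x. ball x d2) fine D \<Longrightarrow> norm (RS_sum (p m) g D - I m) < e/2"
      using I[OF \<open>e/2 > 0\<close>] by meson
    have "gauge (\<lambda>x::real. ball x (min d1 d2))" using d1 d2 by (auto simp: gauge_def)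
    then obtain D where D: "D tagged_division_of {a..b}" "(\<lambda>x. ball x (min d1 d2)) fine D"
      using fine_division_exists_real by blast
    have "(\<lambda>x. ball x d1) fine D" "(\<lambda>x. ball x d2) fine D" using fine_ball_mono[OF D(2)] by auto
    then have 1: "norm (RS_sum (p n) g D - I n) < e/2" "norm (RS_sum (p m) g D - I m) < e/2"
      using d1(2)[OF D(1)] d2(2)[OF D(1)] by blast+
    have eq: "I n - I m = (RS_sum (p m) g D - I m) - (RS_sum (p n) g D - I n)
       + ((RS_sum f g D - RS_sum (p m) g D) - (RS_sum f g D - RS_sum (p n) g D))" by simp
    have "norm (I n - I m) \<le> norm (RS_sum (p m) g D - I m) + norm (RS_sum (p n) g D - I n)
        + (norm (RS_sum f g D - RS_sum (p m) g D) + norm (RS_sum f g D - RS_sum (p n) g D))"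
      unfolding eq by (rule norm_diff_add_diff_le)
    then show "norm (I n - I m) \<le> V * inverse (real (Suc n)) + V * inverse (real (Suc m)) + e"
      using 1 close[OF D(1), of n] close[OF D(1), of m] by linarith
  qed
  have lim0: "(\<lambda>n. V * inverse (real (Suc n))) \<longlonglongrightarrow> 0"
    by (rule tendsto_mult_right_zero[OF LIMSEQ_inverse_real_of_nat])
  have "Cauchy I"
  proof (rule metric_CauchyI)
    fix e :: real assume "e > 0"
    then have "eventually (\<lambda>n. V * inverse (real (Suc n)) < e/2) sequentially"
      by (intro order_tendstoD(2)[OF lim0]) simp
    then obtain N where N: "\<And>n. n \<ge> N \<Longrightarrow> V * inverse (real (Suc n)) < e/2"
      unfolding eventually_sequentially by blast
    show "\<exists>M. \<forall>m\<ge>M. \<forall>n\<ge>M. dist (I m) (I n) < e"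
    proof (intro exI allI impI)
      fix m n assume mn: "N \<le> m" "N \<le> n"
      show "dist (I m) (I n) < e"
        using II[of m n] N[OF mn(1)] N[OF mn(2)] unfolding dist_norm by linarith
    qed
  qed
  then obtain J where J: "I \<longlonglongrightarrow> J" using Cauchy_convergent_iff convergent_def by blast
  have "has_RS_integral f g a b J"
    unfolding has_RS_integral_def RS_sum_def[symmetric]
  proof (intro allI impI)
    fix e :: real assume "e > 0"
    then have "e/3 > 0" by simp
    have "eventually (\<lambda>n. V * inverse (real (Suc n)) < e/3 \<and> dist (I n) J < e/3) sequentially"
      by (intro eventually_conj order_tendstoD(2)[OF lim0] tendstoD[OF J] \<open>e/3 > 0\<close>)
    from eventually_happens'[OF sequentially_bot this]
    obtain n where n: "V * inverse (real (Suc n)) < e/3" "norm (I n - J) < e/3"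
      unfolding dist_norm by blast
    obtain d where d: "d > 0" "\<And>D. D tagged_division_of {a..b} \<Longrightarrow> (\<lambda>x. ball x d) fine D \<Longrightarrow> norm (RS_sum (p n) g D - I n) < e/3"
      using I[OF \<open>e/3 > 0\<close>] by meson
    have "norm (RS_sum f g D - J) < e" if D: "D tagged_division_of {a..b}" "(\<lambda>x. ball x d) fine D" for D
    proof -
      have "RS_sum f g D - J = (RS_sum f g D - RS_sum (p n) g D) + (RS_sum (p n) g D - I n) + (I n - J)"
        by simp
      also have "norm \<dots> \<le> norm (RS_sum f g D - RS_sum (p n) g D) + norm (RS_sum (p n) g D - I n) + norm (I n - J)"
        by (rule order_trans[OF norm_triangle_ineq add_right_mono[OF norm_triangle_ineq]])
      also have "\<dots> < e/3 + e/3 + e/3"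
        using close[OF D(1), of n] d(2)[OF D] n by linarith
      finally show ?thesis by simp
    qed
    then show "\<exists>d>0. \<forall>D. D tagged_division_of {a..b} \<and> (\<lambda>x. ball x d) fine D \<longrightarrow> norm (RS_sum f g D - J) < e"
      using d(1) by blast
  qed
  then show ?thesis using RS_integral_eqI[OF \<open>has_RS_integral f g a b J\<close>] by simp
qed

text \<open>A monotone sequence of points, possibly with repetitions, gives a tagged division whose tags are
  the left endpoints.  Repetitions are admitted so that a partition may be truncated at a point.\<close>

lemma tagged_division_of_partition_points:
  fixes t :: "nat \<Rightarrow> real"
  assumes t: "mono t"
  shows "(\<lambda>i. (t i, {t i..t (Suc i)})) ` {..n} tagged_division_of {t 0..t (Suc n)}" (is "?D tagged_division_of _")
proof (rule tagged_division_ofI)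
  have le: "t i \<le> t j" if "i \<le> j" for i j using t that by (rule monoD)
  show "finite ?D" by simp
  show "x \<in> k" "\<exists>u v. k = cbox u v" if "(x, k) \<in> ?D" for x k
    using that le[of _ "Suc _"] by auto
  show "k \<subseteq> {t 0..t (Suc n)}" if xk: "(x, k) \<in> ?D" for x k
  proof -
    obtain i where i: "i \<le> n" "k = {t i..t (Suc i)}" using xk by auto
    then show ?thesis using le[of 0 i] le[of "Suc i" "Suc n"] by auto
  qed
  show "interior k1 \<inter> interior k2 = {}" if h: "(x1, k1) \<in> ?D" "(x2, k2) \<in> ?D" "(x1, k1) \<noteq> (x2, k2)" for x1 k1 x2 k2
  proof -
    obtain i j where ij: "x1 = t i" "k1 = {t i..t (Suc i)}" "x2 = t j" "k2 = {t j..t (Suc j)}" using h by auto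
    then have "i \<noteq> j" using h by auto
    then have "Suc i \<le> j \<or> Suc j \<le> i" by linarith
    then show ?thesis using ij le[of "Suc i" j] le[of "Suc j" i] by auto
  qed
  have "{t 0..t (Suc n)} \<subseteq> \<Union> {k. \<exists>x. (x, k) \<in> ?D}"
  proof
    fix s assume s: "s \<in> {t 0..t (Suc n)}"
    define i where "i = (LEAST i. s \<le> t (Suc i))"
    have i1: "s \<le> t (Suc i)" unfolding i_def by (rule LeastI[of _ n]) (use s in auto)
    have i2: "i \<le> n" unfolding i_def by (rule Least_le) (use s in auto)
    have "t i \<le> s"
    proof (cases i)
      case 0 then show ?thesis using s by simp
    next
      case (Suc k)
      then have "\<not> s \<le> t (Suc k)" using not_less_Least[of k "\<lambda>i. s \<le> t (Suc i)"] by (simp add: i_def)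
      then show ?thesis using Suc by simp
    qed
    then have "s \<in> {t i..t (Suc i)}" using i1 by simp
    moreover have "(t i, {t i..t (Suc i)}) \<in> ?D" using i2 by auto
    ultimately show "s \<in> \<Union> {k. \<exists>x. (x, k) \<in> ?D}" by blast
  qed
  moreover have "\<Union> {k. \<exists>x. (x, k) \<in> ?D} \<subseteq> {t 0..t (Suc n)}"
  proof
    fix s assume "s \<in> \<Union> {k. \<exists>x. (x, k) \<in> ?D}"
    then obtain i where i: "i \<le> n" "s \<in> {t i..t (Suc i)}" by auto
    then show "s \<in> {t 0..t (Suc n)}" using le[of 0 i] le[of "Suc i" "Suc n"] by auto
  qed
  ultimately show "\<Union> {k. \<exists>x. (x, k) \<in> ?D} = {t 0..t (Suc n)}" by blast
qed

text \<open>Repeated points give equal members of the division, but these have increment 0.\<close>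

lemma RS_sum_partition_points:
  fixes t :: "nat \<Rightarrow> real"
  assumes t: "mono t"
  shows "RS_sum f g ((\<lambda>i. (t i, {t i..t (Suc i)})) ` {..n}) = (\<Sum>i\<le>n. f (t i) * (g (t (Suc i)) - g (t i)))"
proof -
  have le: "t i \<le> t j" if "i \<le> j" for i j using t that by (rule monoD)
  have "RS_sum f g ((\<lambda>i. (t i, {t i..t (Suc i)})) ` {..n}) =
     sum ((\<lambda>(x,k). f x * (g (Sup k) - g (Inf k))) \<circ> (\<lambda>i. (t i, {t i..t (Suc i)}))) {..n}"
    unfolding RS_sum_def
  proof (rule sum.reindex_nontrivial, simp)
    fix i j assume ij: "i \<noteq> j" "(t i, {t i..t (Suc i)}) = (t j, {t j..t (Suc j)})"
    then have eq: "t i = t j" "t (Suc i) = t (Suc j)" using le[of i "Suc i"] le[of j "Suc j"] by (auto simp: Icc_eq_Icc)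
    have "Suc i \<le> j \<or> Suc j \<le> i" using ij by linarith
    then have "t (Suc i) = t i" using eq le[of "Suc i" j] le[of "Suc j" i] le[of i "Suc i"] le[of j "Suc j"] by auto
    then show "(case (t i, {t i..t (Suc i)}) of (x, k) \<Rightarrow> f x * (g (Sup k) - g (Inf k))) = 0" by simp
  qed
  also have "\<dots> = (\<Sum>i\<le>n. f (t i) * (g (t (Suc i)) - g (t i)))"
    using le by (intro sum.cong) auto
  finally show ?thesis .
qed

text \<open>The partitions are arbitrary apart from their mesh.  Uniform partitions yield linearity, bounds
  and limit theorems; partitions truncated at a point serve integrals with a variable upper limit.\<close>

lemma RS_integral_partition_limit:
  fixes t :: "nat \<Rightarrow> nat \<Rightarrow> real"
  assumes dom: "increments_dominated a b g W" and ab: "a \<le> b" and f: "continuous_on {a..b} f"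
    and t: "\<And>n. mono (t n)" "\<And>n. t n 0 = a" "\<And>n. t n (Suc n) = b"
    and mesh: "\<And>n i. t n (Suc i) - t n i \<le> \<delta> n" and \<delta>: "\<delta> \<longlonglongrightarrow> 0"
  shows "(\<lambda>n. \<Sum>i\<le>n. f (t n i) * (g (t n (Suc i)) - g (t n i))) \<longlonglongrightarrow> RS_integral a b f g"
proof (rule tendstoI)
  fix e :: real assume "e > 0"
  then obtain d where d: "d > 0" "\<And>D. D tagged_division_of {a..b} \<Longrightarrow> (\<lambda>x. ball x d) fine D \<Longrightarrow> norm (RS_sum f g D - RS_integral a b f g) < e"
    using has_RS_integral_continuous[OF dom ab f] unfolding has_RS_integral_def RS_sum_def by meson
  have "eventually (\<lambda>n. \<delta> n < d) sequentially" using order_tendstoD(2)[OF \<delta> d(1)] .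
  then show "eventually (\<lambda>n. dist (\<Sum>i\<le>n. f (t n i) * (g (t n (Suc i)) - g (t n i))) (RS_integral a b f g) < e) sequentially"
  proof eventually_elim
    case (elim n)
    define D where "D = (\<lambda>i. (t n i, {t n i..t n (Suc i)})) ` {..n}"
    have "D tagged_division_of {a..b}"
      using tagged_division_of_partition_points[OF t(1)[of n], of n] t unfolding D_def by simp
    moreover have "(\<lambda>x. ball x d) fine D"
      unfolding fine_def D_def
    proof clarify
      fix i x assume "x \<in> {t n i..t n (Suc i)}"
      then show "x \<in> ball (t n i) d" using mesh[of n i] elim by (auto simp: dist_real_def)
    qed
    ultimately have "norm (RS_sum f g D - RS_integral a b f g) < e" using d(2) by blast
    then show ?case unfolding D_def RS_sum_partition_points[OF t(1)] dist_norm .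
  qed
qed

definition uniform_point :: "real \<Rightarrow> real \<Rightarrow> nat \<Rightarrow> nat \<Rightarrow> real" where
  "uniform_point a b n i = a + real i * ((b - a) / real (Suc n))"

lemma mono_uniform_point: "a \<le> b \<Longrightarrow> mono (uniform_point a b n)"
  unfolding uniform_point_def by (intro monoI add_left_mono mult_right_mono) auto

lemma uniform_point_0 [simp]: "uniform_point a b n 0 = a"
  and uniform_point_Suc_n [simp]: "uniform_point a b n (Suc n) = b"
  and uniform_point_step: "uniform_point a b n (Suc i) - uniform_point a b n i = (b - a) / real (Suc n)"
proof -
  have "real (Suc n) \<noteq> 0" by simp
  then show "uniform_point a b n (Suc n) = b"
    unfolding uniform_point_def by (simp del: of_nat_Suc)
qed (auto simp: uniform_point_def add_divide_distrib distrib_right)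

lemma uniform_point_mem:
  assumes "a \<le> b" "i \<le> Suc n" shows "uniform_point a b n i \<in> {a..b}"
  using monoD[OF mono_uniform_point[OF assms(1)], of 0 i n] monoD[OF mono_uniform_point[OF assms(1)], of i "Suc n" n] assms(2)
  by simp

lemma uniform_step_tendsto_0: "(\<lambda>n. (b - a) / real (Suc n)) \<longlonglongrightarrow> 0"
  using tendsto_mult_right_zero[OF LIMSEQ_inverse_real_of_nat, of "b - a"] by (simp add: divide_inverse)

lemma RS_integral_uniform_limit:
  assumes dom: "increments_dominated a b g W" and ab: "a \<le> b" and f: "continuous_on {a..b} f"
  shows "(\<lambda>n. \<Sum>i\<le>n. f (uniform_point a b n i) * (g (uniform_point a b n (Suc i)) - g (uniform_point a b n i)))
           \<longlonglongrightarrow> RS_integral a b f g"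
  by (rule RS_integral_partition_limit[OF dom ab f mono_uniform_point[OF ab] _ _ _ uniform_step_tendsto_0[of b a]])
     (simp_all add: uniform_point_step)

lemma partition_sum_norm_le:
  fixes g :: "real \<Rightarrow> complex"
  assumes dom: "increments_dominated a b g W"
    and t: "mono t" "t 0 = a" "t (Suc n) = b"
    and M: "\<And>i. i \<le> n \<Longrightarrow> norm (c i) \<le> M" 
  shows "norm (\<Sum>i\<le>n. c i * (g (t (Suc i)) - g (t i))) \<le> M * (W b - W a)"
proof -
  have M0: "M \<ge> 0" using M[of 0] norm_ge_zero[of "c 0"] by (auto simp del: norm_ge_zero)
  have "norm (\<Sum>i\<le>n. c i * (g (t (Suc i)) - g (t i))) \<le> (\<Sum>i\<le>n. M * (W (t (Suc i)) - W (t i)))"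
  proof (rule sum_norm_le)
    fix i assume i: "i \<in> {..n}"
    have "a \<le> t i" "t i \<le> t (Suc i)" "t (Suc i) \<le> b"
      using monoD[OF t(1), of 0 i] monoD[OF t(1), of i "Suc i"] monoD[OF t(1), of "Suc i" "Suc n"] t i by auto
    then show "norm (c i * (g (t (Suc i)) - g (t i))) \<le> M * (W (t (Suc i)) - W (t i))"
      unfolding norm_mult using M[of i] i M0 increments_dominatedD[OF dom] by (intro mult_mono) auto
  qed
  also have "\<dots> = M * (W b - W a)"
    using sum_telescope[of "\<lambda>i. - W (t i)" n] t by (simp flip: sum_distrib_left)
  finally show ?thesis .
qed

lemma RS_integral_norm_le:
  assumes dom: "increments_dominated a b g W" and ab: "a \<le> b" and f: "continuous_on {a..b} f"
    and M: "\<And>x. x \<in> {a..b} \<Longrightarrow> norm (f x) \<le> M"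
  shows "norm (RS_integral a b f g) \<le> M * (W b - W a)"
proof (rule Lim_bounded[OF tendsto_norm[OF RS_integral_uniform_limit[OF dom ab f]]], intro allI impI)
  fix n
  show "norm (\<Sum>i\<le>n. f (uniform_point a b n i) * (g (uniform_point a b n (Suc i)) - g (uniform_point a b n i))) \<le> M * (W b - W a)"
    by (rule partition_sum_norm_le[OF dom mono_uniform_point[OF ab]]) (use M uniform_point_mem[OF ab] in auto)
qed

lemma RS_integral_add:
  assumes dom: "increments_dominated a b g W" and ab: "a \<le> b"
    and f: "continuous_on {a..b} f" and h: "continuous_on {a..b} h"
  shows "RS_integral a b (\<lambda>x. f x + h x) g = RS_integral a b f g + RS_integral a b h g"
proof (rule LIMSEQ_unique[OF RS_integral_uniform_limit[OF dom ab continuous_on_add[OF f h]]])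
  show "(\<lambda>n. \<Sum>i\<le>n. (f (uniform_point a b n i) + h (uniform_point a b n i)) * (g (uniform_point a b n (Suc i)) - g (uniform_point a b n i)))
     \<longlonglongrightarrow> RS_integral a b f g + RS_integral a b h g"
    using tendsto_add[OF RS_integral_uniform_limit[OF dom ab f] RS_integral_uniform_limit[OF dom ab h]]
    by (simp add: distrib_right sum.distrib)
qed

lemma RS_integral_cmult:
  assumes dom: "increments_dominated a b g W" and ab: "a \<le> b" and f: "continuous_on {a..b} f"
  shows "RS_integral a b (\<lambda>x. c * f x) g = c * RS_integral a b f g"
proof (rule LIMSEQ_unique[OF RS_integral_uniform_limit[OF dom ab continuous_on_mult_left[OF f]]])
  show "(\<lambda>n. \<Sum>i\<le>n. (c * f (uniform_point a b n i)) * (g (uniform_point a b n (Suc i)) - g (uniform_point a b n i)))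
     \<longlonglongrightarrow> c * RS_integral a b f g"
    using tendsto_mult_left[OF RS_integral_uniform_limit[OF dom ab f], of c]
    by (simp add: sum_distrib_left mult.assoc)
qed

lemma RS_integral_diff:
  assumes dom: "increments_dominated a b g W" and ab: "a \<le> b"
    and f: "continuous_on {a..b} f" and h: "continuous_on {a..b} h"
  shows "RS_integral a b (\<lambda>x. f x - h x) g = RS_integral a b f g - RS_integral a b h g"
  using RS_integral_add[OF dom ab f continuous_on_mult_left[OF h, of "-1"]] RS_integral_cmult[OF dom ab h, of "-1"]
  by simp

lemma RS_integral_cong:
  assumes "\<And>x. x \<in> {a..b} \<Longrightarrow> f x = h x"
  shows "RS_integral a b f g = RS_integral a b h g"
proof -
  have *: "RS_sum f g D = RS_sum h g D" if "D tagged_division_of {a..b}" for D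
    unfolding RS_sum_def
  proof (rule sum.cong[OF refl], clarify)
    fix x k assume "(x, k) \<in> D"
    then have "x \<in> {a..b}" using tagged_division_ofD(2,3)[OF that] by blast
    then show "f x * (g (Sup k) - g (Inf k)) = h x * (g (Sup k) - g (Inf k))" using assms by simp
  qed
  have "has_RS_integral f g a b = has_RS_integral h g a b"
    unfolding has_RS_integral_def RS_sum_def[symmetric]
    by (intro ext all_cong ex_cong1 conj_cong imp_cong refl) (simp only: *)+
  then show ?thesis unfolding RS_integral_def by simp
qed

lemma continuous_on_curry1:
  assumes "continuous_on (A \<times> B) (\<lambda>(s, x). f s x)" "s \<in> A"
  shows "continuous_on B (f s)"
proof -
  have "continuous_on B (\<lambda>x. case (s, x) of (s, x) \<Rightarrow> f s x)"
    by (rule continuous_on_compose2[OF assms(1) continuous_on_Pair[OF continuous_on_const continuous_on_id]])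
       (use assms(2) in auto)
  then show ?thesis by simp
qed

lemma continuous_on_curry2:
  assumes "continuous_on (A \<times> B) (\<lambda>(s, x). f s x)" "x \<in> B"
  shows "continuous_on A (\<lambda>s. f s x)"
proof -
  have "continuous_on A (\<lambda>s. case (s, x) of (s, x) \<Rightarrow> f s x)"
    by (rule continuous_on_compose2[OF assms(1) continuous_on_Pair[OF continuous_on_id continuous_on_const]])
       (use assms(2) in auto)
  then show ?thesis by simp
qed

text \<open>Fubini's theorem for a Stieltjes and a Lebesgue integral: it holds for the sums over uniform
  partitions, and these are bounded uniformly in the parameter, so dominated convergence applies.\<close>

lemma RS_integral_swap:
  fixes f :: "real \<Rightarrow> real \<Rightarrow> complex"
  assumes dom: "increments_dominated a b g W" and ab: "a \<le> b"
    and f: "continuous_on ({c..d} \<times> {a..b}) (\<lambda>(s, x). f s x)"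
  shows "(\<lambda>s. RS_integral a b (f s) g) integrable_on {c..d}"
    and "integral {c..d} (\<lambda>s. RS_integral a b (f s) g) = RS_integral a b (\<lambda>x. integral {c..d} (\<lambda>s. f s x)) g"
proof -
  define P where "P = uniform_point a b"
  define F where "F n s = (\<Sum>i\<le>n. f s (P n i) * (g (P n (Suc i)) - g (P n i)))" for n s
  have cx: "continuous_on {a..b} (f s)" if "s \<in> {c..d}" for s
    by (rule continuous_on_curry1[OF f that])
  have cs: "continuous_on {c..d} (\<lambda>s. f s x)" if "x \<in> {a..b}" for x
    by (rule continuous_on_curry2[OF f that])
  have "bounded ((\<lambda>(s, x). f s x) ` ({c..d} \<times> {a..b}))"
    by (intro compact_imp_bounded compact_continuous_image f compact_Times compact_Icc)
  then obtain M where M: "\<And>s x. s \<in> {c..d} \<Longrightarrow> x \<in> {a..b} \<Longrightarrow> norm (f s x) \<le> M"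
    by (fastforce simp: bounded_iff)
  have mem: "P n i \<in> {a..b}" if "i \<le> Suc n" for n i
    using uniform_point_mem[OF ab that] by (simp add: P_def)
  have Fi: "(F n has_integral (\<Sum>i\<le>n. integral {c..d} (\<lambda>s. f s (P n i)) * (g (P n (Suc i)) - g (P n i)))) {c..d}" for n
    unfolding F_def using mem cs
    by (intro has_integral_sum has_integral_mult_left integrable_integral integrable_continuous_real) auto
  have lim: "(\<lambda>n. F n s) \<longlonglongrightarrow> RS_integral a b (f s) g" if "s \<in> {c..d}" for s
    using RS_integral_uniform_limit[OF dom ab cx[OF that]] by (simp add: F_def P_def)
  have bnd: "norm (F n s) \<le> M * (W b - W a)" if "s \<in> {c..d}" for n s
    unfolding F_def P_def
    by (rule partition_sum_norm_le[OF dom mono_uniform_point[OF ab]])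
       (use M[OF that] uniform_point_mem[OF ab] in auto)
  have dc: "(\<lambda>s. RS_integral a b (f s) g) integrable_on {c..d}"
       "(\<lambda>n. integral {c..d} (F n)) \<longlonglongrightarrow> integral {c..d} (\<lambda>s. RS_integral a b (f s) g)"
    using dominated_convergence[of F "{c..d}" "\<lambda>_. M * (W b - W a)" "\<lambda>s. RS_integral a b (f s) g"] Fi bnd lim
    by (auto simp: integrable_const_ivl intro: has_integral_integrable)
  show "(\<lambda>s. RS_integral a b (f s) g) integrable_on {c..d}" by (rule dc(1))
  have cI: "continuous_on {a..b} (\<lambda>x. integral {c..d} (\<lambda>s. f s x))"
  proof -
    have "continuous_on ({a..b} \<times> {c..d}) (\<lambda>z. case prod.swap z of (s, x) \<Rightarrow> f s x)"
      by (rule continuous_on_compose2[OF f continuous_on_swap]) auto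
    then have "continuous_on ({a..b} \<times> cbox c d) (\<lambda>(x, s). f s x)"
      by (simp add: case_prod_unfold)
    from integral_continuous_on_param[OF this] show ?thesis by simp
  qed
  have "(\<lambda>n. integral {c..d} (F n)) \<longlonglongrightarrow> RS_integral a b (\<lambda>x. integral {c..d} (\<lambda>s. f s x)) g"
    using RS_integral_uniform_limit[OF dom ab cI] by (simp add: integral_unique[OF Fi] P_def)
  then show "integral {c..d} (\<lambda>s. RS_integral a b (f s) g) = RS_integral a b (\<lambda>x. integral {c..d} (\<lambda>s. f s x)) g"
    using dc(2) LIMSEQ_unique by blast
qed

lemma continuous_on_RS_integral_param:
  fixes f :: "real \<Rightarrow> real \<Rightarrow> complex"
  assumes dom: "increments_dominated a b g W" and ab: "a \<le> b"
    and f: "continuous_on ({c..d} \<times> {a..b}) (\<lambda>(s, x). f s x)"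
  shows "continuous_on {c..d} (\<lambda>s. RS_integral a b (f s) g)"
  unfolding continuous_on_iff
proof (intro ballI allI impI)
  fix s e :: real assume s: "s \<in> {c..d}" and e: "e > 0"
  define V where "V = W b - W a + 1"
  have V: "V > 0" "W b - W a < V" "0 \<le> W b - W a"
    using increments_dominatedD[OF dom, of a b] ab norm_ge_zero[of "g b - g a"]
    by (auto simp: V_def simp del: norm_ge_zero)
  have cx: "continuous_on {a..b} (f s)" if "s \<in> {c..d}" for s
    by (rule continuous_on_curry1[OF f that])
  have "uniformly_continuous_on ({c..d} \<times> {a..b}) (\<lambda>(s, x). f s x)"
    by (intro compact_uniformly_continuous f compact_Times compact_Icc)
  moreover have "e / V > 0" using e V by simp
  ultimately obtain \<delta> where \<delta>: "\<delta> > 0" "\<And>z z'. z \<in> {c..d} \<times> {a..b} \<Longrightarrow> z' \<in> {c..d} \<times> {a..b} \<Longrightarrow> dist z' z < \<delta> \<Longrightarrow>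
       dist (case z' of (s, x) \<Rightarrow> f s x) (case z of (s, x) \<Rightarrow> f s x) < e / V"
    unfolding uniformly_continuous_on_def by metis
  show "\<exists>d'>0. \<forall>s'\<in>{c..d}. dist s' s < d' \<longrightarrow> dist (RS_integral a b (f s') g) (RS_integral a b (f s) g) < e"
  proof (intro exI conjI ballI impI, rule \<delta>(1))
    fix s' assume s': "s' \<in> {c..d}" "dist s' s < \<delta>"
    have "dist (RS_integral a b (f s') g) (RS_integral a b (f s) g) = norm (RS_integral a b (\<lambda>x. f s' x - f s x) g)"
      unfolding dist_norm RS_integral_diff[OF dom ab cx[OF s'(1)] cx[OF s]] ..
    also have "\<dots> \<le> e / V * (W b - W a)"
    proof (rule RS_integral_norm_le[OF dom ab continuous_on_diff[OF cx[OF s'(1)] cx[OF s]]])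
      fix x assume "x \<in> {a..b}"
      then show "norm (f s' x - f s x) \<le> e / V"
        using \<delta>(2)[of "(s, x)" "(s', x)"] s s' by (auto simp: dist_norm dist_Pair_Pair)
    qed
    also have "\<dots> < e / V * V" using V e by (intro mult_strict_left_mono) auto
    finally show "dist (RS_integral a b (f s') g) (RS_integral a b (f s) g) < e" using V by simp
  qed
qed

section \<open>Lebesgue measure with a point mass at 0\<close>

text \<open>The defining formula for the measure of sets extends to functions by the usual approximation by
  simple functions.\<close>

lemma nn_integral_lebesgue_plus_dirac:
  assumes f: "f \<in> borel_measurable (lebesgue_on S)" and 0: "0 \<in> S"
  shows "(\<integral>\<^sup>+x. f x \<partial>lebesgue_plus_dirac S) = (\<integral>\<^sup>+x. f x \<partial>lebesgue_on S) + f 0"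
proof -
  have [measurable_cong]: "sets (lebesgue_plus_dirac S) = sets (lebesgue_on S)" by simp
  show ?thesis using f
  proof (induction rule: borel_measurable_induct)
    case (cong f g)
    have "(\<integral>\<^sup>+x. f x \<partial>lebesgue_plus_dirac S) = (\<integral>\<^sup>+x. g x \<partial>lebesgue_plus_dirac S)"
      using cong by (intro nn_integral_cong) auto
    moreover have "(\<integral>\<^sup>+x. f x \<partial>lebesgue_on S) = (\<integral>\<^sup>+x. g x \<partial>lebesgue_on S)"
      using cong by (intro nn_integral_cong) auto
    ultimately show ?case using cong 0 by auto
  next
    case (set A)
    then show ?case by (simp add: emeasure_lebesgue_plus_dirac)
  next
    case (mult u c)
    have [measurable]: "u \<in> borel_measurable (lebesgue_plus_dirac S)" using mult by simp
    show ?case using mult by (simp add: nn_integral_cmult distrib_left)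
  next
    case (add u v)
    have [measurable]: "u \<in> borel_measurable (lebesgue_plus_dirac S)" "v \<in> borel_measurable (lebesgue_plus_dirac S)"
      using add by simp_all
    show ?case using add by (simp add: nn_integral_add algebra_simps)
  next
    case (seq U)
    have [measurable]: "U i \<in> borel_measurable (lebesgue_plus_dirac S)" for i using seq by simp
    have m: "incseq (\<lambda>i. \<integral>\<^sup>+x. U i x \<partial>lebesgue_on S)" "incseq (\<lambda>i. U i 0)"
      using \<open>incseq U\<close> by (auto simp: incseq_def le_fun_def intro!: nn_integral_mono)
    have "(\<integral>\<^sup>+x. (SUP i. U i) x \<partial>lebesgue_plus_dirac S) = (SUP i. \<integral>\<^sup>+x. U i x \<partial>lebesgue_plus_dirac S)"
      using seq by (simp add: nn_integral_monotone_convergence_SUP image_comp)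
    also have "\<dots> = (SUP i. (\<integral>\<^sup>+x. U i x \<partial>lebesgue_on S) + U i 0)"
      using seq by simp
    also have "\<dots> = (SUP i. \<integral>\<^sup>+x. U i x \<partial>lebesgue_on S) + (SUP i. U i 0)"
      by (rule ennreal_SUP_add[OF m])
    also have "\<dots> = (\<integral>\<^sup>+x. (SUP i. U i) x \<partial>lebesgue_on S) + (SUP i. U i) 0"
      using seq by (simp add: nn_integral_monotone_convergence_SUP image_comp)
    finally show ?case using seq by simp
  qed
qed

lemma AE_lebesgue_plus_dirac_iff:
  assumes S: "S \<in> sets lebesgue" and 0: "0 \<in> S"
  shows "(AE x in lebesgue_plus_dirac S. P x) \<longleftrightarrow> (AE x in lebesgue_on S. P x) \<and> P 0"
proof
  have null: "N \<in> null_sets (lebesgue_plus_dirac S) \<longleftrightarrow> N \<in> null_sets (lebesgue_on S) \<and> 0 \<notin> N" for N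
    by (auto simp: null_sets_def emeasure_lebesgue_plus_dirac indicator_def split: if_splits)
  {
    assume "AE x in lebesgue_plus_dirac S. P x"
    then obtain N where N: "N \<in> null_sets (lebesgue_plus_dirac S)" "{x \<in> S. \<not> P x} \<subseteq> N"
      unfolding eventually_ae_filter by auto
    then have "N \<in> null_sets (lebesgue_on S)" "0 \<notin> N" using null by auto
    then show "(AE x in lebesgue_on S. P x) \<and> P 0"
      using N 0 unfolding eventually_ae_filter by auto
  }
  assume *: "(AE x in lebesgue_on S. P x) \<and> P 0"
  then obtain N where N: "N \<in> null_sets (lebesgue_on S)" "{x \<in> S. \<not> P x} \<subseteq> N"
    unfolding eventually_ae_filter by auto
  have "{0} \<in> sets (lebesgue_on S)" using 0 S by (auto simp: sets_restrict_space_iff)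
  then have "N - {0} \<in> null_sets (lebesgue_on S)" using N by (intro null_set_Diff)
  then have "N - {0} \<in> null_sets (lebesgue_plus_dirac S)" using null by auto
  then show "AE x in lebesgue_plus_dirac S. P x"
    using N(2) * unfolding eventually_ae_filter by (intro bexI[of _ "N - {0}"]) auto
qed

text \<open>Membership in \<open>L\<^sup>p\<close> of an interval without the point mass: the mass at 0 influences the norm but
  not integrability.\<close>

definition Lp_on :: "real \<Rightarrow> real \<Rightarrow> real \<Rightarrow> (real \<Rightarrow> 'a::euclidean_space) \<Rightarrow> bool" where
  "Lp_on a b p f \<longleftrightarrow> f \<in> borel_measurable (lebesgue_on {a..b}) \<and> (\<lambda>x. norm (f x) powr p) integrable_on {a..b}"

lemma integrable_lebesgue_on_nonneg_iff:
  fixes f :: "real \<Rightarrow> real"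
  assumes "S \<in> sets lebesgue" "\<And>x. 0 \<le> f x"
  shows "integrable (lebesgue_on S) f \<longleftrightarrow> f integrable_on S"
  using assms absolutely_integrable_on_iff_nonneg[of S f] absolutely_integrable_imp_integrable[of S f] 
    integrable_on_lebesgue_on[of S f] by blast

lemma Lp_space_lebesgue_plus_dirac:
  assumes S: "{a..b} \<in> sets lebesgue" "0 \<in> {a..b}"
  shows "f \<in> Lp_space (lebesgue_plus_dirac {a..b}) p \<longleftrightarrow> Lp_on a b p f"
    and "Lp_on a b p f \<Longrightarrow> Lp_norm (lebesgue_plus_dirac {a..b}) p f
      = (integral {a..b} (\<lambda>x. norm (f x) powr p) + norm (f 0) powr p) powr (1 / p)"
proof -
  have meas: "f \<in> borel_measurable (lebesgue_plus_dirac {a..b}) \<longleftrightarrow> f \<in> borel_measurable (lebesgue_on {a..b})"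
    by (rule arg_cong[of _ _ "\<lambda>A. f \<in> A"], rule measurable_cong_sets) simp_all
  show "f \<in> Lp_space (lebesgue_plus_dirac {a..b}) p \<longleftrightarrow> Lp_on a b p f"
  proof (cases "f \<in> borel_measurable (lebesgue_on {a..b})")
    case True
    then have m: "(\<lambda>x. norm (f x) powr p) \<in> borel_measurable (lebesgue_on {a..b})" by measurable
    then have m': "(\<lambda>x. norm (f x) powr p) \<in> borel_measurable (lebesgue_plus_dirac {a..b})"
      by (subst measurable_cong_sets[OF sets_lebesgue_plus_dirac refl])
    have "integrable (lebesgue_plus_dirac {a..b}) (\<lambda>x. norm (f x) powr p) \<longleftrightarrow> integrable (lebesgue_on {a..b}) (\<lambda>x. norm (f x) powr p)"
      unfolding integrable_iff_bounded using m m' nn_integral_lebesgue_plus_dirac[OF measurable_compose[OF m measurable_ennreal] S(2)]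
      by simp
    also have "\<dots> \<longleftrightarrow> (\<lambda>x. norm (f x) powr p) integrable_on {a..b}"
      by (rule integrable_lebesgue_on_nonneg_iff) simp_all
    finally show ?thesis using True meas by (simp add: Lp_space_def Lp_on_def)
  next
    case False
    then show ?thesis using meas by (simp add: Lp_space_def Lp_on_def)
  qed
  assume L: "Lp_on a b p f"
  then have m: "(\<lambda>x. norm (f x) powr p) \<in> borel_measurable (lebesgue_on {a..b})" by (auto simp: Lp_on_def)
  then have m': "(\<lambda>x. norm (f x) powr p) \<in> borel_measurable (lebesgue_plus_dirac {a..b})"
    by (subst measurable_cong_sets[OF sets_lebesgue_plus_dirac refl])
  have i: "integrable (lebesgue_on {a..b}) (\<lambda>x. norm (f x) powr p)"
    using L by (subst integrable_lebesgue_on_nonneg_iff) (auto simp: Lp_on_def)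
  have "(\<integral>\<^sup>+x. ennreal (norm (f x) powr p) \<partial>lebesgue_on {a..b}) = ennreal (LINT x|lebesgue_on {a..b}. norm (f x) powr p)"
    by (rule nn_integral_eq_integral[OF i]) simp
  also have "(LINT x|lebesgue_on {a..b}. norm (f x) powr p) = integral {a..b} (\<lambda>x. norm (f x) powr p)"
    by (rule lebesgue_integral_eq_integral[OF i S(1)])
  finally have fin: "(\<integral>\<^sup>+x. ennreal (norm (f x) powr p) \<partial>lebesgue_on {a..b}) = ennreal (integral {a..b} (\<lambda>x. norm (f x) powr p))" .
  have nn: "0 \<le> integral {a..b} (\<lambda>x. norm (f x) powr p)"
    using L by (intro integral_nonneg) (auto simp: Lp_on_def)
  from fin have "(\<integral>\<^sup>+x. ennreal (norm (f x) powr p) \<partial>lebesgue_plus_dirac {a..b})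
      = ennreal (integral {a..b} (\<lambda>x. norm (f x) powr p)) + ennreal (norm (f 0) powr p)"
    using nn_integral_lebesgue_plus_dirac[OF measurable_compose[OF m measurable_ennreal] S(2)] by simp
  also have "\<dots> = ennreal (integral {a..b} (\<lambda>x. norm (f x) powr p) + norm (f 0) powr p)"
    using nn by (subst ennreal_plus) auto
  finally have "(LINT x|lebesgue_plus_dirac {a..b}. norm (f x) powr p)
      = enn2real (ennreal (integral {a..b} (\<lambda>x. norm (f x) powr p) + norm (f 0) powr p))"
    using integral_eq_nn_integral[OF m'] by simp
  then have "(LINT x|lebesgue_plus_dirac {a..b}. norm (f x) powr p) = integral {a..b} (\<lambda>x. norm (f x) powr p) + norm (f 0) powr p"
    using nn by (subst (asm) enn2real_ennreal) auto
  then show "Lp_norm (lebesgue_plus_dirac {a..b}) p f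
      = (integral {a..b} (\<lambda>x. norm (f x) powr p) + norm (f 0) powr p) powr (1 / p)"
    by (simp add: Lp_norm_def)
qed

lemma powr_add_le:
  fixes x y p :: real
  assumes "0 \<le> x" "0 \<le> y" "0 \<le> p"
  shows "(x + y) powr p \<le> 2 powr p * (x powr p + y powr p)"
proof -
  have "(x + y) powr p \<le> (2 * max x y) powr p"
    using assms by (intro powr_mono2) auto
  also have "\<dots> = 2 powr p * max x y powr p"
    by (simp add: powr_mult)
  also have "\<dots> \<le> 2 powr p * (x powr p + y powr p)"
    by (intro mult_left_mono) (auto simp: max_def)
  finally show ?thesis .
qed

lemma Lp_onI_bound:
  assumes "f \<in> borel_measurable (lebesgue_on {a..b})" "g integrable_on {a..b}"
    "\<And>x. x \<in> {a..b} \<Longrightarrow> norm (f x) powr p \<le> g x"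
  shows "Lp_on a b p f"
proof -
  have m: "(\<lambda>x. norm (f x) powr p) \<in> borel_measurable (lebesgue_on {a..b})" using assms(1) by measurable
  have "(\<lambda>x. norm (f x) powr p) absolutely_integrable_on {a..b}"
    by (rule measurable_bounded_by_integrable_imp_absolutely_integrable[OF m _ assms(2)]) (use assms(3) in auto)
  then show ?thesis using assms(1) by (simp add: Lp_on_def absolutely_integrable_on_def)
qed

lemma Lp_on_add:
  assumes "Lp_on a b p f" "Lp_on a b p g" "0 \<le> p"
  shows "Lp_on a b p (\<lambda>x. f x + g x)"
proof (rule Lp_onI_bound)
  show "(\<lambda>x. f x + g x) \<in> borel_measurable (lebesgue_on {a..b})"
    using assms by (auto simp: Lp_on_def)
  show "(\<lambda>x. 2 powr p * (norm (f x) powr p + norm (g x) powr p)) integrable_on {a..b}"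
    using assms by (intro integrable_on_mult_right integrable_add) (auto simp: Lp_on_def)
  show "norm (f x + g x) powr p \<le> 2 powr p * (norm (f x) powr p + norm (g x) powr p)" for x
    using powr_mono2[OF assms(3) norm_ge_zero norm_triangle_ineq[of "f x" "g x"]]
      powr_add_le[OF norm_ge_zero[of "f x"] norm_ge_zero[of "g x"] assms(3)] by linarith
qed

lemma Lp_on_norm_le:
  assumes "Lp_on a b p f" "g \<in> borel_measurable (lebesgue_on {a..b})" "0 \<le> p"
    "\<And>x. x \<in> {a..b} \<Longrightarrow> norm (g x) \<le> norm (f x)"
  shows "Lp_on a b p g"
  by (rule Lp_onI_bound[OF assms(2), of "\<lambda>x. norm (f x) powr p"])
     (use assms in \<open>auto simp: Lp_on_def intro!: powr_mono2\<close>)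

lemma Lp_on_uminus: "Lp_on a b p f \<Longrightarrow> Lp_on a b p (\<lambda>x. - f x)"
  by (auto simp: Lp_on_def)

lemma Lp_on_diff:
  "Lp_on a b p f \<Longrightarrow> Lp_on a b p g \<Longrightarrow> 0 \<le> p \<Longrightarrow> Lp_on a b p (\<lambda>x. f x - g x)"
  using Lp_on_add[of a b p f "\<lambda>x. - g x"] Lp_on_uminus[of a b p g] by simp

lemma Lp_on_bounded:
  assumes "f \<in> borel_measurable (lebesgue_on {a..b})" "0 \<le> p" "\<And>x. x \<in> {a..b} \<Longrightarrow> norm (f x) \<le> M"
  shows "Lp_on a b p f"
  by (rule Lp_onI_bound[OF assms(1), of "\<lambda>_. M powr p"])
     (use assms in \<open>auto intro!: powr_mono2 integrable_const_ivl\<close>)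

lemma Lp_on_continuous:
  assumes "continuous_on {a..b} f" "0 \<le> p"
  shows "Lp_on a b p f"
proof -
  have "bounded (f ` {a..b})"
    by (intro compact_imp_bounded compact_continuous_image assms(1) compact_Icc)
  then obtain M where "\<And>x. x \<in> {a..b} \<Longrightarrow> norm (f x) \<le> M" unfolding bounded_iff by blast
  then show ?thesis
    using assms by (intro Lp_on_bounded) (auto intro: continuous_imp_measurable_on_sets_lebesgue)
qed

lemma Lp_on_subinterval: "Lp_on a b p f \<Longrightarrow> {c..d} \<subseteq> {a..b} \<Longrightarrow> Lp_on c d p f"
  unfolding Lp_on_def
  by (metis (no_types, lifting) integrable_on_subinterval measurable_restrict_mono)

lemma Lp_on_imp_absolutely_integrable:
  assumes L: "Lp_on a b p f" and p: "1 \<le> p"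
  shows "f absolutely_integrable_on {a..b}"
proof (rule measurable_bounded_by_integrable_imp_absolutely_integrable)
  show "f \<in> borel_measurable (lebesgue_on {a..b})" using L by (simp add: Lp_on_def)
  show "(\<lambda>x. 1 + norm (f x) powr p) integrable_on {a..b}"
    using L by (auto simp: Lp_on_def intro!: integrable_add integrable_const_ivl)
  show "norm (f x) \<le> 1 + norm (f x) powr p" for x
  proof (cases "norm (f x) \<le> 1")
    case True then show ?thesis by (simp add: add_increasing2)
  next
    case False
    then have "norm (f x) powr 1 \<le> norm (f x) powr p" using p by (intro powr_mono) auto
    then show ?thesis using False by simp
  qed
qed simp

section \<open>Translation, reflection, Hoelder's inequality and density\<close>

lemma borel_measurable_lebesgue_on_shift:
  fixes f :: "real \<Rightarrow> 'a::euclidean_space"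
  assumes "f \<in> borel_measurable (lebesgue_on {a..b})"
  shows "(\<lambda>x. f (x + c)) \<in> borel_measurable (lebesgue_on {a - c..b - c})"
    and "(\<lambda>x. f (c - x)) \<in> borel_measurable (lebesgue_on {c - b..c - a})"
proof -
  have m: "(\<lambda>x. if x \<in> {a..b} then f x else 0) \<in> borel_measurable lebesgue"
    using assms by (intro iffD2[OF borel_measurable_if]) auto
  have "(\<lambda>x. if c + x \<in> {a..b} then f (c + x) else 0) \<in> borel_measurable lebesgue"
    using borel_measurable_affine[OF m, of 1 c] by (simp cong: if_cong)
  also have "(\<lambda>x. if c + x \<in> {a..b} then f (c + x) else 0) = (\<lambda>x. if x \<in> {a - c..b - c} then f (x + c) else 0)"
    by (auto simp: fun_eq_iff add.commute)
  finally show "(\<lambda>x. f (x + c)) \<in> borel_measurable (lebesgue_on {a - c..b - c})"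
    by (rule iffD1[OF borel_measurable_if, rotated]) auto
  have "(\<lambda>x. if c - x \<in> {a..b} then f (c - x) else 0) \<in> borel_measurable lebesgue"
    using borel_measurable_affine[OF m, of "-1" c] by (simp cong: if_cong)
  also have "(\<lambda>x. if c - x \<in> {a..b} then f (c - x) else 0) = (\<lambda>x. if x \<in> {c - b..c - a} then f (c - x) else 0)"
    by (auto simp: fun_eq_iff)
  finally show "(\<lambda>x. f (c - x)) \<in> borel_measurable (lebesgue_on {c - b..c - a})"
    by (rule iffD1[OF borel_measurable_if, rotated]) auto
qed

lemma integral_reflect_at:
  fixes f :: "real \<Rightarrow> 'a::euclidean_space"
  shows "integral {c - b..c - a} (\<lambda>x. f (c - x)) = integral {a..b} f"
    and "(\<lambda>x. f (c - x)) integrable_on {c - b..c - a} \<longleftrightarrow> f integrable_on {a..b}"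
proof -
  show "integral {c - b..c - a} (\<lambda>x. f (c - x)) = integral {a..b} f"
    using Henstock_Kurzweil_Integration.integral_reflect_real[of "b - c" "a - c" "\<lambda>x. f (x + c)"] integral_shift_real_ivl[of a c b f]
    by simp
  show "(\<lambda>x. f (c - x)) integrable_on {c - b..c - a} \<longleftrightarrow> f integrable_on {a..b}"
    using Henstock_Kurzweil_Integration.integrable_reflect_real[of "\<lambda>x. f (x + c)" "b - c" "a - c"] integrable_shift_real_ivl_iff[of f c a b]
    by simp
qed

lemma absolutely_integrable_shift:
  fixes f :: "real \<Rightarrow> 'a::euclidean_space"
  shows "(\<lambda>x. f (x + c)) absolutely_integrable_on {a - c..b - c} \<longleftrightarrow> f absolutely_integrable_on {a..b}"
  unfolding absolutely_integrable_on_def integrable_shift_real_ivl_iff integrable_shift_real_ivl_iff[of "\<lambda>x. norm (f x)"] ..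

lemma Lp_on_shift: "Lp_on a b p f \<Longrightarrow> Lp_on (a - c) (b - c) p (\<lambda>x. f (x + c))"
  unfolding Lp_on_def
  using borel_measurable_lebesgue_on_shift(1)[of f a b c] integrable_shift_real_ivl_iff[of "\<lambda>x. norm (f x) powr p" c a b]
  by auto

lemma Lp_on_reflect: "Lp_on a b p f \<Longrightarrow> Lp_on (c - b) (c - a) p (\<lambda>x. f (c - x))"
  unfolding Lp_on_def
  using borel_measurable_lebesgue_on_shift(2)[of f a b c] integral_reflect_at(2)[of "\<lambda>x. norm (f x) powr p" c b a]
  by auto

text \<open>Young's inequality for the two functions divided by their norms.\<close>

lemma Hoelder_inequality:
  fixes f g :: "real \<Rightarrow> complex"
  assumes pq: "1 < p" "1 < q" "1 / p + 1 / q = 1"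
    and f: "Lp_on a b p f" and g: "Lp_on a b q g"
  shows "(\<lambda>x. g x * f x) absolutely_integrable_on {a..b}"
    and "integral {a..b} (\<lambda>x. norm (g x * f x))
      \<le> (integral {a..b} (\<lambda>x. norm (g x) powr q)) powr (1/q) * (integral {a..b} (\<lambda>x. norm (f x) powr p)) powr (1/p)"
proof -
  define F where "F = integral {a..b} (\<lambda>x. norm (f x) powr p)"
  define G where "G = integral {a..b} (\<lambda>x. norm (g x) powr q)"
  have fi: "(\<lambda>x. norm (f x) powr p) integrable_on {a..b}" and gi: "(\<lambda>x. norm (g x) powr q) integrable_on {a..b}"
    using f g by (auto simp: Lp_on_def)
  have FG: "F \<ge> 0" "G \<ge> 0" unfolding F_def G_def using fi gi by (auto intro: integral_nonneg)
  have "(\<lambda>x. g x * f x) \<in> borel_measurable (lebesgue_on {a..b})"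
    using f g by (auto simp: Lp_on_def)
  moreover have "(\<lambda>x. norm (g x) powr q / q + norm (f x) powr p / p) integrable_on {a..b}"
    using fi gi by (intro integrable_add integrable_on_divide)
  moreover have "norm (g x * f x) \<le> norm (g x) powr q / q + norm (f x) powr p / p" for x
    using Youngs_inequality[of p q "norm (f x)" "norm (g x)"] pq by (simp add: norm_mult mult.commute add.commute)
  ultimately show ai: "(\<lambda>x. g x * f x) absolutely_integrable_on {a..b}"
    by (intro measurable_bounded_by_integrable_imp_absolutely_integrable) auto
  have nai: "(\<lambda>x. norm (g x * f x)) integrable_on {a..b}" using ai by (simp add: absolutely_integrable_on_def)
  have key: "integral {a..b} (\<lambda>x. norm (g x * f x)) \<le> (G powr (1/q) + e) * (F powr (1/p) + e)" if e: "e > 0" for e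
  proof -
    \<comment> \<open>The summand \<open>e\<close> permits the division by \<open>A\<close> and \<open>B\<close> even if a norm is 0.\<close>
    define A where "A = F powr (1/p) + e"
    define B where "B = G powr (1/q) + e"
    have AB: "A > 0" "B > 0" using e by (auto simp: A_def B_def intro!: add_nonneg_pos)
    have "F = (F powr (1/p)) powr p" using FG pq by (simp add: powr_powr)
    also have "\<dots> \<le> A powr p" using e pq by (intro powr_mono2) (auto simp: A_def)
    finally have FA: "F \<le> A powr p" .
    have "G = (G powr (1/q)) powr q" using FG pq by (simp add: powr_powr)
    also have "\<dots> \<le> B powr q" using e pq by (intro powr_mono2) (auto simp: B_def)
    finally have GB: "G \<le> B powr q" .
    have "norm (g x * f x) \<le> A * B * (norm (g x) powr q / (q * B powr q) + norm (f x) powr p / (p * A powr p))" for x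
    proof -
      have "norm (f x) / A * (norm (g x) / B) \<le> (norm (f x) / A) powr p / p + (norm (g x) / B) powr q / q"
        using Youngs_inequality[of p q "norm (f x) / A" "norm (g x) / B"] pq AB by simp
      also have "\<dots> = norm (g x) powr q / (q * B powr q) + norm (f x) powr p / (p * A powr p)"
        using AB by (simp add: powr_divide mult.commute)
      finally have "A * B * (norm (f x) / A * (norm (g x) / B)) \<le> A * B * (norm (g x) powr q / (q * B powr q) + norm (f x) powr p / (p * A powr p))"
        using AB by (intro mult_left_mono) auto
      then show ?thesis using AB by (simp add: norm_mult mult.commute)
    qed
    then have "integral {a..b} (\<lambda>x. norm (g x * f x))
      \<le> integral {a..b} (\<lambda>x. A * B * (norm (g x) powr q / (q * B powr q) + norm (f x) powr p / (p * A powr p)))"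
      using fi gi by (intro integral_le nai integrable_on_mult_right integrable_add integrable_on_divide) auto
    also have "\<dots> = A * B * (G / (q * B powr q) + F / (p * A powr p))"
      using fi gi by (simp add: integral_add integrable_on_divide F_def G_def)
    also have "\<dots> \<le> A * B * (1 / q + 1 / p)"
    proof (intro mult_left_mono add_mono)
      show "G / (q * B powr q) \<le> 1 / q" using GB AB pq by (simp add: field_simps)
      show "F / (p * A powr p) \<le> 1 / p" using FA AB pq by (simp add: field_simps)
    qed (use AB in auto)
    also have "\<dots> = B * A" using pq by (simp add: add.commute)
    finally show ?thesis by (simp add: A_def B_def)
  qed
  have "(\<lambda>n. (G powr (1/q) + inverse (real (Suc n))) * (F powr (1/p) + inverse (real (Suc n))))
      \<longlonglongrightarrow> (G powr (1/q) + 0) * (F powr (1/p) + 0)"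
    by (intro tendsto_mult tendsto_add tendsto_const LIMSEQ_inverse_real_of_nat)
  then have "integral {a..b} (\<lambda>x. norm (g x * f x)) \<le> (G powr (1/q) + 0) * (F powr (1/p) + 0)"
    by (rule LIMSEQ_le_const) (auto intro!: key exI[of _ 0])
  then show "integral {a..b} (\<lambda>x. norm (g x * f x))
      \<le> (integral {a..b} (\<lambda>x. norm (g x) powr q)) powr (1/q) * (integral {a..b} (\<lambda>x. norm (f x) powr p)) powr (1/p)"
    by (simp add: F_def G_def)
qed

text \<open>A measurable function is an almost everywhere limit of continuous functions \<open>G n\<close>.  Projecting
  the values onto the ball of radius \<open>K\<close> makes dominated convergence applicable, and adding a
  narrow hat function prescribes the value at the point \<open>c\<close>.\<close>

lemma Lp_bounded_continuous_approx:
  fixes f :: "real \<Rightarrow> 'a::euclidean_space"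
  assumes m: "f \<in> borel_measurable (lebesgue_on {a..b})" and K: "\<And>x. norm (f x) \<le> K"
    and p: "0 < p" and e: "0 < e"
  shows "\<exists>h. continuous_on UNIV h \<and> h c = f c \<and> integral {a..b} (\<lambda>x. norm (f x - h x) powr p) < e"
proof -
  have "K \<ge> 0" using K[of 0] norm_ge_zero[of "f 0"] by linarith
  have "f measurable_on {a..b}" using m by (simp add: measurable_on_iff_borel_measurable)
  then obtain N G where N: "negligible N" and G: "\<And>n. continuous_on UNIV (G n)"
      and lim: "\<And>x. x \<notin> N \<Longrightarrow> (\<lambda>n. G n x) \<longlonglongrightarrow> (if x \<in> {a..b} then f x else 0)"
    unfolding measurable_on_def by blast
  define \<kappa> where "\<kappa> n x = max 0 (1 - real n * \<bar>x - c\<bar>)" for n x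
  define H where "H n x = closest_point (cball 0 K) (G n x + \<kappa> n x *\<^sub>R (f c - G n c))" for n x
  have clamp: "continuous_on UNIV (closest_point (cball (0::'a) K))"
    by (rule continuous_on_closest_point) (use \<open>K \<ge> 0\<close> in auto)
  have H_cont: "continuous_on UNIV (H n)" for n
    unfolding H_def \<kappa>_def
    by (intro continuous_on_compose2[OF clamp] continuous_intros G) auto
  have H_c: "H n c = f c" for n
    using K[of c] by (simp add: H_def \<kappa>_def closest_point_self)
  have H_K: "norm (H n x) \<le> K" for n x
  proof -
    have "H n x \<in> cball 0 K"
      unfolding H_def by (rule closest_point_in_set) (use \<open>K \<ge> 0\<close> in auto)
    then show ?thesis by simp
  qed
  have H_lim: "(\<lambda>n. H n x) \<longlonglongrightarrow> f x" if x: "x \<in> {a..b}" "x \<notin> insert c N" for x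
  proof -
    have "eventually (\<lambda>n. \<kappa> n x = 0) sequentially"
    proof -
      have "x \<noteq> c" using x by auto
      obtain n0 where n0: "1 / \<bar>x - c\<bar> < real n0" using reals_Archimedean2 by blast
      have "\<kappa> n x = 0" if "n \<ge> n0" for n
      proof -
        have "1 / \<bar>x - c\<bar> < real n" using n0 that by linarith
        then have "1 < real n * \<bar>x - c\<bar>" using \<open>x \<noteq> c\<close> by (simp add: field_simps)
        then show ?thesis by (simp add: \<kappa>_def)
      qed
      then show ?thesis unfolding eventually_sequentially by blast
    qed
    then have "eventually (\<lambda>n. G n x = G n x + \<kappa> n x *\<^sub>R (f c - G n c)) sequentially"
      by (rule eventually_mono) simp
    moreover have "(\<lambda>n. G n x) \<longlonglongrightarrow> f x" using lim[of x] x by simp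
    ultimately have "(\<lambda>n. G n x + \<kappa> n x *\<^sub>R (f c - G n c)) \<longlonglongrightarrow> f x"
      by (rule Lim_transform_eventually[rotated])
    then have "(\<lambda>n. H n x) \<longlonglongrightarrow> closest_point (cball 0 K) (f x)"
      unfolding H_def by (rule continuous_on_tendsto_compose[OF clamp]) auto
    then show ?thesis using K[of x] by (simp add: closest_point_self)
  qed
  \<comment> \<open>Convergence may fail on \<open>N\<close> and at \<open>c\<close>, so the integrand is set to 0 there.\<close>
  define F where "F n x = (if x \<in> insert c N then 0 else norm (f x - H n x) powr p)" for n x
  have Lp: "Lp_on a b p (\<lambda>x. f x - H n x)" for n
    by (intro Lp_on_diff Lp_on_bounded[OF m] Lp_on_continuous continuous_on_subset[OF H_cont])
       (use p K in auto)
  have N': "negligible (insert c N)" using N by simp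
  have FI: "F n integrable_on {a..b}" for n
    by (rule integrable_spike[OF _ N']) (use Lp[of n] in \<open>auto simp: F_def Lp_on_def\<close>)
  have FE: "integral {a..b} (F n) = integral {a..b} (\<lambda>x. norm (f x - H n x) powr p)" for n
    by (rule integral_spike[OF N']) (auto simp: F_def)
  have "(\<lambda>n. integral {a..b} (F n)) \<longlonglongrightarrow> integral {a..b} (\<lambda>x. 0)"
  proof (rule dominated_convergence(2)[where h = "\<lambda>_. (2 * K) powr p"])
    show "(\<lambda>_. (2 * K) powr p) integrable_on {a..b}" by (rule integrable_const_ivl)
    show "norm (F n x) \<le> (2 * K) powr p" for n x
    proof -
      have "norm (f x - H n x) \<le> 2 * K"
        using norm_triangle_ineq4[of "f x" "H n x"] K[of x] H_K[of n x] by linarith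
      then show ?thesis unfolding F_def using p by (auto intro: powr_mono2)
    qed
    show "(\<lambda>n. F n x) \<longlonglongrightarrow> 0" if "x \<in> {a..b}" for x
    proof (cases "x \<in> insert c N")
      case False
      have "(\<lambda>n. norm (f x - H n x) powr p) \<longlonglongrightarrow> norm (f x - f x) powr p"
        by (intro tendsto_powr' tendsto_norm tendsto_diff tendsto_const H_lim) (use that False p in auto)
      then show ?thesis using False p by (simp add: F_def)
    qed (simp add: F_def)
  qed (rule FI)
  then have "(\<lambda>n. integral {a..b} (\<lambda>x. norm (f x - H n x) powr p)) \<longlonglongrightarrow> 0" by (simp add: FE)
  from eventually_happens'[OF sequentially_bot order_tendstoD(2)[OF this e]]
  obtain n where "integral {a..b} (\<lambda>x. norm (f x - H n x) powr p) < e" by blast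
  then show ?thesis using H_cont H_c by blast
qed

text \<open>The value at \<open>c\<close> is reproduced exactly, so that for \<open>c = 0\<close> the approximation is also one in the
  norm that includes the point mass.\<close>

lemma Lp_continuous_approx:
  fixes f :: "real \<Rightarrow> 'a::euclidean_space"
  assumes f: "Lp_on a b p f" and p: "0 < p" and e: "0 < e"
  shows "\<exists>h. continuous_on UNIV h \<and> h c = f c \<and> integral {a..b} (\<lambda>x. norm (f x - h x) powr p) < e"
proof -
  have m: "f \<in> borel_measurable (lebesgue_on {a..b})" and fi: "(\<lambda>x. norm (f x) powr p) integrable_on {a..b}"
    using f by (auto simp: Lp_on_def)
  define T where "T n x = (if norm (f x) \<le> real n then f x else 0)" for n x
  have T_m: "T n \<in> borel_measurable (lebesgue_on {a..b})" for n
    unfolding T_def using m by measurable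
  have d_m: "(\<lambda>x. f x - T n x) \<in> borel_measurable (lebesgue_on {a..b})" for n
    using m T_m by measurable
  have le: "norm (f x - T n x) \<le> norm (f x)" for n x by (simp add: T_def)
  have d_Lp: "Lp_on a b p (\<lambda>x. f x - T n x)" for n
    by (rule Lp_on_norm_le[OF f d_m]) (use p le in auto)
  have "(\<lambda>n. integral {a..b} (\<lambda>x. norm (f x - T n x) powr p)) \<longlonglongrightarrow> integral {a..b} (\<lambda>x. 0)"
  proof (rule dominated_convergence(2)[OF _ fi])
    show "(\<lambda>x. norm (f x - T n x) powr p) integrable_on {a..b}" for n using d_Lp by (simp add: Lp_on_def)
    show "norm (norm (f x - T n x) powr p) \<le> norm (f x) powr p" for n x
      using le[of x n] p by (auto intro: powr_mono2)
    show "(\<lambda>n. norm (f x - T n x) powr p) \<longlonglongrightarrow> 0" for x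
    proof (rule tendsto_eventually)
      obtain n0 where n0: "norm (f x) < real n0" using reals_Archimedean2 by blast
      have "norm (f x - T n x) powr p = 0" if "n \<ge> n0" for n
        using n0 that p by (simp add: T_def)
      then show "eventually (\<lambda>n. norm (f x - T n x) powr p = 0) sequentially"
        unfolding eventually_sequentially by blast
    qed
  qed
  then have lim: "(\<lambda>n. integral {a..b} (\<lambda>x. norm (f x - T n x) powr p)) \<longlonglongrightarrow> 0" by simp
  define e' where "e' = e / (2 * 2 powr p)"
  have e': "e' > 0" using e by (simp add: e'_def)
  obtain n0 where n0: "norm (f c) < real n0" using reals_Archimedean2 by blast
  have "eventually (\<lambda>n. integral {a..b} (\<lambda>x. norm (f x - T n x) powr p) < e' \<and> n \<ge> n0) sequentially"
    by (intro eventually_conj order_tendstoD(2)[OF lim e'] eventually_ge_at_top)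
  from eventually_happens'[OF sequentially_bot this]
  obtain n where n: "integral {a..b} (\<lambda>x. norm (f x - T n x) powr p) < e'" "n \<ge> n0" by blast
  have "norm (T n x) \<le> real n" for x by (simp add: T_def)
  from Lp_bounded_continuous_approx[OF T_m this p e', of c]
  obtain h where h: "continuous_on UNIV h" "h c = T n c" "integral {a..b} (\<lambda>x. norm (T n x - h x) powr p) < e'" by blast
  have hc: "h c = f c" using h(2) n n0 by (simp add: T_def)
  have L1: "Lp_on a b p (\<lambda>x. T n x - h x)" 
    by (intro Lp_on_diff Lp_on_bounded[OF T_m, of _ _ "real n"] Lp_on_continuous continuous_on_subset[OF h(1)])
       (use p in \<open>auto simp: T_def\<close>)
  have L2: "Lp_on a b p (\<lambda>x. f x - h x)" 
    using Lp_on_add[OF d_Lp[of n] L1] p by simp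
  have "integral {a..b} (\<lambda>x. norm (f x - h x) powr p)
     \<le> integral {a..b} (\<lambda>x. 2 powr p * (norm (f x - T n x) powr p + norm (T n x - h x) powr p))"
  proof (rule integral_le)
    show "norm (f x - h x) powr p \<le> 2 powr p * (norm (f x - T n x) powr p + norm (T n x - h x) powr p)" for x
    proof -
      have "norm (f x - h x) \<le> norm (f x - T n x) + norm (T n x - h x)"
        using norm_triangle_ineq[of "f x - T n x" "T n x - h x"] by simp
      then have "norm (f x - h x) powr p \<le> (norm (f x - T n x) + norm (T n x - h x)) powr p"
        using p by (intro powr_mono2) auto
      also have "\<dots> \<le> 2 powr p * (norm (f x - T n x) powr p + norm (T n x - h x) powr p)"
        using p by (intro powr_add_le) auto
      finally show ?thesis .
    qed
  qed (use L1 L2 d_Lp in \<open>auto simp: Lp_on_def intro!: integrable_add\<close>)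
  also have "\<dots> = 2 powr p * (integral {a..b} (\<lambda>x. norm (f x - T n x) powr p) + integral {a..b} (\<lambda>x. norm (T n x - h x) powr p))"
    using L1 d_Lp by (simp add: integral_add Lp_on_def)
  also have "\<dots> < 2 powr p * (e' + e')"
    using n(1) h(3) by (intro mult_strict_left_mono add_strict_mono) auto
  also have "\<dots> = e" by (simp add: e'_def)
  finally show ?thesis using h(1) hc by blast
qed

section \<open>Correlation of two functions\<close>

text \<open>Two effects are estimated separately: a change of the parameter alters the bounded factor \<open>w\<close>
  uniformly by a small amount, and a change of the upper limit alters the primitive of \<open>norm x\<close> by
  a small amount.\<close>

lemma continuous_on_integral_upper_limit:
  fixes w :: "'c::metric_space \<Rightarrow> real \<Rightarrow> complex" and x :: "real \<Rightarrow> complex"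
  assumes C: "compact C" and w: "continuous_on (C \<times> {a..b}) (\<lambda>(c, v). w c v)"
    and x: "x absolutely_integrable_on {a..b}"
  shows "continuous_on (C \<times> {a..b}) (\<lambda>(c, u). integral {a..u} (\<lambda>v. w c v * x v))"
  unfolding continuous_on_iff
proof (intro ballI allI impI)
  fix z e assume z: "z \<in> C \<times> {a..b}" and e: "(0::real) < e"
  obtain c u where [simp]: "z = (c, u)" by force
  have cu: "c \<in> C" "u \<in> {a..b}" using z by auto
  define J where "J s = integral {a..s} (\<lambda>v. norm (x v))" for s
  have nx: "(\<lambda>v. norm (x v)) integrable_on {a..b}" using x by (simp add: absolutely_integrable_on_def)
  have J0: "J b \<ge> 0" unfolding J_def using nx by (intro integral_nonneg) auto
  have "continuous_on {a..b} J" unfolding J_def by (rule indefinite_integral_continuous_1[OF nx])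
  have "bounded ((\<lambda>(c, v). w c v) ` (C \<times> {a..b}))"
    by (intro compact_imp_bounded compact_continuous_image w compact_Times C compact_Icc)
  then obtain M0 where M0: "\<And>y. y \<in> C \<times> {a..b} \<Longrightarrow> norm (case y of (c, v) \<Rightarrow> w c v) \<le> M0"
    unfolding bounded_iff by blast
  define M where "M = max 1 M0"
  have M: "M > 0" "\<And>c v. c \<in> C \<Longrightarrow> v \<in> {a..b} \<Longrightarrow> norm (w c v) \<le> M"
    using M0 by (force simp: M_def)+
  have "uniformly_continuous_on (C \<times> {a..b}) (\<lambda>(c, v). w c v)"
    by (intro compact_uniformly_continuous w compact_Times C compact_Icc)
  moreover have "e / (2 * (J b + 1)) > 0" using e J0 by simp
  ultimately obtain \<delta> where \<delta>: "\<delta> > 0" "\<And>y y'. y \<in> C \<times> {a..b} \<Longrightarrow> y' \<in> C \<times> {a..b} \<Longrightarrow> dist y' y < \<delta> \<Longrightarrow>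
       dist (case y' of (s, x) \<Rightarrow> w s x) (case y of (s, x) \<Rightarrow> w s x) < e / (2 * (J b + 1))"
    unfolding uniformly_continuous_on_def by metis
  have "e / (2 * M) > 0" using e M by simp
  then obtain \<delta>' where \<delta>': "\<delta>' > 0" "\<And>s. s \<in> {a..b} \<Longrightarrow> dist s u < \<delta>' \<Longrightarrow> dist (J s) (J u) < e / (2 * M)"
    using \<open>continuous_on {a..b} J\<close> cu unfolding continuous_on_iff by metis
  have ai: "(\<lambda>v. w c' v * x v) absolutely_integrable_on {a..b}" if "c' \<in> C" for c'
  proof (rule absolutely_integrable_bounded_measurable_product[OF bilinear_times _ _ _ x])
    have "continuous_on {a..b} (w c')" by (rule continuous_on_curry1[OF w that])
    then show "w c' \<in> borel_measurable (lebesgue_on {a..b})"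
      by (intro continuous_imp_measurable_on_sets_lebesgue) auto
    show "bounded (w c' ` {a..b})" unfolding bounded_iff using M(2)[OF that] by blast
  qed auto
  have sub: "(\<lambda>v. w c' v * x v) integrable_on {s..t}" if "c' \<in> C" "{s..t} \<subseteq> {a..b}" for c' s t
    using absolutely_integrable_on_subinterval[OF ai[OF that(1)] that(2)] by (simp add: absolutely_integrable_on_def)
  have nsub: "(\<lambda>v. norm (x v)) integrable_on {s..t}" if "{s..t} \<subseteq> {a..b}" for s t
    by (rule integrable_on_subinterval[OF nx that])
  have tail: "norm (integral {s..t} (\<lambda>v. w c v * x v)) \<le> M * (J t - J s)" if st: "s \<in> {a..b}" "t \<in> {a..b}" "s \<le> t" for s t
  proof -
    have ss: "{s..t} \<subseteq> {a..b}" using st by auto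
    have "norm (integral {s..t} (\<lambda>v. w c v * x v)) \<le> integral {s..t} (\<lambda>v. M * norm (x v))"
      by (intro integral_norm_bound_integral sub nsub integrable_on_mult_right ss cu)
         (use M cu ss in \<open>auto simp: norm_mult intro!: mult_right_mono\<close>)
    also have "\<dots> = M * (J t - J s)"
      using Henstock_Kurzweil_Integration.integral_combine[of a s t "\<lambda>v. norm (x v)"] nsub[of a t] st by (simp add: J_def)
    finally show ?thesis .
  qed
  show "\<exists>d>0. \<forall>y\<in>C \<times> {a..b}. dist y z < d \<longrightarrow>
      dist (case y of (c, u) \<Rightarrow> integral {a..u} (\<lambda>v. w c v * x v)) (case z of (c, u) \<Rightarrow> integral {a..u} (\<lambda>v. w c v * x v)) < e"
  proof (intro exI[of _ "min \<delta> \<delta>'"] conjI ballI impI)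
    show "min \<delta> \<delta>' > 0" using \<delta> \<delta>' by simp
    fix y assume y: "y \<in> C \<times> {a..b}" and d: "dist y z < min \<delta> \<delta>'"
    obtain c' u' where [simp]: "y = (c', u')" by force
    have cu': "c' \<in> C" "u' \<in> {a..b}" using y by auto
    have dc: "dist c' c < \<delta>" "dist u' u < \<delta>'"
      using d dist_fst_le[of y z] dist_snd_le[of y z] by auto
    have "norm (integral {a..u'} (\<lambda>v. w c' v * x v) - integral {a..u'} (\<lambda>v. w c v * x v))
       = norm (integral {a..u'} (\<lambda>v. w c' v * x v - w c v * x v))"
      using cu cu' by (subst integral_diff) (auto intro!: sub)
    also have "\<dots> \<le> integral {a..u'} (\<lambda>v. e / (2 * (J b + 1)) * norm (x v))"
    proof (intro integral_norm_bound_integral integrable_diff sub nsub integrable_on_mult_right)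
      fix v assume v: "v \<in> {a..u'}"
      have "dist (w c' v) (w c v) < e / (2 * (J b + 1))"
        using \<delta>(2)[of "(c, v)" "(c', v)"] cu cu' v dc by (auto simp: dist_Pair_Pair)
      then have "norm (w c' v - w c v) * norm (x v) \<le> e / (2 * (J b + 1)) * norm (x v)"
        by (intro mult_right_mono) (auto simp: dist_norm)
      then show "norm (w c' v * x v - w c v * x v) \<le> e / (2 * (J b + 1)) * norm (x v)"
        by (simp add: norm_mult flip: left_diff_distrib)
    qed (use cu cu' in auto)
    also have "\<dots> = e / (2 * (J b + 1)) * J u'" by (simp add: J_def)
    also have "\<dots> \<le> e / (2 * (J b + 1)) * J b"
    proof (intro mult_left_mono)
      show "J u' \<le> J b" unfolding J_def using cu' by (intro integral_subset_le nsub) auto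
    qed (use e J0 in auto)
    also have "\<dots> < e / 2" using e J0 by (simp add: field_simps)
    finally have 1: "norm (integral {a..u'} (\<lambda>v. w c' v * x v) - integral {a..u'} (\<lambda>v. w c v * x v)) < e / 2" .
    have "norm (integral {a..u'} (\<lambda>v. w c v * x v) - integral {a..u} (\<lambda>v. w c v * x v)) \<le> M * \<bar>J u' - J u\<bar>"
    proof (cases "u \<le> u'")
      case True
      then have "integral {a..u'} (\<lambda>v. w c v * x v) - integral {a..u} (\<lambda>v. w c v * x v) = integral {u..u'} (\<lambda>v. w c v * x v)"
        using Henstock_Kurzweil_Integration.integral_combine[of a u u' "\<lambda>v. w c v * x v"] sub[of c a u'] cu cu' by (auto simp: algebra_simps)
      moreover have "M * (J u' - J u) \<le> M * \<bar>J u' - J u\<bar>" using M by (intro mult_left_mono) auto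
      ultimately show ?thesis using tail[of u u'] True cu cu' by simp
    next
      case False
      then have "integral {a..u} (\<lambda>v. w c v * x v) - integral {a..u'} (\<lambda>v. w c v * x v) = integral {u'..u} (\<lambda>v. w c v * x v)"
        using Henstock_Kurzweil_Integration.integral_combine[of a u' u "\<lambda>v. w c v * x v"] sub[of c a u] cu cu' by (auto simp: algebra_simps)
      moreover have "M * (J u - J u') \<le> M * \<bar>J u' - J u\<bar>" using M by (intro mult_left_mono) auto
      ultimately show ?thesis using tail[of u' u] False cu cu' by (subst norm_minus_commute) simp
    qed
    also have "\<dots> < M * (e / (2 * M))"
      using \<delta>'(2)[OF cu'(2) dc(2)] M by (intro mult_strict_left_mono) (auto simp: dist_norm)
    also have "\<dots> = e / 2" using M by simp
    finally have 2: "norm (integral {a..u'} (\<lambda>v. w c v * x v) - integral {a..u} (\<lambda>v. w c v * x v)) < e / 2" .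
    show "dist (case y of (c, u) \<Rightarrow> integral {a..u} (\<lambda>v. w c v * x v)) (case z of (c, u) \<Rightarrow> integral {a..u} (\<lambda>v. w c v * x v)) < e"
      using norm_triangle_lt[OF add_strict_mono[OF 1 2, simplified]] by (simp add: dist_norm)
  qed
qed

definition correlation :: "(real \<Rightarrow> complex) \<Rightarrow> (real \<Rightarrow> complex) \<Rightarrow> real \<Rightarrow> complex" where
  "correlation \<psi> \<phi> \<theta> = integral {\<theta>..0} (\<lambda>\<xi>. \<psi> (\<xi> - \<theta>) * \<phi> \<xi>)"

definition Lp_seminorm :: "real \<Rightarrow> real \<Rightarrow> real \<Rightarrow> (real \<Rightarrow> 'a::euclidean_space) \<Rightarrow> real" where
  "Lp_seminorm a b p f = (integral {a..b} (\<lambda>x. norm (f x) powr p)) powr (1 / p)"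

lemma correlation_integrable:
  assumes pq: "1 < p" "1 < q" "1 / p + 1 / q = 1"
    and \<psi>: "Lp_on 0 r q \<psi>" and \<phi>: "Lp_on (-r) 0 p \<phi>" and \<theta>: "\<theta> \<in> {-r..0}"
  shows "(\<lambda>\<xi>. \<psi> (\<xi> - \<theta>) * \<phi> \<xi>) absolutely_integrable_on {\<theta>..0}"
    and "norm (correlation \<psi> \<phi> \<theta>) \<le> Lp_seminorm 0 r q \<psi> * Lp_seminorm (-r) 0 p \<phi>"
proof -
  have "Lp_on 0 (-\<theta>) q \<psi>" by (rule Lp_on_subinterval[OF \<psi>]) (use \<theta> in auto)
  from Lp_on_shift[OF this, of "-\<theta>"] have \<psi>': "Lp_on \<theta> 0 q (\<lambda>\<xi>. \<psi> (\<xi> - \<theta>))" by simp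
  have \<phi>': "Lp_on \<theta> 0 p \<phi>" by (rule Lp_on_subinterval[OF \<phi>]) (use \<theta> in auto)
  note H = Hoelder_inequality[OF pq \<phi>' \<psi>']
  show "(\<lambda>\<xi>. \<psi> (\<xi> - \<theta>) * \<phi> \<xi>) absolutely_integrable_on {\<theta>..0}" by (rule H(1))
  then have "norm (correlation \<psi> \<phi> \<theta>) \<le> integral {\<theta>..0} (\<lambda>\<xi>. norm (\<psi> (\<xi> - \<theta>) * \<phi> \<xi>))"
    unfolding correlation_def by (intro integral_norm_bound_integral) (auto simp: absolutely_integrable_on_def)
  also have "\<dots> \<le> (integral {\<theta>..0} (\<lambda>\<xi>. norm (\<psi> (\<xi> - \<theta>)) powr q)) powr (1/q) * (integral {\<theta>..0} (\<lambda>\<xi>. norm (\<phi> \<xi>) powr p)) powr (1/p)"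
    by (rule H(2))
  also have "\<dots> \<le> Lp_seminorm 0 r q \<psi> * Lp_seminorm (-r) 0 p \<phi>"
    unfolding Lp_seminorm_def
  proof (intro mult_mono powr_mono2)
    have "integral {\<theta>..0} (\<lambda>\<xi>. norm (\<psi> (\<xi> - \<theta>)) powr q) = integral {0..-\<theta>} (\<lambda>\<xi>. norm (\<psi> \<xi>) powr q)"
      using integral_shift_real_ivl[of 0 "-\<theta>" "-\<theta>" "\<lambda>\<xi>. norm (\<psi> \<xi>) powr q"] by simp
    also have "\<dots> \<le> integral {0..r} (\<lambda>\<xi>. norm (\<psi> \<xi>) powr q)"
      using \<psi> \<theta> by (intro integral_subset_le) (auto simp: Lp_on_def intro: integrable_on_subinterval)
    finally show "integral {\<theta>..0} (\<lambda>\<xi>. norm (\<psi> (\<xi> - \<theta>)) powr q) \<le> integral {0..r} (\<lambda>\<xi>. norm (\<psi> \<xi>) powr q)" .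
    show "integral {\<theta>..0} (\<lambda>\<xi>. norm (\<phi> \<xi>) powr p) \<le> integral {-r..0} (\<lambda>\<xi>. norm (\<phi> \<xi>) powr p)"
      using \<phi> \<theta> by (intro integral_subset_le) (auto simp: Lp_on_def intro: integrable_on_subinterval)
  qed (use pq \<psi>' \<phi>' in \<open>auto simp: Lp_on_def intro!: integral_nonneg\<close>)
  finally show "norm (correlation \<psi> \<phi> \<theta>) \<le> Lp_seminorm 0 r q \<psi> * Lp_seminorm (-r) 0 p \<phi>" .
qed

lemma correlation_add_right:
  assumes pq: "1 < p" "1 < q" "1 / p + 1 / q = 1"
    and \<psi>: "Lp_on 0 r q \<psi>" and \<phi>: "Lp_on (-r) 0 p \<phi>" and \<phi>': "Lp_on (-r) 0 p \<phi>'" and \<theta>: "\<theta> \<in> {-r..0}"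
  shows "correlation \<psi> (\<lambda>x. \<phi> x + \<phi>' x) \<theta> = correlation \<psi> \<phi> \<theta> + correlation \<psi> \<phi>' \<theta>"
  unfolding correlation_def distrib_left
  by (intro integral_add) (use correlation_integrable(1)[OF pq \<psi> _ \<theta>] \<phi> \<phi>' in \<open>auto simp: absolutely_integrable_on_def\<close>)

lemma correlation_add_left:
  assumes pq: "1 < p" "1 < q" "1 / p + 1 / q = 1"
    and \<psi>: "Lp_on 0 r q \<psi>" and \<psi>': "Lp_on 0 r q \<psi>'" and \<phi>: "Lp_on (-r) 0 p \<phi>" and \<theta>: "\<theta> \<in> {-r..0}"
  shows "correlation (\<lambda>x. \<psi> x + \<psi>' x) \<phi> \<theta> = correlation \<psi> \<phi> \<theta> + correlation \<psi>' \<phi> \<theta>"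
  unfolding correlation_def distrib_right
  by (intro integral_add) (use correlation_integrable(1)[OF pq _ \<phi> \<theta>] \<psi> \<psi>' in \<open>auto simp: absolutely_integrable_on_def\<close>)

lemma correlation_cmult:
  "correlation (\<lambda>x. c * \<psi> x) \<phi> \<theta> = c * correlation \<psi> \<phi> \<theta>"
  "correlation \<psi> (\<lambda>x. c * \<phi> x) \<theta> = c * correlation \<psi> \<phi> \<theta>"
  unfolding correlation_def by (simp_all add: mult.assoc mult.left_commute)

text \<open>If \<open>\<phi>\<close> is continuous, the claim is about a parameter integral.  In general \<open>\<phi>\<close> is an \<open>L\<^sup>p\<close> limit of
  continuous functions, and by Hoelder's inequality the correlations converge uniformly.\<close>

lemma correlation_continuous:
  assumes pq: "1 < p" "1 < q" "1 / p + 1 / q = 1" and r: "0 \<le> r"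
    and \<psi>: "Lp_on 0 r q \<psi>" and \<phi>: "Lp_on (-r) 0 p \<phi>"
  shows "continuous_on {-r..0} (correlation \<psi> \<phi>)"
proof -
  have "\<exists>h. continuous_on UNIV h \<and> h 0 = \<phi> 0 \<and> integral {-r..0} (\<lambda>x. norm (\<phi> x - h x) powr p) < inverse (real (Suc n)) powr p" for n
    by (rule Lp_continuous_approx[OF \<phi>]) (use pq in auto)
  then obtain h where h: "\<And>n. continuous_on UNIV (h n)"
     "\<And>n. integral {-r..0} (\<lambda>x. norm (\<phi> x - h n x) powr p) < inverse (real (Suc n)) powr p" by metis
  have hL: "Lp_on (-r) 0 p (h n)" for n
    by (intro Lp_on_continuous continuous_on_subset[OF h(1)]) (use pq in auto)
  have dL: "Lp_on (-r) 0 p (\<lambda>x. \<phi> x - h n x)" for n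
    using Lp_on_diff[OF \<phi> hL] pq by simp
  have cont: "continuous_on {-r..0} (correlation \<psi> (h n))" for n
  proof -
    have "continuous_on ({-r..0} \<times> {0..r}) (\<lambda>(c, u). integral {0..u} (\<lambda>v. h n (v + c) * \<psi> v))"
    proof (rule continuous_on_integral_upper_limit[OF compact_Icc])
      show "continuous_on ({-r..0} \<times> {0..r}) (\<lambda>(c, v). h n (v + c))"
        unfolding case_prod_unfold by (intro continuous_on_compose2[OF h(1)] continuous_intros) auto
      show "\<psi> absolutely_integrable_on {0..r}"
        using Lp_on_imp_absolutely_integrable[OF \<psi>] pq by simp
    qed
    moreover have "continuous_on {-r..0} (\<lambda>\<theta>. (\<theta>, -\<theta>))" by (intro continuous_intros)
    moreover have "(\<lambda>\<theta>. (\<theta>, -\<theta>)) ` {-r..0} \<subseteq> {-r..0} \<times> {0..r}" by auto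
    ultimately have "continuous_on {-r..0} (\<lambda>\<theta>. integral {0..-\<theta>} (\<lambda>v. h n (v + \<theta>) * \<psi> v))"
      by (auto dest: continuous_on_compose2)
    moreover have "integral {0..-\<theta>} (\<lambda>v. h n (v + \<theta>) * \<psi> v) = correlation \<psi> (h n) \<theta>" for \<theta>
      using integral_shift_real_ivl[of 0 "-\<theta>" "-\<theta>" "\<lambda>v. h n (v + \<theta>) * \<psi> v"]
      by (simp add: correlation_def mult.commute)
    ultimately show ?thesis by simp
  qed
  have "uniform_limit {-r..0} (\<lambda>n. correlation \<psi> (h n)) (correlation \<psi> \<phi>) sequentially"
  proof (rule uniform_limitI)
    fix e :: real assume e: "e > 0"
    have "(\<lambda>n. Lp_seminorm 0 r q \<psi> * inverse (real (Suc n))) \<longlonglongrightarrow> 0"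
      by (rule tendsto_mult_right_zero[OF LIMSEQ_inverse_real_of_nat])
    from order_tendstoD(2)[OF this e]
    show "eventually (\<lambda>n. \<forall>\<theta>\<in>{-r..0}. dist (correlation \<psi> (h n) \<theta>) (correlation \<psi> \<phi> \<theta>) < e) sequentially"
    proof (rule eventually_mono, intro ballI)
      fix n \<theta> assume n: "Lp_seminorm 0 r q \<psi> * inverse (real (Suc n)) < e" and \<theta>: "\<theta> \<in> {-r..0}"
      have "correlation \<psi> \<phi> \<theta> = correlation \<psi> (h n) \<theta> + correlation \<psi> (\<lambda>x. \<phi> x - h n x) \<theta>"
        using correlation_add_right[OF pq \<psi> hL dL \<theta>, of n n] by simp
      then have "dist (correlation \<psi> (h n) \<theta>) (correlation \<psi> \<phi> \<theta>) = norm (correlation \<psi> (\<lambda>x. \<phi> x - h n x) \<theta>)"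
        by (simp add: dist_norm)
      also have "\<dots> \<le> Lp_seminorm 0 r q \<psi> * Lp_seminorm (-r) 0 p (\<lambda>x. \<phi> x - h n x)"
        by (rule correlation_integrable(2)[OF pq \<psi> dL \<theta>])
      also have "\<dots> \<le> Lp_seminorm 0 r q \<psi> * inverse (real (Suc n))"
      proof (intro mult_left_mono)
        have "Lp_seminorm (-r) 0 p (\<lambda>x. \<phi> x - h n x) \<le> (inverse (real (Suc n)) powr p) powr (1 / p)"
          unfolding Lp_seminorm_def using pq dL[of n] h(2)[of n]
          by (intro powr_mono2) (auto simp: Lp_on_def intro!: integral_nonneg)
        then show "Lp_seminorm (-r) 0 p (\<lambda>x. \<phi> x - h n x) \<le> inverse (real (Suc n))"
          using pq by (simp add: powr_powr)
      qed (simp add: Lp_seminorm_def)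
      also note n
      finally show "dist (correlation \<psi> (h n) \<theta>) (correlation \<psi> \<phi> \<theta>) < e" .
    qed
  qed
  then show ?thesis
    by (rule uniform_limit_theorem[rotated]) (use cont in auto)
qed

lemma sum_increments:
  fixes f :: "nat \<Rightarrow> 'a::ab_group_add"
  shows "(\<Sum>i\<le>n. f (Suc i) - f i) = f (Suc n) - f 0"
  by (induction n) simp_all

text \<open>The inner Stieltjes integral extends over the varying interval \<open>{-r..\<xi>}\<close>, so this is Fubini's
  theorem for the discontinuous integrand that vanishes for \<open>\<xi> < \<theta>\<close>.  The sum over the uniform
  partition of \<open>{-r..0}\<close>, restricted to the points to the left of \<open>\<xi>\<close>, differs from the one over the
  partition truncated at \<open>\<xi>\<close> only in the interval that contains \<open>\<xi>\<close>; that difference tends to 0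
  wherever \<open>W\<close> is continuous, which is everywhere but on a countable set.\<close>

lemma RS_integral_correlation_swap:
  fixes \<psi> \<phi> g :: "real \<Rightarrow> complex"
  assumes dom: "increments_dominated (-r) 0 g W" and r: "0 \<le> r"
    and \<psi>: "continuous_on {0..r} \<psi>" and \<phi>: "continuous_on {-r..0} \<phi>"
  shows "(\<lambda>\<xi>. RS_integral (-r) \<xi> (\<lambda>\<theta>. \<psi> (\<xi> - \<theta>)) g * \<phi> \<xi>) integrable_on {-r..0}"
    and "integral {-r..0} (\<lambda>\<xi>. RS_integral (-r) \<xi> (\<lambda>\<theta>. \<psi> (\<xi> - \<theta>)) g * \<phi> \<xi>)
      = RS_integral (-r) 0 (correlation \<psi> \<phi>) g"
proof -
  define t where "t = uniform_point (-r) 0"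
  define \<delta> where "\<delta> n = (0 - (-r)) / real (Suc n)" for n
  have r': "-r \<le> (0::real)" using r by simp
  have \<delta>0: "\<delta> \<longlonglongrightarrow> 0" unfolding \<delta>_def by (rule uniform_step_tendsto_0)
  have \<delta>nn: "\<delta> n \<ge> 0" for n using r by (simp add: \<delta>_def)
  have tmono: "mono (t n)" for n unfolding t_def by (rule mono_uniform_point[OF r'])
  have tmem: "t n i \<in> {-r..0}" if "i \<le> Suc n" for n i
    unfolding t_def by (rule uniform_point_mem[OF r' that])
  have tstep: "t n (Suc i) - t n i = \<delta> n" for n i unfolding t_def \<delta>_def by (rule uniform_point_step)
  have t0: "t n 0 = -r" "t n (Suc n) = 0" for n by (simp_all add: t_def)
  have Wmono: "W u \<le> W v" if "-r \<le> u" "u \<le> v" "v \<le> 0" for u v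
    using monotone_onD[OF increments_dominated_mono[OF dom]] that by auto
  have "bounded (\<psi> ` {0..r})" by (intro compact_imp_bounded compact_continuous_image \<psi> compact_Icc)
  then obtain M where M: "\<And>x. x \<in> {0..r} \<Longrightarrow> norm (\<psi> x) \<le> M" unfolding bounded_iff by blast
  have M0: "M \<ge> 0" using M[of 0] r norm_ge_zero[of "\<psi> 0"] by (auto simp del: norm_ge_zero)
  have "bounded (\<phi> ` {-r..0})" by (intro compact_imp_bounded compact_continuous_image \<phi> compact_Icc)
  then obtain M' where M': "\<And>x. x \<in> {-r..0} \<Longrightarrow> norm (\<phi> x) \<le> M'" unfolding bounded_iff by blast
  have M'0: "M' \<ge> 0" using M'[of 0] r norm_ge_zero[of "\<phi> 0"] by (auto simp del: norm_ge_zero)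
  define G where "G \<xi> = RS_integral (-r) \<xi> (\<lambda>\<theta>. \<psi> (\<xi> - \<theta>)) g" for \<xi>
  define A where "A n \<xi> i = (if \<xi> \<in> {t n i..0} then \<psi> (\<xi> - t n i) * \<phi> \<xi> else 0)" for n \<xi> i
  define F where "F n \<xi> = (\<Sum>i\<le>n. A n \<xi> i * (g (t n (Suc i)) - g (t n i)))" for n \<xi>
  define N where "N = {\<xi> \<in> {-r..0}. \<not> continuous (at \<xi> within {-r..0}) W}"
  have N: "negligible N"
    using mono_on_ctble_discont[OF increments_dominated_mono[OF dom]]
    unfolding N_def negligible_iff_null_sets
    by (intro null_sets_completionI countable_imp_null_set_lborel) simp
  have lim: "(\<lambda>n. F n \<xi>) \<longlonglongrightarrow> G \<xi> * \<phi> \<xi>" if \<xi>: "\<xi> \<in> {-r..0}" "\<xi> \<notin> N" for \<xi>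
  proof -
    define T where "T n = (\<Sum>i\<le>n. \<psi> (\<xi> - min \<xi> (t n i)) * (g (min \<xi> (t n (Suc i))) - g (min \<xi> (t n i))))" for n
    have T: "T \<longlonglongrightarrow> G \<xi>"
      unfolding T_def G_def
    proof (rule RS_integral_partition_limit[of "-r" \<xi> g W "\<lambda>\<theta>. \<psi> (\<xi> - \<theta>)" "\<lambda>n i. min \<xi> (t n i)" \<delta>])
      show "increments_dominated (-r) \<xi> g W"
        by (rule increments_dominated_subinterval[OF dom]) (use \<xi> in auto)
      show "continuous_on {-r..\<xi>} (\<lambda>\<theta>. \<psi> (\<xi> - \<theta>))"
        by (intro continuous_on_compose2[OF \<psi>] continuous_intros) (use \<xi> in auto)
      show "mono (\<lambda>i. min \<xi> (t n i))" for n
        using tmono[of n] by (auto simp: mono_def min_def intro: order_trans)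
      show "min \<xi> (t n (Suc i)) - min \<xi> (t n i) \<le> \<delta> n" for n i
        using tstep[of n i] \<delta>nn[of n] by (auto simp: min_def)
    qed (use \<xi> \<delta>0 t0 in auto)
    define E where "E n = W (min 0 (\<xi> + \<delta> n)) - W \<xi>" for n
    have Wc: "continuous (at \<xi> within {-r..0}) W" using \<xi> by (auto simp: N_def)
    have "(\<lambda>n. min 0 (\<xi> + \<delta> n)) \<longlonglongrightarrow> min 0 (\<xi> + 0)"
      by (intro tendsto_min tendsto_add tendsto_const \<delta>0)
    then have ml: "(\<lambda>n. min 0 (\<xi> + \<delta> n)) \<longlonglongrightarrow> \<xi>" using \<xi> by simp
    have mm: "min 0 (\<xi> + \<delta> n) \<in> {-r..0}" for n
      using \<xi>(1) \<delta>nn[of n] r by (simp add: min_def)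
    have "(\<lambda>n. W (min 0 (\<xi> + \<delta> n))) \<longlonglongrightarrow> W \<xi>"
      by (rule continuous_within_tendsto_compose'[OF Wc mm ml])
    then have E0: "E \<longlonglongrightarrow> 0" unfolding E_def by (rule LIM_zero)
    have "norm (F n \<xi> - T n * \<phi> \<xi>) \<le> M * M' * E n" for n
    proof -
      \<comment> \<open>Clipping to \<open>{\<xi>..\<xi> + \<delta> n}\<close> leaves only the interval around \<open>\<xi>\<close> with a nonzero increment of \<open>W\<close>, and the sum of these increments telescopes.\<close>
      define clip where "clip s = max \<xi> (min s (min 0 (\<xi> + \<delta> n)))" for s
      have "F n \<xi> - T n * \<phi> \<xi> = (\<Sum>i\<le>n. A n \<xi> i * (g (t n (Suc i)) - g (t n i))
          - \<psi> (\<xi> - min \<xi> (t n i)) * (g (min \<xi> (t n (Suc i))) - g (min \<xi> (t n i))) * \<phi> \<xi>)"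
        unfolding F_def T_def by (simp only: sum_distrib_right sum_subtractf)
      also have "norm \<dots> \<le> (\<Sum>i\<le>n. M * M' * (W (clip (t n (Suc i))) - W (clip (t n i))))"
      proof (rule sum_norm_le)
        fix i assume i: "i \<in> {..n}"
        have ti: "t n i \<in> {-r..0}" "t n (Suc i) \<in> {-r..0}" "t n i \<le> t n (Suc i)" "t n (Suc i) = t n i + \<delta> n"
          using tmem[of i n] tmem[of "Suc i" n] tstep[of n i] \<delta>nn[of n] i by auto
        show "norm (A n \<xi> i * (g (t n (Suc i)) - g (t n i))
          - \<psi> (\<xi> - min \<xi> (t n i)) * (g (min \<xi> (t n (Suc i))) - g (min \<xi> (t n i))) * \<phi> \<xi>) \<le> M * M' * (W (clip (t n (Suc i))) - W (clip (t n i)))"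
        proof (cases "t n i \<le> \<xi>")
          case False
          have "clip (t n i) \<le> clip (t n (Suc i))" "-r \<le> clip (t n i)" "clip (t n (Suc i)) \<le> 0"
            using ti \<xi> by (auto simp: clip_def)
          then have "W (clip (t n i)) \<le> W (clip (t n (Suc i)))" by (intro Wmono)
          then show ?thesis using False ti M0 M'0 by (simp add: A_def min_def)
        next
          case True
          have c1: "clip (t n i) = \<xi>" using True by (auto simp: clip_def)
          have A: "A n \<xi> i = \<psi> (\<xi> - t n i) * \<phi> \<xi>" using True \<xi> by (simp add: A_def)
          have b: "norm (\<psi> (\<xi> - t n i) * \<phi> \<xi>) \<le> M * M'"
            unfolding norm_mult using M M' M0 True ti \<xi> by (intro mult_mono) auto
          show ?thesis
          proof (cases "t n (Suc i) \<le> \<xi>")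
            case True2: True
            then have "clip (t n (Suc i)) = \<xi>" by (auto simp: clip_def)
            then show ?thesis using True True2 A c1 by (simp add: min_def algebra_simps)
          next
            case False
            then have c2: "clip (t n (Suc i)) = t n (Suc i)" using True ti by (auto simp: clip_def)
            have "A n \<xi> i * (g (t n (Suc i)) - g (t n i))
              - \<psi> (\<xi> - min \<xi> (t n i)) * (g (min \<xi> (t n (Suc i))) - g (min \<xi> (t n i))) * \<phi> \<xi>
              = \<psi> (\<xi> - t n i) * \<phi> \<xi> * (g (t n (Suc i)) - g \<xi>)"
              using True False A by (simp add: min_def algebra_simps)
            also have "norm \<dots> \<le> M * M' * (W (t n (Suc i)) - W \<xi>)"
              unfolding norm_mult[of "\<psi> (\<xi> - t n i) * \<phi> \<xi>"]
              using b increments_dominatedD[OF dom, of \<xi> "t n (Suc i)"] False \<xi> ti M0 M'0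
              by (intro mult_mono) auto
            finally show ?thesis using c1 c2 by simp
          qed
        qed
      qed
      also have "\<dots> = M * M' * (W (clip (t n (Suc n))) - W (clip (t n 0)))"
        unfolding sum_distrib_left[symmetric] sum_increments[of "\<lambda>i. W (clip (t n i))"] ..
      also have "clip (t n (Suc n)) = min 0 (\<xi> + \<delta> n)"
        using \<xi> \<delta>nn[of n] by (auto simp: clip_def t0 min_def)
      also have "clip (t n 0) = \<xi>" using \<xi> by (auto simp: clip_def t0)
      finally show ?thesis by (simp add: E_def)
    qed
    then have "(\<lambda>n. F n \<xi> - T n * \<phi> \<xi>) \<longlonglongrightarrow> 0"
      by (intro Lim_null_comparison[OF always_eventually tendsto_mult_right_zero[OF E0]]) blast
    from tendsto_add[OF this tendsto_mult_right[OF T, of "\<phi> \<xi>"]] show ?thesis by simp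
  qed
  have Ai: "((\<lambda>\<xi>. A n \<xi> i) has_integral correlation \<psi> \<phi> (t n i)) {-r..0}" if i: "i \<le> n" for n i
  proof -
    have sub: "{t n i..0} \<subseteq> {-r..0}" using tmem[of i n] i by auto
    have "continuous_on {t n i..0} (\<lambda>\<xi>. \<psi> (\<xi> - t n i) * \<phi> \<xi>)"
      using tmem[of i n] i sub
      by (intro continuous_intros continuous_on_compose2[OF \<psi>] continuous_on_subset[OF \<phi>]) auto
    then have "((\<lambda>\<xi>. \<psi> (\<xi> - t n i) * \<phi> \<xi>) has_integral correlation \<psi> \<phi> (t n i)) {t n i..0}"
      unfolding correlation_def by (intro integrable_integral integrable_continuous_real)
    then show ?thesis unfolding A_def has_integral_restrict[OF sub] .
  qed
  have Fi: "(F n has_integral (\<Sum>i\<le>n. correlation \<psi> \<phi> (t n i) * (g (t n (Suc i)) - g (t n i)))) {-r..0}" for n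
    unfolding F_def by (intro has_integral_sum has_integral_mult_left Ai) auto
  have Fb: "norm (F n \<xi>) \<le> M * M' * (W 0 - W (-r))" if \<xi>: "\<xi> \<in> {-r..0}" for n \<xi>
    unfolding F_def
  proof (rule partition_sum_norm_le[OF dom tmono t0])
    fix i assume i: "i \<le> n"
    show "norm (A n \<xi> i) \<le> M * M'"
    proof (cases "\<xi> \<in> {t n i..0}")
      case True
      then have "norm (\<psi> (\<xi> - t n i)) * norm (\<phi> \<xi>) \<le> M * M'"
        using M M' M0 \<xi> tmem[of i n] i by (intro mult_mono) auto
      then show ?thesis using True by (simp add: A_def norm_mult)
    next
      case False
      then have "A n \<xi> i = 0" by (simp only: A_def if_False)
      then show ?thesis using M0 M'0 by simp
    qed
  qed
  \<comment> \<open>Both the approximants and the limit are set to 0 on \<open>N\<close>, where convergence may fail.\<close>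
  define F' where "F' n \<xi> = (if \<xi> \<in> N then 0 else F n \<xi>)" for n \<xi>
  define G' where "G' \<xi> = (if \<xi> \<in> N then 0 else G \<xi> * \<phi> \<xi>)" for \<xi>
  have F'i: "(F' n has_integral (\<Sum>i\<le>n. correlation \<psi> \<phi> (t n i) * (g (t n (Suc i)) - g (t n i)))) {-r..0}" for n
    by (rule has_integral_spike[OF N _ Fi]) (simp add: F'_def)
  have dc: "G' integrable_on {-r..0}" "(\<lambda>n. integral {-r..0} (F' n)) \<longlonglongrightarrow> integral {-r..0} G'"
  proof -
    have 1: "F' n integrable_on {-r..0}" for n using F'i by (rule has_integral_integrable)
    have 2: "(\<lambda>_. M * M' * (W 0 - W (-r))) integrable_on {-r..0}" by (rule integrable_const_ivl)
    have 3: "norm (F' n \<xi>) \<le> M * M' * (W 0 - W (-r))" if "\<xi> \<in> {-r..0}" for n \<xi>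
      using Fb[OF that, of n] M0 M'0 Wmono[of "-r" 0] r by (auto simp: F'_def)
    have 4: "(\<lambda>n. F' n \<xi>) \<longlonglongrightarrow> G' \<xi>" if "\<xi> \<in> {-r..0}" for \<xi>
      using lim[OF that] by (auto simp: F'_def G'_def)
    show "G' integrable_on {-r..0}" "(\<lambda>n. integral {-r..0} (F' n)) \<longlonglongrightarrow> integral {-r..0} G'"
      using dominated_convergence[OF 1 2 3 4] by blast+
  qed
  have "(\<lambda>\<xi>. G \<xi> * \<phi> \<xi>) integrable_on {-r..0}"
    by (rule integrable_spike[OF dc(1) N]) (simp add: G'_def)
  then show "(\<lambda>\<xi>. RS_integral (-r) \<xi> (\<lambda>\<theta>. \<psi> (\<xi> - \<theta>)) g * \<phi> \<xi>) integrable_on {-r..0}"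
    by (simp add: G_def)
  have cc: "continuous_on {-r..0} (correlation \<psi> \<phi>)"
    by (rule correlation_continuous[of 2 2]) (use r \<psi> \<phi> in \<open>auto intro: Lp_on_continuous\<close>)
  have "(\<lambda>n. integral {-r..0} (F' n)) \<longlonglongrightarrow> RS_integral (-r) 0 (correlation \<psi> \<phi>) g"
    using RS_integral_uniform_limit[OF dom r' cc] by (simp add: integral_unique[OF F'i] t_def)
  then have "integral {-r..0} G' = RS_integral (-r) 0 (correlation \<psi> \<phi>) g"
    using dc(2) LIMSEQ_unique by blast
  moreover have "integral {-r..0} G' = integral {-r..0} (\<lambda>\<xi>. G \<xi> * \<phi> \<xi>)"
    by (rule integral_spike[OF N]) (simp add: G'_def)
  ultimately show "integral {-r..0} (\<lambda>\<xi>. RS_integral (-r) \<xi> (\<lambda>\<theta>. \<psi> (\<xi> - \<theta>)) g * \<phi> \<xi>)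
      = RS_integral (-r) 0 (correlation \<psi> \<phi>) g"
    by (simp add: G_def)
qed

section \<open>The extended bilinear form\<close>

lemma Lp_on_component:
  fixes f :: "real \<Rightarrow> complex^'n"
  assumes "Lp_on a b p f" "0 \<le> p"
  shows "Lp_on a b p (\<lambda>x. f x $ i)"
proof (rule Lp_on_norm_le[OF assms(1) _ assms(2)])
  have "(\<lambda>v::complex^'n. v $ i) \<in> borel_measurable borel"
    by (intro borel_measurable_continuous_onI continuous_intros)
  then show "(\<lambda>x. f x $ i) \<in> borel_measurable (lebesgue_on {a..b})"
    using assms(1) unfolding Lp_on_def by (auto intro: measurable_compose)
qed (rule Finite_Cartesian_Product.norm_nth_le)

lemma Lp_seminorm_component_le:
  fixes f :: "real \<Rightarrow> complex^'n"
  assumes f: "Lp_on a b p f" and p: "0 < p"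
  shows "Lp_seminorm a b p (\<lambda>x. f x $ i) \<le> Lp_seminorm a b p f"
  unfolding Lp_seminorm_def
proof (rule powr_mono2)
  show "integral {a..b} (\<lambda>x. norm (f x $ i) powr p) \<le> integral {a..b} (\<lambda>x. norm (f x) powr p)"
    using f Lp_on_component[OF f, of i] p unfolding Lp_on_def
    by (intro integral_le powr_mono2 Finite_Cartesian_Product.norm_nth_le) auto
  show "0 \<le> integral {a..b} (\<lambda>x. norm (f x $ i) powr p)"
    using Lp_on_component[OF f, of i] p unfolding Lp_on_def by (intro integral_nonneg) auto
qed (use p in auto)

lemma M_space_iff: "0 \<le> r \<Longrightarrow> f \<in> M_space r p \<longleftrightarrow> Lp_on (-r) 0 p f"
  unfolding M_space_def m_measure_def by (rule Lp_space_lebesgue_plus_dirac) auto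

lemma M_star_space_iff: "0 \<le> r \<Longrightarrow> f \<in> M_star_space r p \<longleftrightarrow> Lp_on 0 r p f"
  unfolding M_star_space_def m_star_measure_def by (rule Lp_space_lebesgue_plus_dirac) auto

lemma Lp_norm_m_measure:
  "0 \<le> r \<Longrightarrow> Lp_on (-r) 0 p f \<Longrightarrow> Lp_norm (m_measure r) p f = (integral {-r..0} (\<lambda>x. norm (f x) powr p) + norm (f 0) powr p) powr (1 / p)"
  unfolding m_measure_def by (rule Lp_space_lebesgue_plus_dirac(2)) auto

lemma Lp_norm_m_star_measure:
  "0 \<le> r \<Longrightarrow> Lp_on 0 r p f \<Longrightarrow> Lp_norm (m_star_measure r) p f = (integral {0..r} (\<lambda>x. norm (f x) powr p) + norm (f 0) powr p) powr (1 / p)"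
  unfolding m_star_measure_def by (rule Lp_space_lebesgue_plus_dirac(2)) auto

lemma Lp_norm_bounds:
  assumes f: "Lp_on a b p f" and p: "0 < p"
  shows "norm (f 0) \<le> (integral {a..b} (\<lambda>x. norm (f x) powr p) + norm (f 0) powr p) powr (1 / p)"
    and "Lp_seminorm a b p f \<le> (integral {a..b} (\<lambda>x. norm (f x) powr p) + norm (f 0) powr p) powr (1 / p)"
proof -
  have I: "0 \<le> integral {a..b} (\<lambda>x. norm (f x) powr p)"
    using f by (auto simp: Lp_on_def intro!: integral_nonneg)
  have "norm (f 0) = (norm (f 0) powr p) powr (1 / p)" using p by (simp add: powr_powr)
  also have "\<dots> \<le> (integral {a..b} (\<lambda>x. norm (f x) powr p) + norm (f 0) powr p) powr (1 / p)"
    using I p by (intro powr_mono2) auto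
  finally show "norm (f 0) \<le> (integral {a..b} (\<lambda>x. norm (f x) powr p) + norm (f 0) powr p) powr (1 / p)" .
  show "Lp_seminorm a b p f \<le> (integral {a..b} (\<lambda>x. norm (f x) powr p) + norm (f 0) powr p) powr (1 / p)"
    unfolding Lp_seminorm_def using I p by (intro powr_mono2) auto
qed

lemma Lp_norm_continuous_approx:
  fixes f :: "real \<Rightarrow> 'a::euclidean_space"
  assumes f: "Lp_on a b p f" and p: "0 < p" and e: "0 < e"
  obtains h where "continuous_on UNIV h" "Lp_on a b p h" "Lp_on a b p (\<lambda>x. f x - h x)"
    "(integral {a..b} (\<lambda>x. norm (f x - h x) powr p) + norm (f 0 - h 0) powr p) powr (1 / p) < e"
proof -
  obtain h where h: "continuous_on UNIV h" "h 0 = f 0" "integral {a..b} (\<lambda>x. norm (f x - h x) powr p) < e powr p"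
    using Lp_continuous_approx[OF f p, of "e powr p" 0] e by auto
  have hL: "Lp_on a b p h" by (intro Lp_on_continuous continuous_on_subset[OF h(1)]) (use p in auto)
  have dL: "Lp_on a b p (\<lambda>x. f x - h x)" using Lp_on_diff[OF f hL] p by simp
  have "(integral {a..b} (\<lambda>x. norm (f x - h x) powr p) + norm (f 0 - h 0) powr p) powr (1 / p) < (e powr p) powr (1 / p)"
    using h p dL by (intro powr_less_mono2) (auto simp: Lp_on_def intro!: integral_nonneg)
  then show thesis using that[OF h(1) hL dL] e p by (simp add: powr_powr)
qed

lemma eq_0_if_norm_le_mult_small:
  fixes v :: "'a::real_normed_vector"
  assumes K: "0 \<le> K" and small: "\<And>e. 0 < e \<Longrightarrow> \<exists>s. norm v \<le> K * s \<and> s < e"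
  shows "v = 0"
proof -
  have "norm v \<le> 0 + e" if e: "e > 0" for e
  proof -
    have "e / (K + 1) > 0" using e K by simp
    then obtain s where s: "norm v \<le> K * s" "s < e / (K + 1)" using small by blast
    have "K * s \<le> K * (e / (K + 1))" using s K by (intro mult_left_mono) auto
    also have "\<dots> \<le> e" using K e by (simp add: field_simps)
    finally show ?thesis using s by simp
  qed
  then have "norm v \<le> 0" by (rule field_le_epsilon)
  then show ?thesis by simp
qed

text \<open>The explicit formula for the extended bilinear form.\<close>

definition pairing ::
    "real \<Rightarrow> (real \<Rightarrow> complex^'n^'n) \<Rightarrow> (real \<Rightarrow> complex^'n) \<Rightarrow> (real \<Rightarrow> complex^'n) \<Rightarrow> complex" where
  "pairing r \<eta> \<psi> \<phi> = row_col_mult (\<psi> 0) (\<phi> 0) +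
     (\<Sum>i\<in>UNIV. \<Sum>j\<in>UNIV. RS_integral (-r) 0 (correlation (\<lambda>\<tau>. \<psi> \<tau> $ i) (\<lambda>\<xi>. \<phi> \<xi> $ j)) (\<lambda>\<theta>. \<eta> \<theta> $ i $ j))"

text \<open>Domination is required of the entries, not of the matrix norm, because in this form it passes to
  the transposed kernel at once.\<close>

locale stieltjes_kernel =
  fixes r :: real and \<eta> :: "real \<Rightarrow> complex^'n^'n" and W :: "real \<Rightarrow> real"
  assumes r_pos: "0 < r" and dominated_entry: "increments_dominated (-r) 0 (\<lambda>\<theta>. \<eta> \<theta> $ i $ j) W"
begin

lemma left_le: "-r \<le> 0" using r_pos by simp

lemma W_nonneg: "0 \<le> W 0 - W (-r)"
  using order_trans[OF norm_ge_zero increments_dominatedD[OF dominated_entry, of "-r" 0]] left_le by simp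

lemma B_form_eq_pairing:
  assumes \<psi>: "continuous_on {0..r} \<psi>" and \<phi>: "continuous_on {-r..0} \<phi>"
  shows "B_form r \<eta> \<psi> \<phi> = pairing r \<eta> \<psi> \<phi>"
proof -
  note S = RS_integral_correlation_swap[OF dominated_entry less_imp_le[OF r_pos]
      continuous_on_component[OF \<psi>] continuous_on_component[OF \<phi>]]
  have "integral {-r..0} (\<lambda>\<xi>. row_col_mult (RS_integral_row (-r) \<xi> (\<lambda>\<theta>. \<psi> (\<xi> - \<theta>)) \<eta>) (\<phi> \<xi>))
    = integral {-r..0} (\<lambda>\<xi>. \<Sum>j\<in>UNIV. \<Sum>i\<in>UNIV. RS_integral (-r) \<xi> (\<lambda>\<theta>. \<psi> (\<xi> - \<theta>) $ i) (\<lambda>\<theta>. \<eta> \<theta> $ i $ j) * \<phi> \<xi> $ j)"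
    by (simp add: row_col_mult_def RS_integral_row_def sum_distrib_right)
  also have "\<dots> = (\<Sum>j\<in>UNIV. \<Sum>i\<in>UNIV. RS_integral (-r) 0 (correlation (\<lambda>\<tau>. \<psi> \<tau> $ i) (\<lambda>\<xi>. \<phi> \<xi> $ j)) (\<lambda>\<theta>. \<eta> \<theta> $ i $ j))"
    using S by (simp add: integral_sum integrable_sum)
  also have "\<dots> = (\<Sum>i\<in>UNIV. \<Sum>j\<in>UNIV. RS_integral (-r) 0 (correlation (\<lambda>\<tau>. \<psi> \<tau> $ i) (\<lambda>\<xi>. \<phi> \<xi> $ j)) (\<lambda>\<theta>. \<eta> \<theta> $ i $ j))"
    by (rule sum.swap)
  finally show ?thesis by (simp add: B_form_def pairing_def)
qed

end

locale delay_pairing = stieltjes_kernel r \<eta> W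
  for r :: real and \<eta> :: "real \<Rightarrow> complex^'n^'n" and W :: "real \<Rightarrow> real" +
  fixes p q :: real
  assumes p_gt_1: "1 < p" and conj_exp: "1 / p + 1 / q = 1"
begin

lemma q_gt_1: "1 < q"
proof -
  have "1 / q = 1 - 1 / p" using conj_exp by simp
  moreover have "0 < 1 / p" "1 / p < 1" using p_gt_1 by auto
  ultimately have *: "0 < 1 / q" "1 / q < 1" by auto
  then have "0 < q" by simp
  with * show ?thesis by (simp add: field_simps)
qed

lemmas space_iffs = M_space_iff[OF less_imp_le[OF r_pos]] M_star_space_iff[OF less_imp_le[OF r_pos]]

lemmas exponents = p_gt_1 q_gt_1 conj_exp

lemma correlation_entry_continuous:
  assumes \<psi>: "Lp_on 0 r q \<psi>" and \<phi>: "Lp_on (-r) 0 p \<phi>"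
  shows "continuous_on {-r..0} (correlation (\<lambda>\<tau>. \<psi> \<tau> $ i) (\<lambda>\<xi>. \<phi> \<xi> $ j))"
  by (rule correlation_continuous[OF exponents]) (use exponents r_pos in \<open>auto intro!: Lp_on_component \<psi> \<phi>\<close>)

lemma RS_integral_correlation_add_left:
  assumes "Lp_on 0 r q \<psi>" "Lp_on 0 r q \<psi>'" "Lp_on (-r) 0 p \<phi>"
  shows "RS_integral (-r) 0 (correlation (\<lambda>\<tau>. \<psi> \<tau> $ i + \<psi>' \<tau> $ i) (\<lambda>\<xi>. \<phi> \<xi> $ j)) (\<lambda>\<theta>. \<eta> \<theta> $ i $ j)
    = RS_integral (-r) 0 (correlation (\<lambda>\<tau>. \<psi> \<tau> $ i) (\<lambda>\<xi>. \<phi> \<xi> $ j)) (\<lambda>\<theta>. \<eta> \<theta> $ i $ j)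
    + RS_integral (-r) 0 (correlation (\<lambda>\<tau>. \<psi>' \<tau> $ i) (\<lambda>\<xi>. \<phi> \<xi> $ j)) (\<lambda>\<theta>. \<eta> \<theta> $ i $ j)"
  unfolding RS_integral_add[OF dominated_entry left_le correlation_entry_continuous[OF assms(1,3)] correlation_entry_continuous[OF assms(2,3)], symmetric]
  by (rule RS_integral_cong, rule correlation_add_left[OF exponents]) (use exponents assms in \<open>auto intro!: Lp_on_component\<close>)

lemma RS_integral_correlation_add_right:
  assumes "Lp_on 0 r q \<psi>" "Lp_on (-r) 0 p \<phi>" "Lp_on (-r) 0 p \<phi>'"
  shows "RS_integral (-r) 0 (correlation (\<lambda>\<tau>. \<psi> \<tau> $ i) (\<lambda>\<xi>. \<phi> \<xi> $ j + \<phi>' \<xi> $ j)) (\<lambda>\<theta>. \<eta> \<theta> $ i $ j)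
    = RS_integral (-r) 0 (correlation (\<lambda>\<tau>. \<psi> \<tau> $ i) (\<lambda>\<xi>. \<phi> \<xi> $ j)) (\<lambda>\<theta>. \<eta> \<theta> $ i $ j)
    + RS_integral (-r) 0 (correlation (\<lambda>\<tau>. \<psi> \<tau> $ i) (\<lambda>\<xi>. \<phi>' \<xi> $ j)) (\<lambda>\<theta>. \<eta> \<theta> $ i $ j)"
  unfolding RS_integral_add[OF dominated_entry left_le correlation_entry_continuous[OF assms(1,2)] correlation_entry_continuous[OF assms(1,3)], symmetric]
  by (rule RS_integral_cong, rule correlation_add_right[OF exponents]) (use exponents assms in \<open>auto intro!: Lp_on_component\<close>)

lemma norm_pairing_le:
  assumes \<psi>: "Lp_on 0 r q \<psi>" and \<phi>: "Lp_on (-r) 0 p \<phi>"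
  shows "norm (pairing r \<eta> \<psi> \<phi>) \<le> (real CARD('n) + real CARD('n) * real CARD('n) * (W 0 - W (-r)))
     * Lp_norm (m_star_measure r) q \<psi> * Lp_norm (m_measure r) p \<phi>"
proof -
  define a where "a = Lp_norm (m_star_measure r) q \<psi>"
  define b where "b = Lp_norm (m_measure r) p \<phi>"
  have a: "norm (\<psi> 0) \<le> a" "Lp_seminorm 0 r q \<psi> \<le> a"
    unfolding a_def Lp_norm_m_star_measure[OF less_imp_le[OF r_pos] \<psi>]
    using Lp_norm_bounds[OF \<psi>] exponents by auto
  have b: "norm (\<phi> 0) \<le> b" "Lp_seminorm (-r) 0 p \<phi> \<le> b"
    unfolding b_def Lp_norm_m_measure[OF less_imp_le[OF r_pos] \<phi>]
    using Lp_norm_bounds[OF \<phi>] exponents by auto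
  have ab: "0 \<le> a" "0 \<le> b" unfolding a_def b_def Lp_norm_def by simp_all
  have 1: "norm (row_col_mult (\<psi> 0) (\<phi> 0)) \<le> real CARD('n) * (a * b)"
  proof -
    have "norm (row_col_mult (\<psi> 0) (\<phi> 0)) \<le> (\<Sum>i\<in>(UNIV::'n set). a * b)"
      unfolding row_col_mult_def
    proof (rule sum_norm_le)
      fix i
      show "norm (\<psi> 0 $ i * \<phi> 0 $ i) \<le> a * b"
        unfolding norm_mult using ab a(1) b(1) Finite_Cartesian_Product.norm_nth_le[of "\<psi> 0" i] Finite_Cartesian_Product.norm_nth_le[of "\<phi> 0" i]
        by (intro mult_mono) auto
    qed
    then show ?thesis by simp
  qed
  have 2: "norm (RS_integral (-r) 0 (correlation (\<lambda>\<tau>. \<psi> \<tau> $ i) (\<lambda>\<xi>. \<phi> \<xi> $ j)) (\<lambda>\<theta>. \<eta> \<theta> $ i $ j)) \<le> a * b * (W 0 - W (-r))" for i j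
  proof (rule RS_integral_norm_le[OF dominated_entry left_le correlation_entry_continuous[OF \<psi> \<phi>]])
    fix \<theta> assume \<theta>: "\<theta> \<in> {-r..0}"
    have "norm (correlation (\<lambda>\<tau>. \<psi> \<tau> $ i) (\<lambda>\<xi>. \<phi> \<xi> $ j) \<theta>) \<le> Lp_seminorm 0 r q (\<lambda>\<tau>. \<psi> \<tau> $ i) * Lp_seminorm (-r) 0 p (\<lambda>\<xi>. \<phi> \<xi> $ j)"
      by (rule correlation_integrable(2)[OF exponents _ _ \<theta>]) (use exponents in \<open>auto intro!: Lp_on_component \<psi> \<phi>\<close>)
    also have "\<dots> \<le> a * b"
      using Lp_seminorm_component_le[OF \<psi>, of i] Lp_seminorm_component_le[OF \<phi>, of j] a(2) b(2) ab exponents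
      by (intro mult_mono) (auto simp: Lp_seminorm_def)
    finally show "norm (correlation (\<lambda>\<tau>. \<psi> \<tau> $ i) (\<lambda>\<xi>. \<phi> \<xi> $ j) \<theta>) \<le> a * b" .
  qed
  have "norm (\<Sum>i\<in>(UNIV::'n set). \<Sum>j\<in>(UNIV::'n set). RS_integral (-r) 0 (correlation (\<lambda>\<tau>. \<psi> \<tau> $ i) (\<lambda>\<xi>. \<phi> \<xi> $ j)) (\<lambda>\<theta>. \<eta> \<theta> $ i $ j))
    \<le> (\<Sum>i\<in>(UNIV::'n set). \<Sum>j\<in>(UNIV::'n set). a * b * (W 0 - W (-r)))"
    by (intro sum_norm_le 2)
  also have "\<dots> = real CARD('n) * real CARD('n) * (W 0 - W (-r)) * (a * b)" by simp
  finally have "norm (pairing r \<eta> \<psi> \<phi>) \<le> real CARD('n) * (a * b) + real CARD('n) * real CARD('n) * (W 0 - W (-r)) * (a * b)"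
    unfolding pairing_def using 1 by (intro order_trans[OF norm_triangle_ineq] add_mono)
  then show ?thesis by (simp add: a_def b_def algebra_simps)
qed

lemma pairing_is_extension: "bounded_bilinear_extension r \<eta> p q (pairing r \<eta>)"
  unfolding bounded_bilinear_extension_def Ball_def space_iffs
proof (intro conjI allI impI)
  fix \<psi>\<^sub>1 \<psi>\<^sub>2 :: "real \<Rightarrow> complex^'n" and \<phi> :: "real \<Rightarrow> complex^'n"
  assume h: "Lp_on 0 r q \<psi>\<^sub>1" "Lp_on 0 r q \<psi>\<^sub>2" "Lp_on (-r) 0 p \<phi>"
  show "pairing r \<eta> (\<lambda>\<tau>. \<psi>\<^sub>1 \<tau> + \<psi>\<^sub>2 \<tau>) \<phi> = pairing r \<eta> \<psi>\<^sub>1 \<phi> + pairing r \<eta> \<psi>\<^sub>2 \<phi>"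
    using RS_integral_correlation_add_left[OF h]
    by (simp add: pairing_def row_col_mult_def distrib_right sum.distrib)
next
  fix \<psi> \<phi>\<^sub>1 \<phi>\<^sub>2 :: "real \<Rightarrow> complex^'n"
  assume h: "Lp_on 0 r q \<psi>" "Lp_on (-r) 0 p \<phi>\<^sub>1" "Lp_on (-r) 0 p \<phi>\<^sub>2"
  show "pairing r \<eta> \<psi> (\<lambda>\<theta>. \<phi>\<^sub>1 \<theta> + \<phi>\<^sub>2 \<theta>) = pairing r \<eta> \<psi> \<phi>\<^sub>1 + pairing r \<eta> \<psi> \<phi>\<^sub>2"
    using RS_integral_correlation_add_right[OF h]
    by (simp add: pairing_def row_col_mult_def distrib_left sum.distrib)
next
  fix c :: complex and \<psi> \<phi> :: "real \<Rightarrow> complex^'n"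
  assume h: "Lp_on 0 r q \<psi>" "Lp_on (-r) 0 p \<phi>"
  note RS = RS_integral_cmult[OF dominated_entry left_le correlation_entry_continuous[OF h]]
  show "pairing r \<eta> (\<lambda>\<tau>. c *s \<psi> \<tau>) \<phi> = c * pairing r \<eta> \<psi> \<phi>"
    by (simp add: pairing_def row_col_mult_def correlation_cmult[abs_def] RS distrib_left sum_distrib_left mult.assoc)
  show "pairing r \<eta> \<psi> (\<lambda>\<theta>. c *s \<phi> \<theta>) = c * pairing r \<eta> \<psi> \<phi>"
    by (simp add: pairing_def row_col_mult_def correlation_cmult[abs_def] RS distrib_left sum_distrib_left mult.left_commute)
next
  show "\<exists>K. \<forall>\<psi>. Lp_on 0 r q \<psi> \<longrightarrow> (\<forall>\<phi>. Lp_on (-r) 0 p \<phi> \<longrightarrow>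
      norm (pairing r \<eta> \<psi> \<phi>) \<le> K * Lp_norm (m_star_measure r) q \<psi> * Lp_norm (m_measure r) p \<phi>)"
    using norm_pairing_le by blast
next
  fix \<psi> \<phi> :: "real \<Rightarrow> complex^'n"
  assume "continuous_on {0..r} \<psi> \<and> continuous_on {-r..0} \<phi>"
  then show "pairing r \<eta> \<psi> \<phi> = B_form r \<eta> \<psi> \<phi>" using B_form_eq_pairing by simp
qed

lemma extension_add_left:
  assumes "bounded_bilinear_extension r \<eta> p q \<beta>" "Lp_on 0 r q \<psi>\<^sub>1" "Lp_on 0 r q \<psi>\<^sub>2" "Lp_on (-r) 0 p \<phi>"
  shows "\<beta> (\<lambda>\<tau>. \<psi>\<^sub>1 \<tau> + \<psi>\<^sub>2 \<tau>) \<phi> = \<beta> \<psi>\<^sub>1 \<phi> + \<beta> \<psi>\<^sub>2 \<phi>"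
  using assms unfolding bounded_bilinear_extension_def space_iffs[symmetric] by blast

lemma extension_add_right:
  assumes "bounded_bilinear_extension r \<eta> p q \<beta>" "Lp_on 0 r q \<psi>" "Lp_on (-r) 0 p \<phi>\<^sub>1" "Lp_on (-r) 0 p \<phi>\<^sub>2"
  shows "\<beta> \<psi> (\<lambda>\<tau>. \<phi>\<^sub>1 \<tau> + \<phi>\<^sub>2 \<tau>) = \<beta> \<psi> \<phi>\<^sub>1 + \<beta> \<psi> \<phi>\<^sub>2"
  using assms unfolding bounded_bilinear_extension_def space_iffs[symmetric] by blast

lemma extension_bound:
  assumes "bounded_bilinear_extension r \<eta> p q \<beta>"
  obtains K where "\<And>\<psi> \<phi>. Lp_on 0 r q \<psi> \<Longrightarrow> Lp_on (-r) 0 p \<phi> \<Longrightarrow>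
      norm (\<beta> \<psi> \<phi>) \<le> K * Lp_norm (m_star_measure r) q \<psi> * Lp_norm (m_measure r) p \<phi>"
  using assms unfolding bounded_bilinear_extension_def space_iffs[symmetric] by blast

lemma extension_continuous:
  assumes "bounded_bilinear_extension r \<eta> p q \<beta>" "continuous_on {0..r} \<psi>" "continuous_on {-r..0} \<phi>"
  shows "\<beta> \<psi> \<phi> = pairing r \<eta> \<psi> \<phi>"
  using assms B_form_eq_pairing[of \<psi> \<phi>] unfolding bounded_bilinear_extension_def by simp

text \<open>The difference of two extensions is bounded and biadditive and vanishes on pairs of continuous
  functions.  Density is used in one argument at a time, so that only boundedness and
  additivity in that argument enter.\<close>

lemma extension_unique:
  assumes \<beta>: "bounded_bilinear_extension r \<eta> p q \<beta>"
    and \<psi>: "Lp_on 0 r q \<psi>" and \<phi>: "Lp_on (-r) 0 p \<phi>"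
  shows "\<beta> \<psi> \<phi> = pairing r \<eta> \<psi> \<phi>"
proof -
  define D where "D \<psi> \<phi> = \<beta> \<psi> \<phi> - pairing r \<eta> \<psi> \<phi>" for \<psi> \<phi>
  have add_left: "D (\<lambda>\<tau>. \<psi>\<^sub>1 \<tau> + \<psi>\<^sub>2 \<tau>) \<phi> = D \<psi>\<^sub>1 \<phi> + D \<psi>\<^sub>2 \<phi>"
    if "Lp_on 0 r q \<psi>\<^sub>1" "Lp_on 0 r q \<psi>\<^sub>2" "Lp_on (-r) 0 p \<phi>" for \<psi>\<^sub>1 \<psi>\<^sub>2 \<phi>
    unfolding D_def extension_add_left[OF \<beta> that] extension_add_left[OF pairing_is_extension that] by simp
  have add_right: "D \<psi> (\<lambda>\<tau>. \<phi>\<^sub>1 \<tau> + \<phi>\<^sub>2 \<tau>) = D \<psi> \<phi>\<^sub>1 + D \<psi> \<phi>\<^sub>2"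
    if "Lp_on 0 r q \<psi>" "Lp_on (-r) 0 p \<phi>\<^sub>1" "Lp_on (-r) 0 p \<phi>\<^sub>2" for \<psi> \<phi>\<^sub>1 \<phi>\<^sub>2
    unfolding D_def extension_add_right[OF \<beta> that] extension_add_right[OF pairing_is_extension that] by simp
  have zero: "D \<psi> \<phi> = 0" if "continuous_on UNIV \<psi>" "continuous_on UNIV \<phi>" for \<psi> \<phi>
    using extension_continuous[OF \<beta>] continuous_on_subset[OF that(1), of "{0..r}"] continuous_on_subset[OF that(2), of "{-r..0}"]
    unfolding D_def by simp
  obtain K1 where K1: "\<And>\<psi> \<phi>. Lp_on 0 r q \<psi> \<Longrightarrow> Lp_on (-r) 0 p \<phi> \<Longrightarrow> 
      norm (\<beta> \<psi> \<phi>) \<le> K1 * Lp_norm (m_star_measure r) q \<psi> * Lp_norm (m_measure r) p \<phi>"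
    using extension_bound[OF \<beta>] by blast
  obtain K2 where K2: "\<And>\<psi> \<phi>. Lp_on 0 r q \<psi> \<Longrightarrow> Lp_on (-r) 0 p \<phi> \<Longrightarrow> 
      norm (pairing r \<eta> \<psi> \<phi>) \<le> K2 * Lp_norm (m_star_measure r) q \<psi> * Lp_norm (m_measure r) p \<phi>"
    using extension_bound[OF pairing_is_extension] by blast
  \<comment> \<open>The absolute value ensures \<open>K \<ge> 0\<close>, which the boundedness assumption does not provide.\<close>
  define K where "K = \<bar>K1 + K2\<bar>"
  have bound: "norm (D \<psi> \<phi>) \<le> K * Lp_norm (m_star_measure r) q \<psi> * Lp_norm (m_measure r) p \<phi>"
    if "Lp_on 0 r q \<psi>" "Lp_on (-r) 0 p \<phi>" for \<psi> \<phi>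
  proof -
    have "norm (D \<psi> \<phi>) \<le> (K1 + K2) * (Lp_norm (m_star_measure r) q \<psi> * Lp_norm (m_measure r) p \<phi>)"
      using norm_triangle_ineq4[of "\<beta> \<psi> \<phi>" "pairing r \<eta> \<psi> \<phi>"] K1[OF that] K2[OF that]
      by (simp add: D_def algebra_simps)
    also have "\<dots> \<le> K * (Lp_norm (m_star_measure r) q \<psi> * Lp_norm (m_measure r) p \<phi>)"
      unfolding K_def by (intro mult_right_mono) (auto simp: Lp_norm_def)
    finally show ?thesis by (simp add: mult.assoc)
  qed
  have K: "0 \<le> K" by (simp add: K_def)
  have step1: "D \<psi> \<phi> = 0" if \<psi>: "Lp_on 0 r q \<psi>" and \<phi>c: "continuous_on UNIV \<phi>" and \<phi>: "Lp_on (-r) 0 p \<phi>" for \<psi> \<phi>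
  proof (rule eq_0_if_norm_le_mult_small[of "K * Lp_norm (m_measure r) p \<phi>"])
    show "0 \<le> K * Lp_norm (m_measure r) p \<phi>" using K by (simp add: Lp_norm_def)
    fix e :: real assume "0 < e"
    then obtain h where h: "continuous_on UNIV h" "Lp_on 0 r q h" "Lp_on 0 r q (\<lambda>x. \<psi> x - h x)"
      "(integral {0..r} (\<lambda>x. norm (\<psi> x - h x) powr q) + norm (\<psi> 0 - h 0) powr q) powr (1 / q) < e"
      by (rule Lp_norm_continuous_approx[OF \<psi> less_trans[OF zero_less_one q_gt_1]])
    then have small: "Lp_norm (m_star_measure r) q (\<lambda>x. \<psi> x - h x) < e"
      unfolding Lp_norm_m_star_measure[OF less_imp_le[OF r_pos] h(3)] by (intro h(4))
    have "D \<psi> \<phi> = D (\<lambda>x. \<psi> x - h x) \<phi>"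
      using add_left[OF h(2,3) \<phi>] zero[OF h(1) \<phi>c] by simp
    then show "\<exists>s. norm (D \<psi> \<phi>) \<le> K * Lp_norm (m_measure r) p \<phi> * s \<and> s < e"
      using bound[OF h(3) \<phi>] small by (intro exI[of _ "Lp_norm (m_star_measure r) q (\<lambda>x. \<psi> x - h x)"]) (simp add: mult_ac)
  qed
  have "D \<psi> \<phi> = 0"
  proof (rule eq_0_if_norm_le_mult_small[of "K * Lp_norm (m_star_measure r) q \<psi>"])
    show "0 \<le> K * Lp_norm (m_star_measure r) q \<psi>" using K by (simp add: Lp_norm_def)
    fix e :: real assume "0 < e"
    then obtain h where h: "continuous_on UNIV h" "Lp_on (-r) 0 p h" "Lp_on (-r) 0 p (\<lambda>x. \<phi> x - h x)"
      "(integral {-r..0} (\<lambda>x. norm (\<phi> x - h x) powr p) + norm (\<phi> 0 - h 0) powr p) powr (1 / p) < e"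
      by (rule Lp_norm_continuous_approx[OF \<phi> less_trans[OF zero_less_one p_gt_1]])
    then have small: "Lp_norm (m_measure r) p (\<lambda>x. \<phi> x - h x) < e"
      unfolding Lp_norm_m_measure[OF less_imp_le[OF r_pos] h(3)] by (intro h(4))
    have "D \<psi> \<phi> = D \<psi> (\<lambda>x. \<phi> x - h x)"
      using add_right[OF \<psi> h(2,3)] step1[OF \<psi> h(1,2)] by simp
    then show "\<exists>s. norm (D \<psi> \<phi>) \<le> K * Lp_norm (m_star_measure r) q \<psi> * s \<and> s < e"
      using bound[OF \<psi> h(3)] small by (intro exI[of _ "Lp_norm (m_measure r) p (\<lambda>x. \<phi> x - h x)"]) simp
  qed
  then show ?thesis by (simp add: D_def)
qed

lemma B_tilde_eq_pairing:
  assumes "Lp_on 0 r q \<psi>" "Lp_on (-r) 0 p \<phi>"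
  shows "B_tilde r \<eta> p q \<psi> \<phi> = pairing r \<eta> \<psi> \<phi>"
  unfolding B_tilde_def
  by (rule extension_unique[OF someI[of "bounded_bilinear_extension r \<eta> p q"] assms]) (rule pairing_is_extension)

end

section \<open>Existence of mild solutions\<close>

lemma continuous_on_atLeastI:
  fixes f :: "real \<Rightarrow> 'a::metric_space"
  assumes "\<And>b. continuous_on {a..b} f"
  shows "continuous_on {a..} f"
  unfolding continuous_on_iff
proof (intro ballI allI impI)
  fix s e :: real assume s: "s \<in> {a..}" and e: "e > 0"
  have "continuous_on {a..s+1} f" by (rule assms)
  moreover have "s \<in> {a..s+1}" using s by simp
  ultimately obtain d where d: "d > 0" "\<And>x. x \<in> {a..s+1} \<Longrightarrow> dist x s < d \<Longrightarrow> dist (f x) (f s) < e"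
    using e unfolding continuous_on_iff by meson
  show "\<exists>d>0. \<forall>x\<in>{a..}. dist x s < d \<longrightarrow> dist (f x) (f s) < e"
  proof (intro exI conjI ballI impI)
    show "0 < min d 1" using d(1) by simp
    fix x assume "x \<in> {a..}" "dist x s < min d 1"
    then show "dist (f x) (f s) < e" by (intro d(2)) (auto simp: dist_real_def)
  qed
qed

lemma continuous_on_indefinite_integral_atLeast:
  fixes f :: "real \<Rightarrow> 'a::banach"
  assumes "\<And>b. f integrable_on {a..b}"
  shows "continuous_on {a..} (\<lambda>u. integral {a..u} f)"
  by (intro continuous_on_atLeastI indefinite_integral_continuous_1 assms)

lemma has_integral_exp_scaled:
  fixes l u :: real
  assumes "0 < l" "0 \<le> u"
  shows "((\<lambda>s. exp (l * s)) has_integral (exp (l * u) - 1) / l) {0..u}"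
proof -
  have "((\<lambda>s. exp (l * s)) has_integral (exp (l * u) / l - exp (l * 0) / l)) {0..u}"
    using assms by (intro fundamental_theorem_of_calculus)
      (auto intro!: derivative_eq_intros simp: has_real_derivative_iff_has_vector_derivative[symmetric])
  then show ?thesis by (simp add: diff_divide_distrib)
qed

context stieltjes_kernel
begin

lemma L_op_component: "L_op r \<eta> f $ i = (\<Sum>j\<in>UNIV. RS_integral (-r) 0 (\<lambda>\<theta>. f \<theta> $ j) (\<lambda>\<theta>. \<eta> \<theta> $ i $ j))"
  by (simp add: L_op_def RS_integral_col_def)

definition L_bound :: real where
  "L_bound = real CARD('n) * real CARD('n) * (W 0 - W (-r))"

lemma L_bound_nonneg: "0 \<le> L_bound"
  unfolding L_bound_def using W_nonneg by simp

lemma norm_L_op_le: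
  assumes f: "continuous_on {-r..0} f" and M: "\<And>\<theta>. \<theta> \<in> {-r..0} \<Longrightarrow> norm (f \<theta>) \<le> M"
  shows "norm (L_op r \<eta> f) \<le> L_bound * M"
proof -
  have "norm (L_op r \<eta> f) \<le> (\<Sum>i\<in>(UNIV::'n set). norm (L_op r \<eta> f $ i))"
    unfolding norm_vec_def by (rule L2_set_le_sum) simp
  also have "\<dots> \<le> (\<Sum>i\<in>(UNIV::'n set). \<Sum>j\<in>(UNIV::'n set). M * (W 0 - W (-r)))"
    unfolding L_op_component
  proof (intro sum_mono sum_norm_le)
    fix i j
    show "norm (RS_integral (-r) 0 (\<lambda>\<theta>. f \<theta> $ j) (\<lambda>\<theta>. \<eta> \<theta> $ i $ j)) \<le> M * (W 0 - W (-r))"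
      by (rule RS_integral_norm_le[OF dominated_entry left_le continuous_on_component[OF f]])
         (rule order_trans[OF Finite_Cartesian_Product.norm_nth_le M])
  qed
  also have "\<dots> = L_bound * M" by (simp add: L_bound_def)
  finally show ?thesis .
qed

lemma L_op_diff:
  assumes "continuous_on {-r..0} f" "continuous_on {-r..0} h"
  shows "L_op r \<eta> (\<lambda>\<theta>. f \<theta> - h \<theta>) = L_op r \<eta> f - L_op r \<eta> h"
  using RS_integral_diff[OF dominated_entry left_le continuous_on_component[OF assms(1)] continuous_on_component[OF assms(2)]]
  by (simp add: vec_eq_iff L_op_component sum_subtractf)

lemma L_op_zero: "L_op r \<eta> (\<lambda>\<theta>. 0) = 0"
  using L_op_diff[of "\<lambda>_. 0" "\<lambda>_. 0"] by simp

lemma L_op_cong: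
  assumes "\<And>\<theta>. \<theta> \<in> {-r..0} \<Longrightarrow> f \<theta> = h \<theta>"
  shows "L_op r \<eta> f = L_op r \<eta> h"
  unfolding vec_eq_iff L_op_component using assms by (intro allI sum.cong RS_integral_cong) auto

lemma continuous_on_L_op_increment:
  assumes X: "continuous_on {-r..} X"
  shows "continuous_on {0..} (\<lambda>t. L_op r \<eta> (\<lambda>\<theta>. X (t + \<theta>) - X \<theta>))"
proof (rule continuous_on_atLeastI)
  fix b
  have "continuous_on ({0..b} \<times> {-r..0}) (\<lambda>(t, \<theta>). (X (t + \<theta>) - X \<theta>) $ j)" for j
    unfolding case_prod_unfold
    by (intro continuous_on_component continuous_on_diff continuous_on_compose2[OF X] continuous_intros) auto
  then have "continuous_on {0..b} (\<lambda>t. L_op r \<eta> (\<lambda>\<theta>. X (t + \<theta>) - X \<theta>) $ i)" for i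
    unfolding L_op_component
    by (intro continuous_on_sum continuous_on_RS_integral_param[OF dominated_entry left_le]) 
  then show "continuous_on {0..b} (\<lambda>t. L_op r \<eta> (\<lambda>\<theta>. X (t + \<theta>) - X \<theta>))"
    using continuous_on_vec_lambda[of "{0..b}" "\<lambda>i t. L_op r \<eta> (\<lambda>\<theta>. X (t + \<theta>) - X \<theta>) $ i"] by simp
qed

text \<open>With \<open>X\<close> the primitive of \<open>x\<close>, the equation reads
  \<open>x t = \<phi> 0 + L (\<lambda>\<theta>. X (t + \<theta>) - X \<theta>)\<close>, where \<open>X\<close> is prescribed on \<open>{-r..0}\<close>.  Substituting
  \<open>x t = exp (l t) z t\<close> gives a fixed point equation for a bounded continuous function \<open>z\<close>: the
  integral of \<open>exp (l s)\<close> over \<open>{0..t}\<close> is at most \<open>exp (l t) / l\<close>, so for large \<open>l\<close> the right-hand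
  side is a contraction on the whole half-line.\<close>

lemma mild_solution_exists:
  assumes \<phi>: "\<phi> absolutely_integrable_on {-r..0}"
  shows "\<exists>x. is_mild_solution r \<eta> \<phi> x"
proof -
  define \<Phi> where "\<Phi> u = integral {-r..u} \<phi>" for u
  have \<phi>i: "\<phi> integrable_on {-r..0}" using \<phi> by (simp add: absolutely_integrable_on_def)
  have \<Phi>c: "continuous_on {-r..0} \<Phi>" unfolding \<Phi>_def by (rule indefinite_integral_continuous_1[OF \<phi>i])
  have "bounded (\<Phi> ` {-r..0})" by (intro compact_imp_bounded compact_continuous_image \<Phi>c compact_Icc)
  then obtain B where B: "\<And>u. u \<in> {-r..0} \<Longrightarrow> norm (\<Phi> u) \<le> B" unfolding bounded_iff by blast
  \<comment> \<open>This weight gives the contraction constant \<open>1/2\<close>; the summand 1 keeps \<open>l\<close> positive.\<close>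
  define l where "l = 2 * L_bound + 1"
  have l: "0 < l" "L_bound / l \<le> 1 / 2" using L_bound_nonneg by (auto simp: l_def field_simps)
  \<comment> \<open>\<open>X z\<close> is the primitive of the function that is \<open>\<phi>\<close> on \<open>{-r..0}\<close> and \<open>exp (l * s) *\<^sub>R z s\<close> for \<open>s \<ge> 0\<close>; it is extended by a constant to the left of \<open>-r\<close>.\<close>
  define J where "J z u = integral {0..u} (\<lambda>s. exp (l * s) *\<^sub>R z s)" for z :: "real \<Rightarrow> complex^'n" and u
  define X where "X z u = \<Phi> (max (-r) (min 0 u)) + J z (max 0 u)" for z u
  define T where "T z t = exp (- l * max 0 t) *\<^sub>R (\<phi> 0 + L_op r \<eta> (\<lambda>\<theta>. X z (max 0 t + \<theta>) - X z \<theta>))" for z t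
  have Zi: "(\<lambda>s. exp (l * s) *\<^sub>R z s) integrable_on {a..b}" if "continuous_on UNIV z" for z :: "real \<Rightarrow> complex^'n" and a b
    by (intro integrable_continuous_real continuous_intros continuous_on_subset[OF that]) auto
  have Jc: "continuous_on {0..} (J z)" if "continuous_on UNIV z" for z
    unfolding J_def by (rule continuous_on_indefinite_integral_atLeast[OF Zi[OF that]])
  have Xc: "continuous_on UNIV (X z)" if "continuous_on UNIV z" for z
    unfolding X_def using r_pos
    by (intro continuous_on_add continuous_on_compose2[OF \<Phi>c] continuous_on_compose2[OF Jc[OF that]] continuous_intros) auto
  have incr_c: "continuous_on {-r..0} (\<lambda>\<theta>. X z (t + \<theta>) - X z \<theta>)" if "continuous_on UNIV z" for z t
    by (intro continuous_intros continuous_on_compose2[OF Xc[OF that]]) auto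
  have Tc: "continuous_on UNIV (T z)" if "continuous_on UNIV z" for z
  proof -
    have "continuous_on {0..} (\<lambda>t. L_op r \<eta> (\<lambda>\<theta>. X z (t + \<theta>) - X z \<theta>))"
      by (rule continuous_on_L_op_increment[OF continuous_on_subset[OF Xc[OF that]]]) auto
    then have "continuous_on UNIV (\<lambda>t. L_op r \<eta> (\<lambda>\<theta>. X z (max 0 t + \<theta>) - X z \<theta>))"
      by (rule continuous_on_compose2) (auto intro!: continuous_intros)
    then show ?thesis unfolding T_def by (intro continuous_intros)
  qed
  have Jdiff: "norm (J z u - J z' u) \<le> K * (exp (l * u) / l)"
    if z: "continuous_on UNIV z" "continuous_on UNIV z'" and u: "0 \<le> u" and K: "\<And>s. norm (z s - z' s) \<le> K" for z z' u K
  proof -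
    have K0: "0 \<le> K" by (rule order_trans[OF norm_ge_zero K])
    have "norm (J z u - J z' u) = norm (integral {0..u} (\<lambda>s. exp (l * s) *\<^sub>R (z s - z' s)))"
      unfolding J_def using Zi[OF z(1), of 0 u] Zi[OF z(2), of 0 u] by (simp add: scaleR_diff_right integral_diff)
    also have "\<dots> \<le> integral {0..u} (\<lambda>s. K * exp (l * s))"
    proof (rule integral_norm_bound_integral)
      show "(\<lambda>s. exp (l * s) *\<^sub>R (z s - z' s)) integrable_on {0..u}"
        by (rule Zi) (intro continuous_intros z)
      show "(\<lambda>s. K * exp (l * s)) integrable_on {0..u}"
        using has_integral_exp_scaled[OF l(1) u] by (intro integrable_on_mult_right has_integral_integrable)
      show "norm (exp (l * s) *\<^sub>R (z s - z' s)) \<le> K * exp (l * s)" for s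
        using mult_right_mono[OF K[of s], of "exp (l * s)"] by (simp add: mult.commute)
    qed
    also have "\<dots> = K * ((exp (l * u) - 1) / l)"
      using has_integral_exp_scaled[OF l(1) u] by (simp add: integral_unique)
    also have "\<dots> \<le> K * (exp (l * u) / l)"
      using K0 l by (intro mult_left_mono divide_right_mono) auto
    finally show ?thesis .
  qed
  have Tdiff: "norm (T z t - T z' t) \<le> K / 2"
    if z: "continuous_on UNIV z" "continuous_on UNIV z'" and K: "\<And>s. norm (z s - z' s) \<le> K" for z z' t K
  proof -
    define s where "s = max 0 t"
    have s: "0 \<le> s" by (simp add: s_def)
    have K0: "0 \<le> K" by (rule order_trans[OF norm_ge_zero K])
    have Lb: "norm (L_op r \<eta> (\<lambda>\<theta>. X z (s + \<theta>) - X z \<theta> - (X z' (s + \<theta>) - X z' \<theta>))) \<le> L_bound * (K * (exp (l * s) / l))"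
    proof (rule norm_L_op_le)
      show "continuous_on {-r..0} (\<lambda>\<theta>. X z (s + \<theta>) - X z \<theta> - (X z' (s + \<theta>) - X z' \<theta>))"
        by (rule continuous_on_diff[OF incr_c[OF z(1)] incr_c[OF z(2)]])
      fix \<theta> assume \<theta>: "\<theta> \<in> {-r..0}"
      have Xd: "X z u - X z' u = J z (max 0 u) - J z' (max 0 u)" for u by (simp add: X_def)
      have "max 0 \<theta> = 0" using \<theta> by simp
      then have J0: "J z (max 0 \<theta>) - J z' (max 0 \<theta>) = 0" by (simp add: J_def)
      have "X z (s + \<theta>) - X z \<theta> - (X z' (s + \<theta>) - X z' \<theta>) = (X z (s + \<theta>) - X z' (s + \<theta>)) - (X z \<theta> - X z' \<theta>)"
        by simp
      also have "\<dots> = J z (max 0 (s + \<theta>)) - J z' (max 0 (s + \<theta>))"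
        unfolding Xd J0 by simp
      finally have Xe: "X z (s + \<theta>) - X z \<theta> - (X z' (s + \<theta>) - X z' \<theta>) = J z (max 0 (s + \<theta>)) - J z' (max 0 (s + \<theta>))" .
      have "norm (X z (s + \<theta>) - X z \<theta> - (X z' (s + \<theta>) - X z' \<theta>)) \<le> K * (exp (l * max 0 (s + \<theta>)) / l)"
        unfolding Xe by (rule Jdiff[OF z(1) z(2) max.cobounded1 K])
      also have "\<dots> \<le> K * (exp (l * s) / l)"
      proof (intro mult_left_mono divide_right_mono K0 less_imp_le[OF l(1)])
        have "max 0 (s + \<theta>) \<le> s" using \<theta> s by simp
        then have "l * max 0 (s + \<theta>) \<le> l * s" by (rule mult_left_mono) (rule less_imp_le[OF l(1)])
        then show "exp (l * max 0 (s + \<theta>)) \<le> exp (l * s)" by (rule iffD2[OF exp_le_cancel_iff])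
      qed
      finally show "norm (X z (s + \<theta>) - X z \<theta> - (X z' (s + \<theta>) - X z' \<theta>)) \<le> K * (exp (l * s) / l)" .
    qed
    have "T z t - T z' t = exp (- l * s) *\<^sub>R (L_op r \<eta> (\<lambda>\<theta>. X z (s + \<theta>) - X z \<theta>) - L_op r \<eta> (\<lambda>\<theta>. X z' (s + \<theta>) - X z' \<theta>))"
      by (simp add: T_def s_def scaleR_diff_right scaleR_add_right)
    then have Teq: "T z t - T z' t = exp (- l * s) *\<^sub>R L_op r \<eta> (\<lambda>\<theta>. X z (s + \<theta>) - X z \<theta> - (X z' (s + \<theta>) - X z' \<theta>))"
      by (simp only: L_op_diff[OF incr_c[OF z(1)] incr_c[OF z(2)]])
    have "norm (T z t - T z' t) \<le> exp (- l * s) * (L_bound * (K * (exp (l * s) / l)))"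
      unfolding Teq norm_scaleR abs_exp_cancel by (rule mult_left_mono[OF Lb]) simp
    also have "\<dots> = (exp (- l * s) * exp (l * s)) * (L_bound / l * K)" by simp
    also have "exp (- l * s) * exp (l * s) = 1" by (simp add: exp_minus)
    also have "1 * (L_bound / l * K) \<le> K / 2" using mult_right_mono[OF l(2) K0] by simp
    finally show ?thesis .
  qed
  have T0: "norm (T (\<lambda>_. 0) t) \<le> norm (\<phi> 0) + L_bound * (2 * B)" for t
  proof -
    have "norm (L_op r \<eta> (\<lambda>\<theta>. X (\<lambda>_. 0) (max 0 t + \<theta>) - X (\<lambda>_. 0) \<theta>)) \<le> L_bound * (2 * B)"
    proof (rule norm_L_op_le[OF incr_c])
      fix \<theta> assume "\<theta> \<in> {-r..0}"
      show "norm (X (\<lambda>_. 0) (max 0 t + \<theta>) - X (\<lambda>_. 0) \<theta>) \<le> 2 * B"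
        unfolding X_def J_def
        using B[of "max (-r) (min 0 (max 0 t + \<theta>))"] B[of "max (-r) (min 0 \<theta>)"] r_pos
          norm_triangle_ineq4[of "\<Phi> (max (-r) (min 0 (max 0 t + \<theta>)))" "\<Phi> (max (-r) (min 0 \<theta>))"]
        by simp
    qed auto
    then have "norm (\<phi> 0 + L_op r \<eta> (\<lambda>\<theta>. X (\<lambda>_. 0) (max 0 t + \<theta>) - X (\<lambda>_. 0) \<theta>)) \<le> norm (\<phi> 0) + L_bound * (2 * B)"
      by (intro order_trans[OF norm_triangle_ineq]) simp
    moreover have "exp (- l * max 0 t) \<le> 1" using l by (simp add: mult_nonneg_nonneg)
    ultimately have "exp (- l * max 0 t) * norm (\<phi> 0 + L_op r \<eta> (\<lambda>\<theta>. X (\<lambda>_. 0) (max 0 t + \<theta>) - X (\<lambda>_. 0) \<theta>)) \<le> 1 * (norm (\<phi> 0) + L_bound * (2 * B))"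
      by (intro mult_mono) auto
    then show ?thesis by (simp add: T_def)
  qed
  have ac: "continuous_on UNIV (apply_bcontfun z)" for z :: "real \<Rightarrow>\<^sub>C (complex^'n)"
    using apply_bcontfun[of z] by (simp add: bcontfun_def)
  have Tb: "T (apply_bcontfun z) \<in> bcontfun" for z :: "real \<Rightarrow>\<^sub>C (complex^'n)"
  proof (rule bcontfun_normI[OF Tc[OF ac]])
    fix t
    have "norm (T (apply_bcontfun z) t - T (\<lambda>_. 0) t) \<le> norm z / 2"
      by (rule Tdiff[OF ac]) (auto simp: norm_bounded)
    then show "norm (T (apply_bcontfun z) t) \<le> norm (\<phi> 0) + L_bound * (2 * B) + norm z / 2"
      using T0[of t] norm_triangle_ineq2[of "T (apply_bcontfun z) t" "T (\<lambda>_. 0) t"] by linarith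
  qed
  have "\<exists>!z. Bcontfun (T (apply_bcontfun z)) = z"
  proof (rule banach_fix_type[of "1/2"])
    show "\<forall>z z'. dist (Bcontfun (T (apply_bcontfun z))) (Bcontfun (T (apply_bcontfun z'))) \<le> 1 / 2 * dist z z'"
    proof (intro allI dist_bound)
      fix z z' :: "real \<Rightarrow>\<^sub>C (complex^'n)" and t
      have "norm (T (apply_bcontfun z) t - T (apply_bcontfun z') t) \<le> dist z z' / 2"
        by (rule Tdiff[OF ac ac]) (use dist_bounded[of z _ z'] in \<open>auto simp: dist_norm\<close>)
      then show "dist (apply_bcontfun (Bcontfun (T (apply_bcontfun z))) t) (apply_bcontfun (Bcontfun (T (apply_bcontfun z'))) t) \<le> 1 / 2 * dist z z'"
        by (simp add: Bcontfun_inverse[OF Tb] dist_norm)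
    qed
  qed auto
  then obtain zb where "Bcontfun (T (apply_bcontfun zb)) = zb" by blast
  then have fixp: "T (apply_bcontfun zb) = apply_bcontfun zb"
    using Bcontfun_inverse[OF Tb, of zb] by simp
  define z where "z = apply_bcontfun zb"
  have zc: "continuous_on UNIV z" by (simp add: z_def ac)
  have zT: "T z = z" using fixp by (simp add: z_def)
  define x where "x t = (if 0 \<le> t then exp (l * t) *\<^sub>R z t else \<phi> t)" for t
  have x_eq: "x t = \<phi> 0 + L_op r \<eta> (\<lambda>\<theta>. X z (t + \<theta>) - X z \<theta>)" if "0 \<le> t" for t
  proof -
    have "x t = exp (l * t) *\<^sub>R T z t" using that by (simp add: x_def zT)
    also have "\<dots> = (exp (l * t) * exp (- l * t)) *\<^sub>R (\<phi> 0 + L_op r \<eta> (\<lambda>\<theta>. X z (t + \<theta>) - X z \<theta>))"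
      using that by (simp add: T_def max_absorb2)
    also have "exp (l * t) * exp (- l * t) = 1" by (simp add: exp_minus)
    finally show ?thesis by simp
  qed
  have x0: "x 0 = \<phi> 0" using x_eq[of 0] by (simp add: L_op_zero)
  have x_neg: "x u = \<phi> u" if "u \<le> 0" for u using that x0 by (cases "u = 0") (auto simp: x_def)
  have x_pos: "x u = exp (l * u) *\<^sub>R z u" if "0 \<le> u" for u using that by (simp add: x_def)
  have ai: "x absolutely_integrable_on {-r..S}" for S
  proof -
    have 1: "x absolutely_integrable_on {-r..0}"
      by (rule absolutely_integrable_spike[OF \<phi> negligible_empty]) (simp add: x_neg)
    have "continuous_on {0..max 0 S} x"
      by (rule continuous_on_eq[where f = "\<lambda>u. exp (l * u) *\<^sub>R z u"])
         (auto simp: x_pos intro!: continuous_intros continuous_on_subset[OF zc])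
    then have 2: "x absolutely_integrable_on {0..max 0 S}" by (rule absolutely_integrable_continuous_real)
    have "x absolutely_integrable_on {-r..max 0 S}"
      by (rule absolutely_integrable_on_combine[OF 1 2]) (use r_pos in auto)
    then show ?thesis by (rule absolutely_integrable_on_subinterval) auto
  qed
  have xi: "x integrable_on {a..b}" if "-r \<le> a" for a b
    using absolutely_integrable_on_subinterval[OF ai[of b], of a b] that by (simp add: absolutely_integrable_on_def)
  have X_eq: "integral {-r..u} x = X z u" if "-r \<le> u" for u
  proof (cases "u \<le> 0")
    case True
    have "integral {-r..u} x = integral {-r..u} \<phi>" using True by (intro integral_cong) (auto simp: x_neg)
    then show ?thesis using True that by (simp add: X_def \<Phi>_def J_def max_def min_def)
  next
    case False
    have "integral {-r..u} x = integral {-r..0} x + integral {0..u} x"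
      using False r_pos xi[of "-r" u] by (intro Henstock_Kurzweil_Integration.integral_combine[symmetric]) auto
    also have "integral {-r..0} x = integral {-r..0} \<phi>" by (intro integral_cong) (auto simp: x_neg)
    also have "integral {0..u} x = J z u" unfolding J_def by (intro integral_cong) (auto simp: x_pos)
    finally show ?thesis using False r_pos by (simp add: X_def \<Phi>_def max_def min_def)
  qed
  have "x t = \<phi> 0 + L_op r \<eta> (\<lambda>\<theta>. integral {0..t} (\<lambda>s. x (s + \<theta>)))" if t: "0 \<le> t" for t
  proof -
    have "X z (t + \<theta>) - X z \<theta> = integral {0..t} (\<lambda>s. x (s + \<theta>))" if \<theta>: "\<theta> \<in> {-r..0}" for \<theta>
    proof -
      have "integral {0..t} (\<lambda>s. x (s + \<theta>)) = integral {\<theta>..t + \<theta>} x"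
        using integral_shift_real_ivl[of \<theta> \<theta> "t + \<theta>" x] by simp
      also have "\<dots> = integral {-r..t + \<theta>} x - integral {-r..\<theta>} x"
        using Henstock_Kurzweil_Integration.integral_combine[of "-r" \<theta> "t + \<theta>" x] xi[of "-r" "t + \<theta>"] \<theta> t by (simp add: algebra_simps)
      finally show ?thesis using X_eq \<theta> t by simp
    qed
    then show ?thesis unfolding x_eq[OF t] by (intro arg_cong2[of _ _ _ _ "(+)"] refl L_op_cong)
  qed
  moreover have "AE \<theta> in m_measure r. x \<theta> = \<phi> \<theta>"
    by (rule AE_I2) (simp add: m_measure_def x_neg)
  ultimately show ?thesis using ai unfolding is_mild_solution_def by blast
qed

end

section \<open>Properties of mild solutions and time reversal\<close>

lemma mild_solution_integrable:
  assumes "is_mild_solution r \<eta> \<phi> x" "-r \<le> a"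
  shows "x absolutely_integrable_on {a..b}" "x integrable_on {a..b}"
proof -
  have "x absolutely_integrable_on {-r..b}" using assms(1) by (simp add: is_mild_solution_def)
  then show "x absolutely_integrable_on {a..b}"
    by (rule absolutely_integrable_on_subinterval) (use assms(2) in auto)
  then show "x integrable_on {a..b}" by (simp add: absolutely_integrable_on_def)
qed

lemma integral_shift_eq_increment:
  fixes x :: "real \<Rightarrow> 'a::euclidean_space"
  assumes "x integrable_on {a..t + \<theta>}" "a \<le> \<theta>" "0 \<le> t"
  shows "integral {0..t} (\<lambda>s. x (s + \<theta>)) = integral {a..t + \<theta>} x - integral {a..\<theta>} x"
  using integral_shift_real_ivl[of \<theta> \<theta> "t + \<theta>" x] 
    Henstock_Kurzweil_Integration.integral_combine[of a \<theta> "t + \<theta>" x] assms by (simp add: algebra_simps)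

context stieltjes_kernel
begin

text \<open>The right-hand side of the equation involves \<open>x\<close> only through its primitive, which is continuous.\<close>

lemma mild_solution_continuous:
  assumes x: "is_mild_solution r \<eta> \<phi> x"
  shows "continuous_on {0..} x"
proof -
  define X where "X u = integral {-r..u} x" for u
  have X: "continuous_on {-r..} X"
    unfolding X_def by (rule continuous_on_indefinite_integral_atLeast) (rule mild_solution_integrable(2)[OF x order_refl])
  have "x t = \<phi> 0 + L_op r \<eta> (\<lambda>\<theta>. X (t + \<theta>) - X \<theta>)" if t: "t \<in> {0..}" for t
  proof -
    have "x t = \<phi> 0 + L_op r \<eta> (\<lambda>\<theta>. integral {0..t} (\<lambda>s. x (s + \<theta>)))"
      using x t by (simp add: is_mild_solution_def)
    moreover have "L_op r \<eta> (\<lambda>\<theta>. integral {0..t} (\<lambda>s. x (s + \<theta>))) = L_op r \<eta> (\<lambda>\<theta>. X (t + \<theta>) - X \<theta>)"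
      unfolding X_def using t by (intro L_op_cong integral_shift_eq_increment mild_solution_integrable(2)[OF x]) auto
    ultimately show ?thesis by simp
  qed
  moreover have "continuous_on {0..} (\<lambda>t. \<phi> 0 + L_op r \<eta> (\<lambda>\<theta>. X (t + \<theta>) - X \<theta>))"
    by (intro continuous_on_add continuous_on_const continuous_on_L_op_increment X)
  ultimately show ?thesis by (subst continuous_on_cong[OF refl]) 
qed

lemma mild_solution_at_0:
  assumes x: "is_mild_solution r \<eta> \<phi> x"
  shows "x 0 = \<phi> 0"
  using x by (simp add: is_mild_solution_def L_op_zero)

lemma mild_solution_history:
  assumes x: "is_mild_solution r \<eta> \<phi> x"
  obtains N where "negligible N" "\<And>\<theta>. \<theta> \<in> {-r..0} - N \<Longrightarrow> x \<theta> = \<phi> \<theta>"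
proof -
  have "AE \<theta> in lebesgue_plus_dirac {-r..0}. x \<theta> = \<phi> \<theta>"
    using x unfolding is_mild_solution_def m_measure_def by blast
  then have "AE \<theta> in lebesgue_on {-r..0}. x \<theta> = \<phi> \<theta>"
    using AE_lebesgue_plus_dirac_iff[of "{-r..0}" "\<lambda>\<theta>. x \<theta> = \<phi> \<theta>"] left_le by auto
  then have "AE \<theta> in lebesgue. \<theta> \<in> {-r..0} \<longrightarrow> x \<theta> = \<phi> \<theta>"
    by (subst (asm) AE_restrict_space_iff) auto
  then obtain N where "negligible N" "{\<theta>. \<not> (\<theta> \<in> {-r..0} \<longrightarrow> x \<theta> = \<phi> \<theta>)} \<subseteq> N"
    unfolding eventually_ae_filter_negligible by blast
  then show thesis using that[of N] by blast
qed

lemma mild_solution_Lp_on: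
  assumes x: "is_mild_solution r \<eta> \<phi> x" and \<phi>: "Lp_on (-r) 0 p \<phi>" and p: "0 \<le> p"
  shows "Lp_on (-r) T p x"
proof -
  define S where "S = max 0 T"
  obtain N where N: "negligible N" "\<And>\<theta>. \<theta> \<in> {-r..0} - N \<Longrightarrow> x \<theta> = \<phi> \<theta>"
    using mild_solution_history[OF x] by blast
  have 1: "(\<lambda>\<theta>. norm (x \<theta>) powr p) integrable_on {-r..0}"
    by (rule integrable_spike[OF _ N(1)]) (use \<phi> N(2) in \<open>auto simp: Lp_on_def\<close>)
  have "Lp_on 0 S p x"
    by (rule Lp_on_continuous[OF continuous_on_subset[OF mild_solution_continuous[OF x]] p]) auto
  then have 2: "(\<lambda>\<theta>. norm (x \<theta>) powr p) integrable_on {0..S}" by (simp add: Lp_on_def)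
  have "(\<lambda>\<theta>. norm (x \<theta>) powr p) integrable_on {-r..S}"
    by (rule Henstock_Kurzweil_Integration.integrable_combine[OF _ _ 1 2]) (use left_le in \<open>auto simp: S_def\<close>)
  moreover have "x \<in> borel_measurable (lebesgue_on {-r..S})"
    by (rule absolutely_integrable_imp_borel_measurable[OF mild_solution_integrable(1)[OF x order_refl]]) simp
  ultimately have "Lp_on (-r) S p x" by (simp add: Lp_on_def)
  then show ?thesis by (rule Lp_on_subinterval) (auto simp: S_def)
qed

lemma stieltjes_kernel_transpose: "stieltjes_kernel r (\<lambda>\<theta>. transpose (\<eta> \<theta>)) W"
  by (rule stieltjes_kernel.intro[OF r_pos]) (simp add: transpose_def dominated_entry)

lemma L_star_eq_L_op: "L_star r \<eta> \<psi> = L_op r (\<lambda>\<theta>. transpose (\<eta> \<theta>)) (\<lambda>\<theta>. \<psi> (-\<theta>))"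
  by (simp add: L_star_def L_op_def RS_integral_row_def RS_integral_col_def transpose_def)

lemma AE_m_star_measure_reflect:
  "(AE \<tau> in m_star_measure r. P \<tau>) \<longleftrightarrow> (AE \<theta> in m_measure r. P (-\<theta>))"
proof -
  have neg: "negligible (uminus ` N)" if "negligible N" for N :: "real set"
    by (rule negligible_differentiable_image_negligible[OF _ that]) (auto intro!: derivative_intros)
  have eq: "(AE x in lebesgue. x \<in> {0..r} \<longrightarrow> P x) \<longleftrightarrow> (AE x in lebesgue. x \<in> {-r..0} \<longrightarrow> P (-x))"
    unfolding eventually_ae_filter_negligible
  proof safe
    fix N assume N: "negligible N" "{x. \<not> (x \<in> {0..r} \<longrightarrow> P x)} \<subseteq> N"
    have "{x. \<not> (x \<in> {-r..0} \<longrightarrow> P (-x))} \<subseteq> uminus ` N"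
    proof
      fix x assume "x \<in> {x. \<not> (x \<in> {-r..0} \<longrightarrow> P (-x))}"
      then have "-x \<in> N" using N(2) by auto
      then show "x \<in> uminus ` N" by (metis image_eqI minus_minus)
    qed
    then show "\<exists>N. negligible N \<and> {x. \<not> (x \<in> {-r..0} \<longrightarrow> P (-x))} \<subseteq> N" using neg[OF N(1)] by blast
  next
    fix N assume N: "negligible N" "{x. \<not> (x \<in> {-r..0} \<longrightarrow> P (-x))} \<subseteq> N"
    have "{x. \<not> (x \<in> {0..r} \<longrightarrow> P x)} \<subseteq> uminus ` N"
    proof
      fix x assume "x \<in> {x. \<not> (x \<in> {0..r} \<longrightarrow> P x)}"
      then have "-x \<in> N" using N(2) by auto
      then show "x \<in> uminus ` N" by (metis image_eqI minus_minus)
    qed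
    then show "\<exists>N. negligible N \<and> {x. \<not> (x \<in> {0..r} \<longrightarrow> P x)} \<subseteq> N" using neg[OF N(1)] by blast
  qed
  have 1: "(AE \<tau> in m_star_measure r. P \<tau>) \<longleftrightarrow> (AE x in lebesgue. x \<in> {0..r} \<longrightarrow> P x) \<and> P 0"
    unfolding m_star_measure_def using r_pos
    by (subst AE_lebesgue_plus_dirac_iff; (subst AE_restrict_space_iff)?; simp)
  have 2: "(AE \<theta> in m_measure r. P (-\<theta>)) \<longleftrightarrow> (AE x in lebesgue. x \<in> {-r..0} \<longrightarrow> P (-x)) \<and> P 0"
    unfolding m_measure_def using r_pos
    by (subst AE_lebesgue_plus_dirac_iff; (subst AE_restrict_space_iff)?; simp)
  show ?thesis unfolding 1 2 eq ..
qed

text \<open>Row vectors are acted on by the kernel from the right, which is the action of the transposed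
  kernel on column vectors; the sign in the adjoint equation is absorbed by the reversal of time.\<close>

lemma adjoint_mild_solution_iff:
  "is_adjoint_mild_solution r \<eta> \<psi> y \<longleftrightarrow>
     is_mild_solution r (\<lambda>\<theta>. transpose (\<eta> \<theta>)) (\<lambda>\<theta>. \<psi> (-\<theta>)) (\<lambda>t. y (-t))"
proof -
  interpret tr: stieltjes_kernel r "\<lambda>\<theta>. transpose (\<eta> \<theta>)" W by (rule stieltjes_kernel_transpose)
  define z where "z t = y (-t)" for t
  have ai: "(\<forall>T. y absolutely_integrable_on {T..r}) \<longleftrightarrow> (\<forall>T. z absolutely_integrable_on {-r..T})"
  proof -
    have *: "z absolutely_integrable_on {-r..-T} \<longleftrightarrow> y absolutely_integrable_on {T..r}" for T
      unfolding z_def by (rule absolutely_integrable_reflect_real)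
    show ?thesis
    proof safe
      fix T assume "\<forall>T. y absolutely_integrable_on {T..r}"
      then show "z absolutely_integrable_on {-r..T}" using *[of "-T"] by simp
    next
      fix T assume "\<forall>T. z absolutely_integrable_on {-r..T}"
      then show "y absolutely_integrable_on {T..r}" using *[of T] by simp
    qed
  qed
  have eqn: "(\<forall>t\<le>0. y t = \<psi> 0 - L_star r \<eta> (\<lambda>\<tau>. - integral {t..0} (\<lambda>s. y (s + \<tau>)))) \<longleftrightarrow>
      (\<forall>t\<ge>0. z t = \<psi> (-0) + L_op r (\<lambda>\<theta>. transpose (\<eta> \<theta>)) (\<lambda>\<theta>. integral {0..t} (\<lambda>s. z (s + \<theta>))))"
    if int: "\<forall>T. z absolutely_integrable_on {-r..T}"
  proof -
    have zi: "z integrable_on {-r..b}" for b using int by (simp add: absolutely_integrable_on_def)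
    have *: "\<psi> 0 - L_star r \<eta> (\<lambda>\<tau>. - integral {-t..0} (\<lambda>s. y (s + \<tau>))) =
       \<psi> (-0) + L_op r (\<lambda>\<theta>. transpose (\<eta> \<theta>)) (\<lambda>\<theta>. integral {0..t} (\<lambda>s. z (s + \<theta>)))" if t: "0 \<le> t" for t
    proof -
      have reversed: "integral {-t..0} (\<lambda>s. y (s - \<theta>)) = integral {0..t} (\<lambda>s. z (s + \<theta>))" for \<theta>
      proof -
        have zs: "z (s + \<theta>) = y (- s - \<theta>)" for s unfolding z_def by (rule arg_cong[of _ _ y]) simp
        have "integral {-t..-0} (\<lambda>s. y (- (- s) - \<theta>)) = integral {0..t} (\<lambda>s. y (- s - \<theta>))"
          by (rule Henstock_Kurzweil_Integration.integral_reflect_real)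
        then show ?thesis unfolding zs by simp
      qed
      have cont: "continuous_on {-r..0} (\<lambda>\<theta>. integral {0..t} (\<lambda>s. z (s + \<theta>)))"
      proof (rule continuous_on_eq)
        have Zc: "continuous_on {-r..} (\<lambda>u. integral {-r..u} z)"
          by (rule continuous_on_indefinite_integral_atLeast[OF zi])
        show "continuous_on {-r..0} (\<lambda>\<theta>. integral {-r..t + \<theta>} z - integral {-r..\<theta>} z)"
          by (intro continuous_on_diff continuous_on_compose2[OF Zc] continuous_intros) (use t in auto)
        show "\<And>\<theta>. \<theta> \<in> {-r..0} \<Longrightarrow> integral {-r..t + \<theta>} z - integral {-r..\<theta>} z = integral {0..t} (\<lambda>s. z (s + \<theta>))"
          using t zi by (intro integral_shift_eq_increment[symmetric]) auto
      qed
      have "L_star r \<eta> (\<lambda>\<tau>. - integral {-t..0} (\<lambda>s. y (s + \<tau>))) = L_op r (\<lambda>\<theta>. transpose (\<eta> \<theta>)) (\<lambda>\<theta>. 0 - integral {0..t} (\<lambda>s. z (s + \<theta>)))"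
        by (simp add: L_star_eq_L_op reversed)
      also have "\<dots> = - L_op r (\<lambda>\<theta>. transpose (\<eta> \<theta>)) (\<lambda>\<theta>. integral {0..t} (\<lambda>s. z (s + \<theta>)))"
        by (subst tr.L_op_diff[OF continuous_on_const cont]) (simp add: tr.L_op_zero)
      finally show ?thesis by simp
    qed
    have "(\<forall>t\<le>0. y t = \<psi> 0 - L_star r \<eta> (\<lambda>\<tau>. - integral {t..0} (\<lambda>s. y (s + \<tau>)))) \<longleftrightarrow>
      (\<forall>t\<ge>0. y (-t) = \<psi> 0 - L_star r \<eta> (\<lambda>\<tau>. - integral {-t..0} (\<lambda>s. y (s + \<tau>))))"
    proof safe
      fix t :: real assume h: "\<forall>t\<ge>0. y (-t) = \<psi> 0 - L_star r \<eta> (\<lambda>\<tau>. - integral {-t..0} (\<lambda>s. y (s + \<tau>)))" "t \<le> 0"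
      then show "y t = \<psi> 0 - L_star r \<eta> (\<lambda>\<tau>. - integral {t..0} (\<lambda>s. y (s + \<tau>)))"
        using h(1)[rule_format, of "-t"] by simp
    qed simp
    also have "\<dots> \<longleftrightarrow> (\<forall>t\<ge>0. z t = \<psi> (-0) + L_op r (\<lambda>\<theta>. transpose (\<eta> \<theta>)) (\<lambda>\<theta>. integral {0..t} (\<lambda>s. z (s + \<theta>))))"
      unfolding z_def[of "t" for t, symmetric] by (intro all_cong) (simp only: *)
    finally show ?thesis .
  qed
  show ?thesis
    unfolding is_adjoint_mild_solution_def is_mild_solution_def AE_m_star_measure_reflect ai z_def[symmetric]
    by (rule conj_cong[OF refl], rule conj_cong[OF refl], rule eqn)
qed

end

section \<open>Convolution\<close>

text \<open>Both sides are the integral of \<open>k s u * b u\<close> over the triangle \<open>0 \<le> u \<le> s \<le> t\<close>.\<close>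

lemma triangle_Fubini:
  fixes k :: "real \<Rightarrow> real \<Rightarrow> complex" and b :: "real \<Rightarrow> complex"
  assumes k: "continuous_on UNIV (\<lambda>(s, u). k s u)" and b: "b absolutely_integrable_on {0..t}"
  shows "integral {0..t} (\<lambda>s. integral {0..s} (\<lambda>u. k s u * b u)) = integral {0..t} (\<lambda>u. integral {u..t} (\<lambda>s. k s u) * b u)"
proof -
  define M where "M = lebesgue_on {0..t}"
  interpret M: finite_measure M unfolding M_def by (rule finite_measure_lebesgue_on) simp
  interpret P: pair_sigma_finite M M ..
  have id_m [measurable]: "(\<lambda>x. x) \<in> borel_measurable M"
    unfolding M_def by (simp add: measurable_restrict_space1 measurable_completion)
  have bI: "integrable M b" unfolding M_def by (rule absolutely_integrable_imp_integrable[OF b]) simp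
  have [measurable]: "b \<in> borel_measurable M" using bI by simp
  have kb: "(\<lambda>(s, u). k s u) \<in> borel_measurable (borel \<Otimes>\<^sub>M borel)"
    using borel_measurable_continuous_onI[OF k] by (simp add: borel_prod)
  have [measurable]: "(\<lambda>z. k (fst z) (snd z)) \<in> borel_measurable (M \<Otimes>\<^sub>M M)"
    using measurable_compose[OF measurable_Pair[of fst "M \<Otimes>\<^sub>M M" borel snd borel] kb]
    by (simp add: measurable_compose[OF measurable_fst id_m] measurable_compose[OF measurable_snd id_m] case_prod_unfold)
  have "compact ((\<lambda>(s, u). k s u) ` ({0..t} \<times> {0..t}))"
    by (intro compact_continuous_image continuous_on_subset[OF k] compact_Times compact_Icc) auto
  then obtain K where K: "\<And>s u. s \<in> {0..t} \<Longrightarrow> u \<in> {0..t} \<Longrightarrow> norm (k s u) \<le> K"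
    by (fastforce dest!: compact_imp_bounded simp: bounded_iff)
  define G where "G z = (if snd z \<le> fst z then k (fst z) (snd z) * b (snd z) else 0)" for z
  have fs [measurable]: "fst \<in> borel_measurable (M \<Otimes>\<^sub>M M)" "snd \<in> borel_measurable (M \<Otimes>\<^sub>M M)"
    by (simp_all add: measurable_compose[OF measurable_fst id_m] measurable_compose[OF measurable_snd id_m])
  have [measurable]: "G \<in> borel_measurable (M \<Otimes>\<^sub>M M)" unfolding G_def by measurable
  have G_le: "norm (G (s, u)) \<le> norm (of_real K * b u)" if "s \<in> {0..t}" "u \<in> {0..t}" for s u
  proof -
    have "norm (k s u) * norm (b u) \<le> \<bar>K\<bar> * norm (b u)"
      by (intro mult_right_mono order_trans[OF K[OF that] abs_ge_self]) auto
    then show ?thesis by (simp add: G_def norm_mult)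
  qed
  have "integrable (M \<Otimes>\<^sub>M M) (\<lambda>z. b (snd z))"
    by (rule P.Fubini_integrable) (use bI in auto)
  then have "integrable (M \<Otimes>\<^sub>M M) (\<lambda>z. of_real K * b (snd z))" by simp
  then have GI: "integrable (M \<Otimes>\<^sub>M M) (case_prod (\<lambda>s u. G (s, u)))"
  proof (rule Bochner_Integration.integrable_bound)
    show "AE z in M \<Otimes>\<^sub>M M. norm (case z of (s, u) \<Rightarrow> G (s, u)) \<le> norm (of_real K * b (snd z))"
    proof (rule AE_I2)
      fix z assume "z \<in> space (M \<Otimes>\<^sub>M M)"
      then obtain s u where z: "z = (s, u)" "s \<in> {0..t}" "u \<in> {0..t}" by (auto simp: space_pair_measure M_def)
      show "norm (case z of (s, u) \<Rightarrow> G (s, u)) \<le> norm (of_real K * b (snd z))"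
        using G_le[OF z(2,3)] unfolding z(1) prod.case snd_conv .
    qed
  qed simp
  have slice: "(LINT u|M. F u) = integral {0..t} F"
    if "F \<in> borel_measurable M" "integrable M h" "\<And>u. u \<in> {0..t} \<Longrightarrow> norm (F u) \<le> norm (h u)" for F h :: "real \<Rightarrow> complex"
  proof -
    have "integrable M F"
      by (rule Bochner_Integration.integrable_bound[OF that(2,1)]) (use that(3) in \<open>auto intro!: AE_I2 simp: M_def\<close>)
    then show ?thesis unfolding M_def by (rule lebesgue_integral_eq_integral) simp
  qed
  have inner1: "(LINT u|M. G (s, u)) = integral {0..s} (\<lambda>u. k s u * b u)" if s: "s \<in> {0..t}" for s
  proof -
    have sub: "{0..s} \<subseteq> {0..t}" using s by auto
    have "(\<lambda>u. G (s, u)) \<in> borel_measurable M"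
      using measurable_compose[OF measurable_Pair1'[of s M M] \<open>G \<in> borel_measurable (M \<Otimes>\<^sub>M M)\<close>] s by (simp add: M_def)
    then have "(LINT u|M. G (s, u)) = integral {0..t} (\<lambda>u. G (s, u))"
      by (rule slice[OF _ integrable_mult_right G_le[OF s]]) (use bI in auto)
    also have "\<dots> = integral {0..t} (\<lambda>u. if u \<in> {0..s} then k s u * b u else 0)"
      by (intro integral_cong) (auto simp: G_def)
    also have "\<dots> = integral {0..s} (\<lambda>u. k s u * b u)"
      by (simp only: Henstock_Kurzweil_Integration.integral_restrict_Int Int_absorb2[OF sub])
    finally show ?thesis .
  qed
  have inner2: "(LINT s|M. G (s, u)) = integral {u..t} (\<lambda>s. k s u) * b u" if u: "u \<in> {0..t}" for u
  proof -
    have sub: "{u..t} \<subseteq> {0..t}" using u by auto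
    have "(\<lambda>s. G (s, u)) \<in> borel_measurable M"
      using measurable_compose[OF measurable_Pair2'[of u M M] \<open>G \<in> borel_measurable (M \<Otimes>\<^sub>M M)\<close>] u by (simp add: M_def)
    then have "(LINT s|M. G (s, u)) = integral {0..t} (\<lambda>s. G (s, u))"
      by (rule slice[where h = "\<lambda>_. of_real K * b u"]) (use G_le[OF _ u] in auto)
    also have "\<dots> = integral {0..t} (\<lambda>s. if s \<in> {u..t} then k s u * b u else 0)"
      by (intro integral_cong) (auto simp: G_def)
    also have "\<dots> = integral {u..t} (\<lambda>s. k s u * b u)"
      by (simp only: Henstock_Kurzweil_Integration.integral_restrict_Int Int_absorb2[OF sub])
    also have "\<dots> = integral {u..t} (\<lambda>s. k s u) * b u" by simp
    finally show ?thesis .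
  qed
  have "(LINT s|M. LINT u|M. G (s, u)) = integral {0..t} (\<lambda>s. LINT u|M. G (s, u))"
    using P.integrable_fst'[of "case_prod (\<lambda>s u. G (s, u))"] GI
    unfolding M_def by (intro lebesgue_integral_eq_integral) (auto simp: M_def)
  also have "\<dots> = integral {0..t} (\<lambda>s. integral {0..s} (\<lambda>u. k s u * b u))"
    by (rule integral_cong) (rule inner1)
  finally have A: "(LINT s|M. LINT u|M. G (s, u)) = integral {0..t} (\<lambda>s. integral {0..s} (\<lambda>u. k s u * b u))" .
  have "(LINT u|M. LINT s|M. G (s, u)) = integral {0..t} (\<lambda>u. LINT s|M. G (s, u))"
    using P.integrable_snd[OF GI]
    unfolding M_def by (intro lebesgue_integral_eq_integral) (auto simp: M_def)
  also have "\<dots> = integral {0..t} (\<lambda>u. integral {u..t} (\<lambda>s. k s u) * b u)"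
    by (rule integral_cong) (rule inner2)
  finally have B: "(LINT u|M. LINT s|M. G (s, u)) = integral {0..t} (\<lambda>u. integral {u..t} (\<lambda>s. k s u) * b u)" .
  show ?thesis using P.Fubini_integral[OF GI] A B by simp
qed

text \<open>This is \<open>a * b\<^sup>\<theta>\<close> with \<open>b\<^sup>\<theta> u = b (u + \<theta>)\<close>; for \<open>\<theta> < 0\<close> it involves values of \<open>b\<close> at negative times,
  where \<open>b\<close> need not be continuous.\<close>

definition shifted_convolution :: "(real \<Rightarrow> complex) \<Rightarrow> (real \<Rightarrow> complex) \<Rightarrow> real \<Rightarrow> real \<Rightarrow> complex" where
  "shifted_convolution a b s \<theta> = integral {0..s} (\<lambda>u. a (s - u) * b (u + \<theta>))"

lemma continuous_on_extend_left:
  fixes a :: "real \<Rightarrow> 'a::topological_space"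
  assumes "continuous_on {0..} a"
  shows "continuous_on UNIV (\<lambda>c. a (max 0 c))"
  by (rule continuous_on_compose2[OF assms]) (auto intro!: continuous_intros)

text \<open>The substitution \<open>v = u + \<theta>\<close> moves the shift into the continuous factor and into the limits
  of integration.\<close>

lemma shifted_convolution_continuous:
  assumes a: "continuous_on {0..} a" and b: "b absolutely_integrable_on {-r..T}" and r: "0 \<le> r"
  shows "continuous_on ({0..T} \<times> {-r..0}) (\<lambda>(s, \<theta>). shifted_convolution a b s \<theta>)"
proof -
  define a' where "a' c = a (max 0 c)" for c
  have a'c: "continuous_on UNIV a'" unfolding a'_def by (rule continuous_on_extend_left[OF a])
  define I where "I c u = integral {-r..u} (\<lambda>v. a' (c - v) * b v)" for c u
  have Ic: "continuous_on ({-r..T} \<times> {-r..T}) (\<lambda>(c, u). I c u)"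
    unfolding I_def
  proof (rule continuous_on_integral_upper_limit[OF compact_Icc _ b])
    show "continuous_on ({-r..T} \<times> {-r..T}) (\<lambda>(c, v). a' (c - v))"
      unfolding case_prod_unfold by (rule continuous_on_compose2[OF a'c]) (auto intro!: continuous_intros)
  qed
  have eq: "shifted_convolution a b s \<theta> = I (s + \<theta>) (s + \<theta>) - I (s + \<theta>) \<theta>" if "s \<in> {0..T}" "\<theta> \<in> {-r..0}" for s \<theta>
  proof -
    have "(\<lambda>v. a' (s + \<theta> - v) * b v) absolutely_integrable_on {-r..s + \<theta>}"
    proof (rule absolutely_integrable_bounded_measurable_product[OF bilinear_times])
      have c: "continuous_on {-r..s + \<theta>} (\<lambda>v. a' (s + \<theta> - v))"
        by (rule continuous_on_compose2[OF a'c]) (auto intro!: continuous_intros)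
      then show "(\<lambda>v. a' (s + \<theta> - v)) \<in> borel_measurable (lebesgue_on {-r..s + \<theta>})"
        by (rule continuous_imp_measurable_on_sets_lebesgue) simp
      show "bounded ((\<lambda>v. a' (s + \<theta> - v)) ` {-r..s + \<theta>})"
        by (intro compact_imp_bounded compact_continuous_image c compact_Icc)
      show "b absolutely_integrable_on {-r..s + \<theta>}"
        by (rule absolutely_integrable_on_subinterval[OF b]) (use that in auto)
    qed simp
    then have "(\<lambda>v. a' (s + \<theta> - v) * b v) integrable_on {-r..s + \<theta>}" by (simp add: absolutely_integrable_on_def)
    from integral_shift_eq_increment[OF this] that
    have "integral {0..s} (\<lambda>u. a' (s + \<theta> - (u + \<theta>)) * b (u + \<theta>)) = I (s + \<theta>) (s + \<theta>) - I (s + \<theta>) \<theta>"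
      by (simp add: I_def)
    moreover have "integral {0..s} (\<lambda>u. a' (s + \<theta> - (u + \<theta>)) * b (u + \<theta>)) = shifted_convolution a b s \<theta>"
      unfolding shifted_convolution_def a'_def by (intro integral_cong) (auto simp: max_def)
    ultimately show ?thesis by simp
  qed
  have "continuous_on ({0..T} \<times> {-r..0}) (\<lambda>z. case (fst z + snd z, fst z + snd z) of (c, u) \<Rightarrow> I c u)"
    by (rule continuous_on_compose2[OF Ic]) (auto intro!: continuous_intros)
  moreover have "continuous_on ({0..T} \<times> {-r..0}) (\<lambda>z. case (fst z + snd z, snd z) of (c, u) \<Rightarrow> I c u)"
    by (rule continuous_on_compose2[OF Ic]) (auto intro!: continuous_intros)
  ultimately have "continuous_on ({0..T} \<times> {-r..0}) (\<lambda>z. I (fst z + snd z) (fst z + snd z) - I (fst z + snd z) (snd z))"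
    by (simp add: continuous_on_diff)
  then show ?thesis
    by (rule continuous_on_eq) (auto simp: eq)
qed

text \<open>Associativity \<open>a * (1 * b\<^sup>\<theta>) = 1 * (a * b\<^sup>\<theta>)\<close>: after an exchange of integrations, both sides are
  the integral of \<open>b (u + \<theta>)\<close> against the primitive of \<open>a\<close> at \<open>t - u\<close>.\<close>

lemma shifted_convolution_integral:
  assumes a: "continuous_on {0..} a" and b: "b absolutely_integrable_on {\<theta>..t + \<theta>}"
  shows "integral {0..t} (\<lambda>u. a (t - u) * integral {0..u} (\<lambda>s. b (s + \<theta>)))
    = integral {0..t} (\<lambda>s. shifted_convolution a b s \<theta>)"
proof -
  define a' where "a' c = a (max 0 c)" for c
  have a'c: "continuous_on UNIV a'" unfolding a'_def by (rule continuous_on_extend_left[OF a])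
  have b': "(\<lambda>u. b (u + \<theta>)) absolutely_integrable_on {0..t}"
    using absolutely_integrable_shift[where f = b and c = \<theta> and a = \<theta> and b = "t + \<theta>"] b by simp
  have k1: "continuous_on UNIV (\<lambda>(s::real, u::real). a' (s - u))"
    unfolding case_prod_unfold by (rule continuous_on_compose2[OF a'c]) (auto intro!: continuous_intros)
  have k2: "continuous_on UNIV (\<lambda>(s::real, u::real). a' (t - s))"
    unfolding case_prod_unfold by (rule continuous_on_compose2[OF a'c]) (auto intro!: continuous_intros)
  have i1: "integral {u..t} (\<lambda>s. a' (s - u)) = integral {0..t - u} a'" for u
    using integral_shift_real_ivl[of 0 "-u" "t - u" a'] by simp
  have i2: "integral {u..t} (\<lambda>s. a' (t - s)) = integral {0..t - u} a'" for u
    using integral_reflect_at(1)[of t "t - u" 0 a'] by simp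
  have "integral {0..t} (\<lambda>u. a (t - u) * integral {0..u} (\<lambda>s. b (s + \<theta>)))
     = integral {0..t} (\<lambda>s. integral {0..s} (\<lambda>u. a' (t - s) * b (u + \<theta>)))"
    by (intro integral_cong) (simp add: a'_def)
  also have "\<dots> = integral {0..t} (\<lambda>u. integral {0..t - u} a' * b (u + \<theta>))"
    unfolding triangle_Fubini[OF k2 b'] i2 ..
  also have "\<dots> = integral {0..t} (\<lambda>s. integral {0..s} (\<lambda>u. a' (s - u) * b (u + \<theta>)))"
    unfolding triangle_Fubini[OF k1 b'] i1 ..
  also have "\<dots> = integral {0..t} (\<lambda>s. shifted_convolution a b s \<theta>)"
    unfolding shifted_convolution_def a'_def by (intro integral_cong) (auto simp: max_def)
  finally show ?thesis .
qed

text \<open>Convolution with \<open>a\<close> may be carried out under the Stieltjes integral, and the integration over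
  \<open>{0..t}\<close> that is hidden in the equation may be moved to the outside.\<close>

lemma convolution_RS_integral:
  assumes dom: "increments_dominated (-r) 0 g W" and r: "0 \<le> r"
    and a: "continuous_on {0..} a" and b: "\<And>T. b absolutely_integrable_on {-r..T}" and t: "0 \<le> t"
  shows "(\<lambda>u. a (t - u) * RS_integral (-r) 0 (\<lambda>\<theta>. integral {0..u} (\<lambda>s. b (s + \<theta>))) g) integrable_on {0..t}" (is ?I)
    and "(\<lambda>s. RS_integral (-r) 0 (shifted_convolution a b s) g) integrable_on {0..t}"
    and "integral {0..t} (\<lambda>u. a (t - u) * RS_integral (-r) 0 (\<lambda>\<theta>. integral {0..u} (\<lambda>s. b (s + \<theta>))) g)
      = integral {0..t} (\<lambda>s. RS_integral (-r) 0 (shifted_convolution a b s) g)" (is ?E)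
proof -
  have le: "-r \<le> (0::real)" using r by simp
  have bi: "b integrable_on {-r..T}" for T using b[of T] by (simp add: absolutely_integrable_on_def)
  define B where "B u = integral {-r..u} b" for u
  have Bc: "continuous_on {-r..} B" unfolding B_def by (rule continuous_on_indefinite_integral_atLeast[OF bi])
  define f where "f u \<theta> = a (t - u) * (B (u + \<theta>) - B \<theta>)" for u \<theta>
  have ac: "continuous_on ({0..t} \<times> {-r..0}) (\<lambda>z. a (t - fst z))"
    by (rule continuous_on_compose2[OF a]) (auto intro!: continuous_intros)
  have B1: "continuous_on ({0..t} \<times> {-r..0}) (\<lambda>z. B (fst z + snd z))"
    by (rule continuous_on_compose2[OF Bc]) (auto intro!: continuous_intros)
  have B2: "continuous_on ({0..t} \<times> {-r..0}) (\<lambda>z. B (snd z))"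
    by (rule continuous_on_compose2[OF Bc]) (auto intro!: continuous_intros)
  have fc: "continuous_on ({0..t} \<times> {-r..0}) (\<lambda>(u, \<theta>). f u \<theta>)"
    unfolding f_def case_prod_unfold by (intro continuous_on_mult continuous_on_diff ac B1 B2)
  have incr: "integral {0..u} (\<lambda>s. b (s + \<theta>)) = B (u + \<theta>) - B \<theta>" if "0 \<le> u" "\<theta> \<in> {-r..0}" for u \<theta>
    unfolding B_def using that by (intro integral_shift_eq_increment bi) auto
  have inner: "RS_integral (-r) 0 (f u) g = a (t - u) * RS_integral (-r) 0 (\<lambda>\<theta>. integral {0..u} (\<lambda>s. b (s + \<theta>))) g" if u: "u \<in> {0..t}" for u
  proof -
    have "continuous_on {-r..0} (\<lambda>\<theta>. B (u + \<theta>) - B \<theta>)"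
      using u by (intro continuous_on_diff continuous_on_compose2[OF Bc] continuous_intros) auto
    then have "RS_integral (-r) 0 (f u) g = a (t - u) * RS_integral (-r) 0 (\<lambda>\<theta>. B (u + \<theta>) - B \<theta>) g"
      unfolding f_def by (rule RS_integral_cmult[OF dom le])
    also have "RS_integral (-r) 0 (\<lambda>\<theta>. B (u + \<theta>) - B \<theta>) g = RS_integral (-r) 0 (\<lambda>\<theta>. integral {0..u} (\<lambda>s. b (s + \<theta>))) g"
      using incr u by (intro RS_integral_cong) auto
    finally show ?thesis .
  qed
  note S1 = RS_integral_swap[OF dom le fc]
  note S2 = RS_integral_swap[OF dom le shifted_convolution_continuous[OF a b r, of t]]
  show ?I using integrable_eq[OF S1(1) inner] .
  show "(\<lambda>s. RS_integral (-r) 0 (shifted_convolution a b s) g) integrable_on {0..t}" by (rule S2(1))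
  have "integral {0..t} (\<lambda>u. a (t - u) * RS_integral (-r) 0 (\<lambda>\<theta>. integral {0..u} (\<lambda>s. b (s + \<theta>))) g)
    = integral {0..t} (\<lambda>u. RS_integral (-r) 0 (f u) g)"
    by (intro integral_cong) (simp add: inner)
  also have "\<dots> = RS_integral (-r) 0 (\<lambda>\<theta>. integral {0..t} (\<lambda>u. f u \<theta>)) g" by (rule S1(2))
  also have "\<dots> = RS_integral (-r) 0 (\<lambda>\<theta>. integral {0..t} (\<lambda>s. shifted_convolution a b s \<theta>)) g"
  proof (rule RS_integral_cong)
    fix \<theta> assume \<theta>: "\<theta> \<in> {-r..0}"
    have "integral {0..t} (\<lambda>u. f u \<theta>) = integral {0..t} (\<lambda>u. a (t - u) * integral {0..u} (\<lambda>s. b (s + \<theta>)))"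
      using \<theta> by (intro integral_cong) (simp add: f_def incr)
    also have "\<dots> = integral {0..t} (\<lambda>s. shifted_convolution a b s \<theta>)"
      by (rule shifted_convolution_integral[OF a absolutely_integrable_on_subinterval[OF b[of "t + \<theta>"]]]) (use \<theta> in auto)
    finally show "integral {0..t} (\<lambda>u. f u \<theta>) = integral {0..t} (\<lambda>s. shifted_convolution a b s \<theta>)" .
  qed
  also have "\<dots> = integral {0..t} (\<lambda>s. RS_integral (-r) 0 (shifted_convolution a b s) g)" by (rule S2(2)[symmetric])
  finally show ?E .
qed

lemma continuous_zero_if_integrals_zero:
  fixes D :: "real \<Rightarrow> complex"
  assumes D: "\<And>T. continuous_on {0..T} D" and zero: "\<And>t. 0 \<le> t \<Longrightarrow> integral {0..t} D = 0" and t: "0 \<le> t"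
  shows "D t = 0"
proof -
  have "((\<lambda>u. integral {0..u} D) has_vector_derivative D t) (at t within {0..t+1})"
    by (rule integral_has_vector_derivative[OF D]) (use t in auto)
  then have "((\<lambda>u. 0) has_vector_derivative D t) (at t within {0..t+1})"
    by (rule has_vector_derivative_transform[rotated 2]) (use t zero in auto)
  moreover have "((\<lambda>u. 0) has_vector_derivative 0) (at t within {0..t+1})" by simp
  ultimately show ?thesis
    using vector_derivative_unique_within_closed_interval[of 0 "t+1" t "\<lambda>_. 0" "D t" 0] t by (simp add: cbox_interval)
qed

context stieltjes_kernel
begin

lemma mild_solution_component_integrable:
  assumes x: "is_mild_solution r \<eta> \<phi> x"
  shows "(\<lambda>s. x s $ i) absolutely_integrable_on {-r..T}"
  using absolutely_integrable_linear[OF mild_solution_integrable(1)[OF x order_refl] bounded_linear_vec_nth[of i]]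
  by (simp add: o_def)

lemma mild_solution_component:
  assumes x: "is_mild_solution r \<eta> \<phi> x" and t: "0 \<le> t"
  shows "x t $ i = x 0 $ i + (\<Sum>j\<in>UNIV. RS_integral (-r) 0 (\<lambda>\<theta>. integral {0..t} (\<lambda>s. x (s + \<theta>) $ j)) (\<lambda>\<theta>. \<eta> \<theta> $ i $ j))"
proof -
  have "x t = x 0 + L_op r \<eta> (\<lambda>\<theta>. integral {0..t} (\<lambda>s. x (s + \<theta>)))"
    using x t mild_solution_at_0[OF x] by (simp add: is_mild_solution_def)
  then have "x t $ i = (x 0 + L_op r \<eta> (\<lambda>\<theta>. integral {0..t} (\<lambda>s. x (s + \<theta>)))) $ i"
    by (rule arg_cong)
  then have "x t $ i = x 0 $ i + (\<Sum>j\<in>UNIV. RS_integral (-r) 0 (\<lambda>\<theta>. integral {0..t} (\<lambda>s. x (s + \<theta>)) $ j) (\<lambda>\<theta>. \<eta> \<theta> $ i $ j))"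
    unfolding vector_add_component L_op_component .
  moreover have "RS_integral (-r) 0 (\<lambda>\<theta>. integral {0..t} (\<lambda>s. x (s + \<theta>)) $ j) (\<lambda>\<theta>. \<eta> \<theta> $ i $ j)
      = RS_integral (-r) 0 (\<lambda>\<theta>. integral {0..t} (\<lambda>s. x (s + \<theta>) $ j)) (\<lambda>\<theta>. \<eta> \<theta> $ i $ j)" for j
  proof (rule RS_integral_cong)
    fix \<theta> assume "\<theta> \<in> {-r..0}"
    then have "(\<lambda>s. x (s + \<theta>)) integrable_on {0..t}"
      using integrable_shift_real_ivl[OF mild_solution_integrable(2)[OF x, of \<theta> "t + \<theta>"], of \<theta>] by simp
    from integral_linear[OF this bounded_linear_vec_nth[of j]]
    show "integral {0..t} (\<lambda>s. x (s + \<theta>)) $ j = integral {0..t} (\<lambda>s. x (s + \<theta>) $ j)" by (simp add: o_def)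
  qed
  ultimately show ?thesis by simp
qed

text \<open>The equation for \<open>x\<close> convolved with a continuous function.\<close>

lemma convolution_mild_solution:
  assumes x: "is_mild_solution r \<eta> \<phi> x" and a: "continuous_on {0..} a" and t: "0 \<le> t"
  shows "integral {0..t} (\<lambda>u. a (t - u) * x u $ i)
    = x 0 $ i * integral {0..t} a
      + (\<Sum>j\<in>UNIV. integral {0..t} (\<lambda>s. RS_integral (-r) 0 (shifted_convolution a (\<lambda>v. x v $ j) s) (\<lambda>\<theta>. \<eta> \<theta> $ i $ j)))"
proof -
  note C = convolution_RS_integral[OF dominated_entry less_imp_le[OF r_pos] a mild_solution_component_integrable[OF x] t]
  have ai: "(\<lambda>u. a (t - u)) integrable_on {0..t}"
    by (intro integrable_continuous_real continuous_on_compose2[OF a] continuous_intros) auto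
  have "integral {0..t} (\<lambda>u. a (t - u) * x u $ i)
    = integral {0..t} (\<lambda>u. a (t - u) * x 0 $ i
        + (\<Sum>j\<in>UNIV. a (t - u) * RS_integral (-r) 0 (\<lambda>\<theta>. integral {0..u} (\<lambda>s. x (s + \<theta>) $ j)) (\<lambda>\<theta>. \<eta> \<theta> $ i $ j)))"
  proof (rule integral_cong)
    fix u assume "u \<in> {0..t}"
    then have xu: "x u $ i = x 0 $ i + (\<Sum>j\<in>UNIV. RS_integral (-r) 0 (\<lambda>\<theta>. integral {0..u} (\<lambda>s. x (s + \<theta>) $ j)) (\<lambda>\<theta>. \<eta> \<theta> $ i $ j))"
      by (intro mild_solution_component[OF x]) simp
    show "a (t - u) * x u $ i = a (t - u) * x 0 $ i
        + (\<Sum>j\<in>UNIV. a (t - u) * RS_integral (-r) 0 (\<lambda>\<theta>. integral {0..u} (\<lambda>s. x (s + \<theta>) $ j)) (\<lambda>\<theta>. \<eta> \<theta> $ i $ j))"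
      by (subst xu) (simp only: distrib_left sum_distrib_left)
  qed
  also have "\<dots> = integral {0..t} (\<lambda>u. a (t - u) * x 0 $ i)
     + (\<Sum>j\<in>UNIV. integral {0..t} (\<lambda>u. a (t - u) * RS_integral (-r) 0 (\<lambda>\<theta>. integral {0..u} (\<lambda>s. x (s + \<theta>) $ j)) (\<lambda>\<theta>. \<eta> \<theta> $ i $ j)))"
    by (intro integral_unique has_integral_add has_integral_sum integrable_integral C(1) integrable_on_mult_left ai) auto
  also have "integral {0..t} (\<lambda>u. a (t - u) * x 0 $ i) = x 0 $ i * integral {0..t} a"
    using integral_reflect_at(1)[of t t 0 a] by simp
  finally show ?thesis unfolding C(3) .
qed

lemma continuous_on_RS_shifted_convolution:
  assumes "continuous_on {0..} a" "\<And>T. b absolutely_integrable_on {-r..T}"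
  shows "continuous_on {0..T} (\<lambda>s. RS_integral (-r) 0 (shifted_convolution a b s) (\<lambda>\<theta>. \<eta> \<theta> $ i $ j))"
  by (rule continuous_on_RS_integral_param[OF dominated_entry left_le
        shifted_convolution_continuous[OF assms less_imp_le[OF r_pos]]])

text \<open>The left-hand side is continuous in \<open>t\<close>.  Its integral over \<open>{0..T}\<close> vanishes: convolve the
  equation for \<open>x\<close> with \<open>z\<close> and the one for \<open>z\<close> with \<open>x\<close> and use that convolution is commutative.\<close>

lemma mild_solutions_reciprocity:
  assumes x: "is_mild_solution r \<eta> \<phi> x" and z: "is_mild_solution r (\<lambda>\<theta>. transpose (\<eta> \<theta>)) \<psi> z" and t: "0 \<le> t"
  shows "(\<Sum>i\<in>UNIV. z 0 $ i * x t $ i) - (\<Sum>i\<in>UNIV. z t $ i * x 0 $ i)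
     + (\<Sum>i\<in>UNIV. \<Sum>j\<in>UNIV. RS_integral (-r) 0 (shifted_convolution (\<lambda>v. x v $ j) (\<lambda>v. z v $ i) t) (\<lambda>\<theta>. \<eta> \<theta> $ i $ j)
         - RS_integral (-r) 0 (shifted_convolution (\<lambda>v. z v $ i) (\<lambda>v. x v $ j) t) (\<lambda>\<theta>. \<eta> \<theta> $ i $ j)) = 0"
proof -
  interpret tr: stieltjes_kernel r "\<lambda>\<theta>. transpose (\<eta> \<theta>)" W by (rule stieltjes_kernel_transpose)
  define P where "P i j s = RS_integral (-r) 0 (shifted_convolution (\<lambda>v. x v $ j) (\<lambda>v. z v $ i) s) (\<lambda>\<theta>. \<eta> \<theta> $ i $ j)" for i j s
  define Q where "Q i j s = RS_integral (-r) 0 (shifted_convolution (\<lambda>v. z v $ i) (\<lambda>v. x v $ j) s) (\<lambda>\<theta>. \<eta> \<theta> $ i $ j)" for i j s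
  define D where "D s = (\<Sum>i\<in>UNIV. z 0 $ i * x s $ i) - (\<Sum>i\<in>UNIV. z s $ i * x 0 $ i) + (\<Sum>i\<in>UNIV. \<Sum>j\<in>UNIV. P i j s - Q i j s)" for s
  have xc: "continuous_on {0..} (\<lambda>v. x v $ i)" for i by (rule continuous_on_component[OF mild_solution_continuous[OF x]])
  have zc: "continuous_on {0..} (\<lambda>v. z v $ i)" for i by (rule continuous_on_component[OF tr.mild_solution_continuous[OF z]])
  have Pc: "continuous_on {0..T} (P i j)" for i j T
    unfolding P_def by (rule continuous_on_RS_shifted_convolution[OF xc tr.mild_solution_component_integrable[OF z]])
  have Qc: "continuous_on {0..T} (Q i j)" for i j T
    unfolding Q_def by (rule continuous_on_RS_shifted_convolution[OF zc mild_solution_component_integrable[OF x]])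
  have xcT: "continuous_on {0..T} (\<lambda>v. x v $ i)" for i T by (rule continuous_on_subset[OF xc]) auto
  have zcT: "continuous_on {0..T} (\<lambda>v. z v $ i)" for i T by (rule continuous_on_subset[OF zc]) auto
  have Dc: "continuous_on {0..T} D" for T
    unfolding D_def by (intro continuous_intros Pc Qc xcT zcT)
  have "integral {0..T} D = 0" if T: "0 \<le> T" for T
  proof -
    have e1: "integral {0..T} (\<lambda>u. z (T - u) $ i * x u $ i) = x 0 $ i * integral {0..T} (\<lambda>v. z v $ i) + (\<Sum>j\<in>UNIV. integral {0..T} (Q i j))" for i
      using convolution_mild_solution[OF x zc T] by (simp add: Q_def[abs_def])
    have e2: "integral {0..T} (\<lambda>u. x (T - u) $ j * z u $ j) = z 0 $ j * integral {0..T} (\<lambda>v. x v $ j) + (\<Sum>i\<in>UNIV. integral {0..T} (P i j))" for j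
      using tr.convolution_mild_solution[OF z xc T] by (simp add: P_def[abs_def] transpose_def)
    have e3: "integral {0..T} (\<lambda>u. z (T - u) $ i * x u $ i) = integral {0..T} (\<lambda>u. x (T - u) $ i * z u $ i)" for i
      using integral_reflect_at(1)[of T T 0 "\<lambda>u. x (T - u) $ i * z u $ i"] by (simp add: mult.commute)
    have "(\<Sum>i\<in>UNIV. x 0 $ i * integral {0..T} (\<lambda>v. z v $ i)) + (\<Sum>i\<in>UNIV. \<Sum>j\<in>UNIV. integral {0..T} (Q i j))
        = (\<Sum>j\<in>UNIV. z 0 $ j * integral {0..T} (\<lambda>v. x v $ j)) + (\<Sum>j\<in>UNIV. \<Sum>i\<in>UNIV. integral {0..T} (P i j))"
      unfolding sum.distrib[symmetric] e1[symmetric] e2[symmetric] e3 ..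
    also have "(\<Sum>j\<in>UNIV. \<Sum>i\<in>UNIV. integral {0..T} (P i j)) = (\<Sum>i\<in>UNIV. \<Sum>j\<in>UNIV. integral {0..T} (P i j))"
      by (rule sum.swap)
    finally have bal0: "(\<Sum>i\<in>UNIV. x 0 $ i * integral {0..T} (\<lambda>v. z v $ i)) + (\<Sum>i\<in>UNIV. \<Sum>j\<in>UNIV. integral {0..T} (Q i j))
        = (\<Sum>j\<in>UNIV. z 0 $ j * integral {0..T} (\<lambda>v. x v $ j)) + (\<Sum>i\<in>UNIV. \<Sum>j\<in>UNIV. integral {0..T} (P i j))" .
    have rearrange: "c - a + (d - b) = 0" if "a + b = c + d" for a b c d :: complex
    proof -
      have "c - a + (d - b) = (c + d) - (a + b)" by simp
      then show ?thesis using that by simp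
    qed
    have bal: "(\<Sum>i\<in>UNIV. z 0 $ i * integral {0..T} (\<lambda>v. x v $ i)) - (\<Sum>i\<in>UNIV. integral {0..T} (\<lambda>v. z v $ i) * x 0 $ i)
        + ((\<Sum>i\<in>UNIV. \<Sum>j\<in>UNIV. integral {0..T} (P i j)) - (\<Sum>i\<in>UNIV. \<Sum>j\<in>UNIV. integral {0..T} (Q i j))) = 0"
      unfolding mult.commute[of "integral {0..T} (\<lambda>v. z v $ _)" "x 0 $ _"] by (rule rearrange[OF bal0])
    have PI: "((\<lambda>s. P i j s) has_integral integral {0..T} (P i j)) {0..T}" for i j
      by (intro integrable_integral integrable_continuous_real Pc)
    have QI: "((\<lambda>s. Q i j s) has_integral integral {0..T} (Q i j)) {0..T}" for i j
      by (intro integrable_integral integrable_continuous_real Qc)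
    have XI: "((\<lambda>s. x s $ i) has_integral integral {0..T} (\<lambda>v. x v $ i)) {0..T}" for i
      by (intro integrable_integral integrable_continuous_real xcT)
    have ZI: "((\<lambda>s. z s $ i) has_integral integral {0..T} (\<lambda>v. z v $ i)) {0..T}" for i
      by (intro integrable_integral integrable_continuous_real zcT)
    have "(D has_integral ((\<Sum>i\<in>UNIV. z 0 $ i * integral {0..T} (\<lambda>v. x v $ i)) - (\<Sum>i\<in>UNIV. integral {0..T} (\<lambda>v. z v $ i) * x 0 $ i)
        + (\<Sum>i\<in>UNIV. \<Sum>j\<in>UNIV. integral {0..T} (P i j) - integral {0..T} (Q i j)))) {0..T}"
      unfolding D_def
      by (intro has_integral_add has_integral_diff has_integral_sum has_integral_mult_right has_integral_mult_left PI QI XI ZI) auto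
    then show ?thesis using bal by (simp add: sum_subtractf integral_unique)
  qed
  from continuous_zero_if_integrals_zero[OF Dc this t] show ?thesis unfolding D_def P_def Q_def .
qed

end

section \<open>Duality of the solution operators\<close>

context delay_pairing
begin

text \<open>Boundedness makes the pairing blind to changes on null sets that avoid the point 0.\<close>

lemma pairing_cong_left:
  assumes \<psi>: "Lp_on 0 r q \<psi>" "Lp_on 0 r q \<psi>'" and \<phi>: "Lp_on (-r) 0 p \<phi>"
    and N: "negligible N" "\<And>\<tau>. \<tau> \<in> {0..r} - N \<Longrightarrow> \<psi> \<tau> = \<psi>' \<tau>" and 0: "\<psi> 0 = \<psi>' 0"
  shows "pairing r \<eta> \<psi> \<phi> = pairing r \<eta> \<psi>' \<phi>"
proof -
  have d: "Lp_on 0 r q (\<lambda>\<tau>. \<psi> \<tau> - \<psi>' \<tau>)" using Lp_on_diff[OF \<psi>] exponents by simp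
  have "integral {0..r} (\<lambda>\<tau>. norm (\<psi> \<tau> - \<psi>' \<tau>) powr q) = integral {0..r} (\<lambda>\<tau>. 0)"
    by (rule integral_spike[OF N(1)]) (simp add: N(2))
  then have "Lp_norm (m_star_measure r) q (\<lambda>\<tau>. \<psi> \<tau> - \<psi>' \<tau>) = 0"
    using 0 by (simp add: Lp_norm_m_star_measure[OF less_imp_le[OF r_pos] d])
  then have "pairing r \<eta> (\<lambda>\<tau>. \<psi> \<tau> - \<psi>' \<tau>) \<phi> = 0"
    using norm_pairing_le[OF d \<phi>] by simp
  then show ?thesis
    using extension_add_left[OF pairing_is_extension \<psi>(2) d \<phi>] by simp
qed

lemma pairing_cong_right:
  assumes \<psi>: "Lp_on 0 r q \<psi>" and \<phi>: "Lp_on (-r) 0 p \<phi>" "Lp_on (-r) 0 p \<phi>'"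
    and N: "negligible N" "\<And>\<theta>. \<theta> \<in> {-r..0} - N \<Longrightarrow> \<phi> \<theta> = \<phi>' \<theta>" and 0: "\<phi> 0 = \<phi>' 0"
  shows "pairing r \<eta> \<psi> \<phi> = pairing r \<eta> \<psi> \<phi>'"
proof -
  have d: "Lp_on (-r) 0 p (\<lambda>\<theta>. \<phi> \<theta> - \<phi>' \<theta>)" using Lp_on_diff[OF \<phi>] exponents by simp
  have "integral {-r..0} (\<lambda>\<theta>. norm (\<phi> \<theta> - \<phi>' \<theta>) powr p) = integral {-r..0} (\<lambda>\<theta>. 0)"
    by (rule integral_spike[OF N(1)]) (simp add: N(2))
  then have "Lp_norm (m_measure r) p (\<lambda>\<theta>. \<phi> \<theta> - \<phi>' \<theta>) = 0"
    using 0 by (simp add: Lp_norm_m_measure[OF less_imp_le[OF r_pos] d])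
  then have "pairing r \<eta> \<psi> (\<lambda>\<theta>. \<phi> \<theta> - \<phi>' \<theta>) = 0"
    using norm_pairing_le[OF \<psi> d] by simp
  then show ?thesis
    using extension_add_right[OF pairing_is_extension \<psi> \<phi>(2) d] by simp
qed

text \<open>All four terms are integrals of the single function \<open>u \<mapsto> b (t + \<theta> - u) * a u\<close>, over
  \<open>{t + \<theta>..t}\<close>, \<open>{\<theta>..0}\<close>, \<open>{0..t}\<close> and \<open>{\<theta>..t + \<theta>}\<close> respectively, and \<open>{\<theta>..t}\<close> is split in two ways.\<close>

lemma correlation_diff_eq_shifted_convolution_diff:
  fixes a b :: "real \<Rightarrow> complex"
  assumes b: "Lp_on (-r) t q b" and a: "Lp_on (-r) t p a" and \<theta>: "\<theta> \<in> {-r..0}" and t: "0 \<le> t"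
  shows "correlation (\<lambda>\<tau>. b (-\<tau>)) (\<lambda>\<xi>. a (t + \<xi>)) \<theta> - correlation (\<lambda>\<tau>. b (t - \<tau>)) a \<theta>
    = shifted_convolution a b t \<theta> - shifted_convolution b a t \<theta>"
proof -
  define Q where "Q u = b (t + \<theta> - u) * a u" for u
  have "Lp_on \<theta> t q b" by (rule Lp_on_subinterval[OF b]) (use \<theta> in auto)
  from Lp_on_reflect[OF this, of "t + \<theta>"] have "Lp_on \<theta> t q (\<lambda>u. b (t + \<theta> - u))" by simp
  moreover have "Lp_on \<theta> t p a" by (rule Lp_on_subinterval[OF a]) (use \<theta> in auto)
  ultimately have "Q absolutely_integrable_on {\<theta>..t}"
    unfolding Q_def by (intro Hoelder_inequality(1)[OF exponents])
  then have Qi: "Q integrable_on {\<theta>..t}" by (simp add: absolutely_integrable_on_def)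
  have c1: "correlation (\<lambda>\<tau>. b (-\<tau>)) (\<lambda>\<xi>. a (t + \<xi>)) \<theta> = integral {t + \<theta>..t} Q"
    using integral_shift_real_ivl[of "t + \<theta>" t t Q] by (simp add: correlation_def Q_def add.commute)
  have c2: "correlation (\<lambda>\<tau>. b (t - \<tau>)) a \<theta> = integral {\<theta>..0} Q"
    by (simp add: correlation_def Q_def[abs_def] diff_diff_eq2)
  have s1: "shifted_convolution b a t \<theta> = integral {\<theta>..t + \<theta>} Q"
    using integral_shift_real_ivl[of \<theta> \<theta> "t + \<theta>" Q] by (simp add: shifted_convolution_def Q_def)
  have s2: "shifted_convolution a b t \<theta> = integral {0..t} Q"
    using integral_reflect_at(1)[of t t 0 Q] by (simp add: shifted_convolution_def Q_def mult.commute add.commute)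
  have "integral {\<theta>..0} Q + integral {0..t} Q = integral {\<theta>..t} Q"
    by (rule Henstock_Kurzweil_Integration.integral_combine) (use \<theta> t Qi in auto)
  moreover have "integral {\<theta>..t + \<theta>} Q + integral {t + \<theta>..t} Q = integral {\<theta>..t} Q"
    by (rule Henstock_Kurzweil_Integration.integral_combine) (use \<theta> t Qi in auto)
  ultimately have "integral {t + \<theta>..t} Q - integral {\<theta>..0} Q = integral {0..t} Q - integral {\<theta>..t + \<theta>} Q"
    by (simp add: algebra_simps)
  then show ?thesis unfolding c1 c2 s1 s2 .
qed

lemma pairing_solutions_eq:
  assumes x: "is_mild_solution r \<eta> \<phi> x" and z: "is_mild_solution r (\<lambda>\<theta>. transpose (\<eta> \<theta>)) \<psi> z"
    and xL: "\<And>T. Lp_on (-r) T p x" and zL: "\<And>T. Lp_on (-r) T q z" and t: "0 \<le> t"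
  shows "pairing r \<eta> (\<lambda>\<tau>. z (-\<tau>)) (\<lambda>\<theta>. x (t + \<theta>)) = pairing r \<eta> (\<lambda>\<tau>. z (t - \<tau>)) x"
proof -
  interpret tr: stieltjes_kernel r "\<lambda>\<theta>. transpose (\<eta> \<theta>)" W by (rule stieltjes_kernel_transpose)
  have L1: "Lp_on 0 r q (\<lambda>\<tau>. z (s - \<tau>))" if "0 \<le> s" for s
  proof -
    have "Lp_on (s - r) s q z" by (rule Lp_on_subinterval[OF zL]) (use that in auto)
    from Lp_on_reflect[OF this, of s] show ?thesis by simp
  qed
  have L0: "Lp_on 0 r q (\<lambda>\<tau>. z (-\<tau>))" using L1[of 0] by simp
  have L2: "Lp_on (-r) 0 p (\<lambda>\<theta>. x (t + \<theta>))"
  proof -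
    have "Lp_on (t - r) t p x" by (rule Lp_on_subinterval[OF xL]) (use t in auto)
    from Lp_on_shift[OF this, of t] show ?thesis by (simp add: add.commute)
  qed
  have xc: "continuous_on {0..} (\<lambda>v. x v $ i)" for i by (rule continuous_on_component[OF mild_solution_continuous[OF x]])
  have zc: "continuous_on {0..} (\<lambda>v. z v $ i)" for i by (rule continuous_on_component[OF tr.mild_solution_continuous[OF z]])
  have sc1: "continuous_on {-r..0} (shifted_convolution (\<lambda>v. x v $ j) (\<lambda>v. z v $ i) t)" for i j
    by (rule continuous_on_curry1[OF shifted_convolution_continuous[OF xc tr.mild_solution_component_integrable[OF z] less_imp_le[OF r_pos]], of t t])
       (use t in simp)
  have sc2: "continuous_on {-r..0} (shifted_convolution (\<lambda>v. z v $ i) (\<lambda>v. x v $ j) t)" for i j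
    by (rule continuous_on_curry1[OF shifted_convolution_continuous[OF zc mild_solution_component_integrable[OF x] less_imp_le[OF r_pos]], of t t])
       (use t in simp)
  have RS: "RS_integral (-r) 0 (correlation (\<lambda>\<tau>. z (-\<tau>) $ i) (\<lambda>\<xi>. x (t + \<xi>) $ j)) (\<lambda>\<theta>. \<eta> \<theta> $ i $ j)
      - RS_integral (-r) 0 (correlation (\<lambda>\<tau>. z (t - \<tau>) $ i) (\<lambda>\<xi>. x \<xi> $ j)) (\<lambda>\<theta>. \<eta> \<theta> $ i $ j)
      = RS_integral (-r) 0 (shifted_convolution (\<lambda>v. x v $ j) (\<lambda>v. z v $ i) t) (\<lambda>\<theta>. \<eta> \<theta> $ i $ j)
         - RS_integral (-r) 0 (shifted_convolution (\<lambda>v. z v $ i) (\<lambda>v. x v $ j) t) (\<lambda>\<theta>. \<eta> \<theta> $ i $ j)" for i j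
    unfolding RS_integral_diff[OF dominated_entry left_le correlation_entry_continuous[OF L0 L2] correlation_entry_continuous[OF L1[OF t] xL], symmetric]
      RS_integral_diff[OF dominated_entry left_le sc1 sc2, symmetric]
  proof (rule RS_integral_cong)
    fix \<theta> assume \<theta>: "\<theta> \<in> {-r..0}"
    show "correlation (\<lambda>\<tau>. z (-\<tau>) $ i) (\<lambda>\<xi>. x (t + \<xi>) $ j) \<theta> - correlation (\<lambda>\<tau>. z (t - \<tau>) $ i) (\<lambda>\<xi>. x \<xi> $ j) \<theta>
      = shifted_convolution (\<lambda>v. x v $ j) (\<lambda>v. z v $ i) t \<theta> - shifted_convolution (\<lambda>v. z v $ i) (\<lambda>v. x v $ j) t \<theta>"
      by (rule correlation_diff_eq_shifted_convolution_diff[OF _ _ \<theta> t])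
         (use exponents in \<open>auto intro!: Lp_on_component zL xL\<close>)
  qed
  have "pairing r \<eta> (\<lambda>\<tau>. z (-\<tau>)) (\<lambda>\<theta>. x (t + \<theta>)) - pairing r \<eta> (\<lambda>\<tau>. z (t - \<tau>)) x
    = (\<Sum>i\<in>UNIV. z 0 $ i * x t $ i) - (\<Sum>i\<in>UNIV. z t $ i * x 0 $ i)
     + (\<Sum>i\<in>UNIV. \<Sum>j\<in>UNIV. RS_integral (-r) 0 (shifted_convolution (\<lambda>v. x v $ j) (\<lambda>v. z v $ i) t) (\<lambda>\<theta>. \<eta> \<theta> $ i $ j)
         - RS_integral (-r) 0 (shifted_convolution (\<lambda>v. z v $ i) (\<lambda>v. x v $ j) t) (\<lambda>\<theta>. \<eta> \<theta> $ i $ j))"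
    unfolding RS[symmetric] pairing_def row_col_mult_def by (simp add: sum_subtractf)
  also have "\<dots> = 0" by (rule mild_solutions_reciprocity[OF x z t])
  finally show ?thesis by simp
qed

lemma B_tilde_S_op_eq_S_star_op:
  assumes \<psi>: "Lp_on 0 r q \<psi>" and \<phi>: "Lp_on (-r) 0 p \<phi>" and t: "0 \<le> t"
  shows "B_tilde r \<eta> p q \<psi> (S_op r \<eta> t \<phi>) = B_tilde r \<eta> p q (S_star_op r \<eta> t \<psi>) \<phi>"
proof -
  interpret tr: stieltjes_kernel r "\<lambda>\<theta>. transpose (\<eta> \<theta>)" W by (rule stieltjes_kernel_transpose)
  define x where "x = mild_solution r \<eta> \<phi>"
  define z where "z t = adjoint_mild_solution r \<eta> \<psi> (-t)" for t
  have \<psi>': "Lp_on (-r) 0 q (\<lambda>\<theta>. \<psi> (-\<theta>))" using Lp_on_reflect[OF \<psi>, of 0] by simp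
  have x: "is_mild_solution r \<eta> \<phi> x"
    unfolding x_def mild_solution_def
    by (rule someI_ex[OF mild_solution_exists[OF Lp_on_imp_absolutely_integrable[OF \<phi>]]]) (use exponents in simp)
  obtain z0 where "is_mild_solution r (\<lambda>\<theta>. transpose (\<eta> \<theta>)) (\<lambda>\<theta>. \<psi> (-\<theta>)) z0"
    using tr.mild_solution_exists[OF Lp_on_imp_absolutely_integrable[OF \<psi>']] exponents by auto
  then have "is_adjoint_mild_solution r \<eta> \<psi> (\<lambda>t. z0 (-t))"
    unfolding adjoint_mild_solution_iff by simp
  then have "is_adjoint_mild_solution r \<eta> \<psi> (adjoint_mild_solution r \<eta> \<psi>)"
    unfolding adjoint_mild_solution_def by (rule someI[of "is_adjoint_mild_solution r \<eta> \<psi>"])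
  then have z: "is_mild_solution r (\<lambda>\<theta>. transpose (\<eta> \<theta>)) (\<lambda>\<theta>. \<psi> (-\<theta>)) z"
    unfolding adjoint_mild_solution_iff z_def .
  have xL: "Lp_on (-r) T p x" for T by (rule mild_solution_Lp_on[OF x \<phi>]) (use exponents in simp)
  have zL: "Lp_on (-r) T q z" for T by (rule tr.mild_solution_Lp_on[OF z \<psi>']) (use exponents in simp)
  have S: "S_op r \<eta> t \<phi> = (\<lambda>\<theta>. x (t + \<theta>))" by (simp add: S_op_def x_def)
  have S': "S_star_op r \<eta> t \<psi> = (\<lambda>\<tau>. z (t - \<tau>))" by (simp add: S_star_op_def z_def)
  have "Lp_on (t - r) t p x" by (rule Lp_on_subinterval[OF xL]) (use t in auto)
  from Lp_on_shift[OF this, of t] have xtL: "Lp_on (-r) 0 p (\<lambda>\<theta>. x (t + \<theta>))" by (simp add: add.commute)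
  have "Lp_on (t - r) t q z" by (rule Lp_on_subinterval[OF zL]) (use t in auto)
  from Lp_on_reflect[OF this, of t] have ztL: "Lp_on 0 r q (\<lambda>\<tau>. z (t - \<tau>))" by simp
  have z0L: "Lp_on 0 r q (\<lambda>\<tau>. z (-\<tau>))" using Lp_on_reflect[OF zL[of 0], of 0] by simp
  obtain N where N: "negligible N" "\<And>\<theta>. \<theta> \<in> {-r..0} - N \<Longrightarrow> z \<theta> = \<psi> (-\<theta>)"
    using tr.mild_solution_history[OF z] by blast
  have "negligible (uminus ` N)"
    by (rule negligible_differentiable_image_negligible[OF _ N(1)]) (auto intro!: derivative_intros)
  then have 1: "pairing r \<eta> \<psi> (\<lambda>\<theta>. x (t + \<theta>)) = pairing r \<eta> (\<lambda>\<tau>. z (-\<tau>)) (\<lambda>\<theta>. x (t + \<theta>))"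
  proof (rule pairing_cong_left[OF \<psi> z0L xtL])
    fix \<tau> assume \<tau>: "\<tau> \<in> {0..r} - uminus ` N"
    have "-\<tau> \<notin> N"
    proof
      assume "-\<tau> \<in> N"
      from imageI[OF this, of uminus] have "\<tau> \<in> uminus ` N" by simp
      with \<tau> show False by blast
    qed
    then show "\<psi> \<tau> = z (-\<tau>)" using N(2)[of "-\<tau>"] \<tau> by simp
  next
    show "\<psi> 0 = z (-0)" using tr.mild_solution_at_0[OF z] by simp
  qed
  obtain N' where N': "negligible N'" "\<And>\<theta>. \<theta> \<in> {-r..0} - N' \<Longrightarrow> x \<theta> = \<phi> \<theta>"
    using mild_solution_history[OF x] by blast
  have 2: "pairing r \<eta> (\<lambda>\<tau>. z (t - \<tau>)) x = pairing r \<eta> (\<lambda>\<tau>. z (t - \<tau>)) \<phi>"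
    by (rule pairing_cong_right[OF ztL xL \<phi> N' mild_solution_at_0[OF x]])
  show ?thesis
    unfolding S S' B_tilde_eq_pairing[OF \<psi> xtL] B_tilde_eq_pairing[OF ztL \<phi>] 1 2[symmetric]
    by (rule pairing_solutions_eq[OF x z xL zL t])
qed

end

theorem theorem5p10:
  fixes r p q :: real
    and \<eta> :: "real \<Rightarrow> complex^'n^'n"
  assumes "r > 0"
    and "bounded_variation_on (-r) 0 \<eta>"
    and "1 < p" and "1 / p + 1 / q = 1"
  shows "\<forall>\<psi>\<in>M_star_space r q. \<forall>\<phi>\<in>M_space r p. \<forall>t\<ge>0.
    B_tilde r \<eta> p q \<psi> (S_op r \<eta> t \<phi>) = B_tilde r \<eta> p q (S_star_op r \<eta> t \<psi>) \<phi>"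
proof -
  obtain W where W: "increments_dominated (-r) 0 \<eta> W"
    using bounded_variation_on_dominated[OF assms(2)] .
  have entry: "increments_dominated (-r) 0 (\<lambda>\<theta>. \<eta> \<theta> $ i $ j) W" for i j
    unfolding increments_dominated_def
  proof (intro allI impI)
    fix u v assume uv: "- r \<le> u \<and> u \<le> v \<and> v \<le> 0"
    have "norm (\<eta> v $ i $ j - \<eta> u $ i $ j) = norm ((\<eta> v - \<eta> u) $ i $ j)" by simp
    also have "\<dots> \<le> norm ((\<eta> v - \<eta> u) $ i)" by (rule Finite_Cartesian_Product.norm_nth_le)
    also have "\<dots> \<le> norm (\<eta> v - \<eta> u)" by (rule Finite_Cartesian_Product.norm_nth_le)
    also have "\<dots> \<le> W v - W u" using increments_dominatedD[OF W] uv by auto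
    finally show "norm (\<eta> v $ i $ j - \<eta> u $ i $ j) \<le> W v - W u" .
  qed
  interpret delay_pairing r \<eta> W p q
    by unfold_locales (use assms entry in auto)
  show ?thesis
    by (intro ballI allI impI B_tilde_S_op_eq_S_star_op) (simp_all add: space_iffs)
qed

end
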